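(* Let $C$ be a positive real-valued $Y$-$\Delta$ consistent conductance function, and let $f:\mathbb{Z}_{\le 0}^3\to\mathbb{R}_{>0}$ be the solution of the cube recurrence with $C^f=C$ and $f_{i,0,0}=f_{0,j,0}=f_{0,0,k}=1$ for all $i,j,k\in\mathbb{Z}_{\le 0}$. Then: (1) For every set of initial conditions $\mathcal{I}$, the element $g_{0,0,0}$ determined by the generalized cube recurrence as a function of the variables $(g_{i,j,k})_{(i,j,k)\in\mathcal{I}}$ satisfies $$g_{0,0,0}=\sum_{G\in\mathcal{G}(\mathcal{I})}\mathbb{P}^C_{\mathcal{I}}(G)\,m_g(G).$$ (2) For every set of initial conditions $\mathcal{I}$, grove shuffling, started from the unique grove on $\{(i,j,k)\in\mathbb{Z}_{\le 0}^3:\max\{i,j,k\}=0\}$ and run until the initial conditions are $\mathcal{I}$, generates a random $\mathcal{I}$-grove with distribution $\mathbb{P}^C_{\mathcal{I}}$, regardless of the order in which the cubes are shuffled. (3) For every set of initial conditions $\mathcal{I}$, the probability measures $\mathbb{P}^C_{\mathcal{I}}$ and $\mathbb{P}^f_{\mathcal{I}}$ are equal. (4) For every set of initial conditions $\mathcal{I}$, $$Z_{\mathcal{I}}=\prod\Delta(i,j,k),$$ where the product is over all $(i,j,k)$ such that the cube at $(i,j,k)$ is removed to reach $\mathcal{I}$.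
   Context: $\mathbb{Z}_{\le 0}$ denotes the nonpositive integers. **Initial conditions.** Let $\mathcal{L}\subseteq\mathbb{Z}_{\le 0}^3$ have finite complement $\mathcal{U}:=\mathbb{Z}_{\le 0}^3\setminus\mathcal{L}$ and be down-closed: $(i,j,k)\in\mathcal{L}$ and $i'\le i$, $j'\le j$, $k'\le k$ imply $(i',j',k')\in\mathcal{L}$. The associated set of initial conditions is $\mathcal{I}=\{(i,j,k)\in\mathcal{L}:(i+1,j+1,k+1)\notin\mathcal{L}\}$. **Rhombi.** For $(i,j,k)\in\mathbb{Z}_{\le 0}^3$ put $r_a(i,j,k)=\{(i,j,k),(i,j-1,k),(i,j,k-1),(i,j-1,k-1)\}$, $r_b(i,j,k)=\{(i,j,k),(i-1,j,k),(i,j,k-1),(i-1,j,k-1)\}$, $r_c(i,j,k)=\{(i,j,k),(i-1,j,k),(i,j-1,k),(i-1,j-1,k)\}$. Long diagonals: $E_a(i,j,k)=\{(i,j-1,k),(i,j,k-1)\}$, $E_b(i,j,k)=\{(i-1,j,k),(i,j,k-1)\}$, $E_c(i,j,k)=\{(i-1,j,k),(i,j-1,k)\}$. Short diagonals: $e_a(i,j,k)=\{(i,j,k),(i,j-1,k-1)\}$, $e_b(i,j,k)=\{(i,j,k),(i-1,j,k-1)\}$, $e_c(i,j,k)=\{(i,j,k),(i-1,j-1,k)\}$. A rhombus is in $\mathcal{I}$ if it is a subset of $\mathcal{I}$. **Groves.** Let $\Gamma_{\mathcal{I}}$ be the graph with vertex set $\mathcal{I}$ whose edges are the long and short diagonals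 of all rhombi in $\mathcal{I}$. An $\mathcal{I}$-grove is a subgraph $G$ of $\Gamma_{\mathcal{I}}$ such that: (i) its vertex set is $\mathcal{I}$; (ii) for each rhombus in $\mathcal{I}$ exactly one of its two diagonals is in $G$; (iii) there is $N$ such that whenever all vertices of a rhombus in $\mathcal{I}$ satisfy $i+j+k<-N$, its short diagonal is in $G$; (iv) for $N$ large enough, every component of $G$ contains exactly one of the following sets of vertices, and each such set is contained in some component of $G$: $\{(0,p,q),(p,0,q)\}$, $\{(p,q,0),(0,q,p)\}$, $\{(q,0,p),(q,p,0)\}$ for $0>p>q$ with $p+q\in\{-N-1,-N-2\}$; $\{(0,p,p),(p,0,p),(p,p,0)\}$ for $2p\in\{-N-1,-N-2\}$; $\{(0,0,q)\}$, $\{(0,q,0)\}$, $\{(q,0,0)\}$ for $q\le -N-1$. The set of $\mathcal{I}$-groves is $\mathcal{G}(\mathcal{I})$. For a function $g$ on $\mathcal{I}$, $m_g(G)=\prod_{(i,j,k)\in\mathcal{I}}g_{i,j,k}^{\deg_G(i,j,k)-2}$. **Conductances.** A conductance function assigns to each long diagonal $E_q(i,j,k)$ a value $C_q(i,j,k)$ and to each short diagonal the value $c_q(i,j,k)=1/C_q(i,j,k)$ ($q\in\{a,b,c\}$, $(i,j,k)\in\mathbb{Z}_{\le 0}^3$). It is $Y$-$\Delta$ consistent if for all $(i,j,k)\in\mathbb{Z}_{\le0}^3$, the three quantities $C_a(i,j,k)c_a(i-1,j,k)$, $C_b(i,j,k)c_b(i,j-1,k)$, $C_c(i,j,k)c_c(i,j,k-1)$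 all equal $C_a(i,j,k)C_b(i,j,k)+C_a(i,j,k)C_c(i,j,k)+C_b(i,j,k)C_c(i,j,k)$. For positive $C$, put $w(G)=\prod_{E_q(i,j,k)\in G}C_q(i,j,k)$ (product over long diagonals in $G$), $Z_{\mathcal{I}}=\sum_{G\in\mathcal{G}(\mathcal{I})}w(G)$, and $\mathbb{P}^C_{\mathcal{I}}(G)=w(G)/Z_{\mathcal{I}}$. **Cube recurrence.** $f:\mathbb{Z}_{\le 0}^3\to\mathbb{R}_{>0}$ satisfies the cube recurrence if for all $(i,j,k)\in\mathbb{Z}_{\le0}^3$, $f_{i,j,k}f_{i-1,j-1,k-1}=f_{i-1,j,k}f_{i,j-1,k-1}+f_{i,j-1,k}f_{i-1,j,k-1}+f_{i,j,k-1}f_{i-1,j-1,k}$. Then $\mathbb{P}^f_{\mathcal{I}}(G)=m_f(G)/f_{0,0,0}$, a probability measure on $\mathcal{G}(\mathcal{I})$, and $C^f$ is the conductance function $$C^f_a(i,j,k)=\tfrac{f_{i,j-1,k}f_{i,j,k-1}}{f_{i,j,k}f_{i,j-1,k-1}},\quad C^f_b(i,j,k)=\tfrac{f_{i-1,j,k}f_{i,j,k-1}}{f_{i,j,k}f_{i-1,j,k-1}},\quad C^f_c(i,j,k)=\tfrac{f_{i-1,j,k}f_{i,j-1,k}}{f_{i,j,k}f_{i-1,j-1,k}}.$$ A solution $f$ with $C^f=C$ and value $1$ on the three coordinate axes exists and is unique for each positive $Y$-$\Delta$ consistent $C$. **Generalized cube recurrence.** Put $\Delta(i,j,k)=C_b(i,j-1,k)C_c(i,j,k-1)+C_a(i-1,j,k)C_c(i,j,k-1)+C_a(i-1,j,k)C_b(i,j-1,k)$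 and $U(i,j,k)=\frac{C_b(i,j-1,k)C_c(i,j,k-1)}{\Delta(i,j,k)}$, $V(i,j,k)=\frac{C_a(i-1,j,k)C_c(i,j,k-1)}{\Delta(i,j,k)}$, $W(i,j,k)=\frac{C_a(i-1,j,k)C_b(i,j-1,k)}{\Delta(i,j,k)}$. The generalized cube recurrence is $$g_{i,j,k}g_{i-1,j-1,k-1}=U(i,j,k)g_{i-1,j,k}g_{i,j-1,k-1}+V(i,j,k)g_{i,j-1,k}g_{i-1,j,k-1}+W(i,j,k)g_{i,j,k-1}g_{i-1,j-1,k}.$$ Given $\mathcal{I}$, one takes $(g_v)_{v\in\mathcal{I}}$ as independent variables and solves recursively for $g_v$, $v\in\mathcal{U}$ (using the recurrence at $(i,j,k)\in\mathcal{U}$), in particular for $g_{0,0,0}$. **Grove shuffling.** Suppose $\mathcal{I}'$ is the set of initial conditions of $\mathcal{L}'$ and $r_a(i,j,k),r_b(i,j,k),r_c(i,j,k)\subset\mathcal{I}'$. Removing (shuffling) the cube at $(i,j,k)$ replaces $\mathcal{L}'$ by $\mathcal{L}'\setminus\{(i,j,k)\}$; the initial conditions lose $(i,j,k)$ and gain $(i-1,j-1,k-1)$, and the three rhombi above are replaced by $r_a(i-1,j,k)$, $r_b(i,j-1,k)$, $r_c(i,j,k-1)$. A grove $G'$ on $\mathcal{I}'$ is replaced by a grove on the new initial conditions with the same diagonals on all other rhombi, and on the three new rhombi as follows: (a) If $G'$ contains the three short diagonals $e_a,e_b,e_c$ at $(i,j,k)$, then, independently of all other choices, use $\{e_a(i-1,j,k),E_b(i,j-1,k),E_c(i,j,k-1)\}$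 with probability $U(i,j,k)$, $\{E_a(i-1,j,k),e_b(i,j-1,k),E_c(i,j,k-1)\}$ with probability $V(i,j,k)$, and $\{E_a(i-1,j,k),E_b(i,j-1,k),e_c(i,j,k-1)\}$ with probability $W(i,j,k)$. (b) If $G'$ contains exactly one of the short diagonals at $(i,j,k)$ (and two long ones), use the three short diagonals $e_a(i-1,j,k),e_b(i,j-1,k),e_c(i,j,k-1)$. (c) If $G'$ contains exactly two of the short diagonals at $(i,j,k)$ and one long diagonal, of type $q\in\{a,b,c\}$, use the long diagonal of the new rhombus of type $q$ and the short diagonals of the other two new rhombi. Every set of initial conditions can be reached from $\{\max\{i,j,k\}=0\}$ (the case $\mathcal{U}=\emptyset$) by such removals; the removed cubes are those at the points of $\mathcal{U}$. *)

theory Defs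
  imports
    "HOL-Probability.Probability_Mass_Function"
    "HOL-Library.Poly_Mapping"
    "HOL-Library.Countable"
    "HOL-Computational_Algebra.Fraction_Field"
begin

section \<open>Initial conditions and rhombi\<close>

type_synonym pt = "int \<times> int \<times> int"

definition octant :: "pt set" where
  "octant = {(i, j, k). i \<le> 0 \<and> j \<le> 0 \<and> k \<le> 0}"

definition lower_region :: "pt set \<Rightarrow> bool" where
  "lower_region L \<longleftrightarrow> L \<subseteq> octant \<and> finite (octant - L) \<and>
     (\<forall>i j k i' j' k'. (i, j, k) \<in> L \<and> i' \<le> i \<and> j' \<le> j \<and> k' \<le> k \<longrightarrow> (i', j', k') \<in> L)"

abbreviation upper :: "pt set \<Rightarrow> pt set" where
  "upper L \<equiv> octant - L"

definition init_conds :: "pt set \<Rightarrow> pt set" where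
  "init_conds L = {(i, j, k). (i, j, k) \<in> L \<and> (i + 1, j + 1, k + 1) \<notin> L}"

datatype dir = Dir_a | Dir_b | Dir_c

fun rhombus :: "dir \<Rightarrow> pt \<Rightarrow> pt set" where
  "rhombus Dir_a (i, j, k) = {(i, j, k), (i, j - 1, k), (i, j, k - 1), (i, j - 1, k - 1)}"
| "rhombus Dir_b (i, j, k) = {(i, j, k), (i - 1, j, k), (i, j, k - 1), (i - 1, j, k - 1)}"
| "rhombus Dir_c (i, j, k) = {(i, j, k), (i - 1, j, k), (i, j - 1, k), (i - 1, j - 1, k)}"

fun long_diag :: "dir \<Rightarrow> pt \<Rightarrow> pt set" where
  "long_diag Dir_a (i, j, k) = {(i, j - 1, k), (i, j, k - 1)}"
| "long_diag Dir_b (i, j, k) = {(i - 1, j, k), (i, j, k - 1)}"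
| "long_diag Dir_c (i, j, k) = {(i - 1, j, k), (i, j - 1, k)}"

fun short_diag :: "dir \<Rightarrow> pt \<Rightarrow> pt set" where
  "short_diag Dir_a (i, j, k) = {(i, j, k), (i, j - 1, k - 1)}"
| "short_diag Dir_b (i, j, k) = {(i, j, k), (i - 1, j, k - 1)}"
| "short_diag Dir_c (i, j, k) = {(i, j, k), (i - 1, j - 1, k)}"

definition rhombi_in :: "pt set \<Rightarrow> (dir \<times> pt) set" where
  "rhombi_in I = {(q, v). v \<in> octant \<and> rhombus q v \<subseteq> I}"


section \<open>Groves\<close>

text \<open>Only subgraphs with vertex set \<open>I\<close> occur, so a subgraph is represented by its edge set;
  an edge is the set of its two endpoints.\<close>

type_synonym edges = "pt set set"

definition Gamma_edges :: "pt set \<Rightarrow> edges" where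
  "Gamma_edges I = (\<Union>(q, v)\<in>rhombi_in I. {long_diag q v, short_diag q v})"

definition components :: "pt set \<Rightarrow> edges \<Rightarrow> pt set set" where
  "components I G = (\<lambda>u. {v \<in> I. (u, v) \<in> {(x, y). {x, y} \<in> G}\<^sup>*}) ` I"

definition boundary_sets :: "int \<Rightarrow> pt set set" where
  "boundary_sets N =
     {{(0, p, q), (p, 0, q)} | p q. 0 > p \<and> p > q \<and> p + q \<in> {- N - 1, - N - 2}} \<union>
     {{(p, q, 0), (0, q, p)} | p q. 0 > p \<and> p > q \<and> p + q \<in> {- N - 1, - N - 2}} \<union>
     {{(q, 0, p), (q, p, 0)} | p q. 0 > p \<and> p > q \<and> p + q \<in> {- N - 1, - N - 2}} \<union>
     {{(0, p, p), (p, 0, p), (p, p, 0)} | p. 2 * p \<in> {- N - 1, - N - 2}} \<union>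
     {{(0, 0, q)} | q. q \<le> - N - 1} \<union>
     {{(0, q, 0)} | q. q \<le> - N - 1} \<union>
     {{(q, 0, 0)} | q. q \<le> - N - 1}"

definition groves :: "pt set \<Rightarrow> edges set" where
  "groves I = {G. G \<subseteq> Gamma_edges I \<and>
     (\<forall>(q, v)\<in>rhombi_in I. (long_diag q v \<in> G) \<noteq> (short_diag q v \<in> G)) \<and>
     (\<exists>N::int. \<forall>(q, v)\<in>rhombi_in I.
        (\<forall>(i, j, k)\<in>rhombus q v. i + j + k < - N) \<longrightarrow> short_diag q v \<in> G) \<and>
     (\<exists>N\<^sub>0. \<forall>N\<ge>N\<^sub>0.
        (\<forall>K\<in>components I G. \<exists>!S. S \<in> boundary_sets N \<and> S \<subseteq> K) \<and>
        (\<forall>S\<in>boundary_sets N. \<exists>K\<in>components I G. S \<subseteq> K))}"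

definition degree :: "edges \<Rightarrow> pt \<Rightarrow> nat" where
  "degree G v = card {e \<in> G. v \<in> e}"

text \<open>In a grove all but finitely many vertices have degree 2. They contribute the factor 1 and
  are left out, since \<open>prod\<close> over an infinite set is 1 by convention.\<close>

definition grove_monomial :: "pt set \<Rightarrow> (pt \<Rightarrow> 'a::field) \<Rightarrow> edges \<Rightarrow> 'a" where
  "grove_monomial I g G = (\<Prod>v\<in>{v \<in> I. degree G v \<noteq> 2}. g v powi (int (degree G v) - 2))"


section \<open>Conductances\<close>

text \<open>A conductance function is given by its values \<open>C q v\<close> on the long diagonals
  \<open>long_diag q v\<close>, \<open>v \<in> octant\<close>; the short diagonal carries the inverse.\<close>

type_synonym cond = "dir \<Rightarrow> pt \<Rightarrow> real"

definition short_cond :: "cond \<Rightarrow> cond" where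
  "short_cond C q v = 1 / C q v"

definition YDelta_consistent :: "cond \<Rightarrow> bool" where
  "YDelta_consistent C \<longleftrightarrow> (\<forall>i j k. (i, j, k) \<in> octant \<longrightarrow>
     (let S = C Dir_a (i, j, k) * C Dir_b (i, j, k) + C Dir_a (i, j, k) * C Dir_c (i, j, k)
              + C Dir_b (i, j, k) * C Dir_c (i, j, k)
      in C Dir_a (i, j, k) * short_cond C Dir_a (i - 1, j, k) = S \<and>
         C Dir_b (i, j, k) * short_cond C Dir_b (i, j - 1, k) = S \<and>
         C Dir_c (i, j, k) * short_cond C Dir_c (i, j, k - 1) = S))"

definition grove_weight :: "cond \<Rightarrow> edges \<Rightarrow> real" where
  "grove_weight C G = (\<Prod>(q, v)\<in>{(q, v). v \<in> octant \<and> long_diag q v \<in> G}. C q v)"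

definition partition_fun :: "cond \<Rightarrow> pt set \<Rightarrow> real" where
  "partition_fun C I = (\<Sum>G\<in>groves I. grove_weight C G)"

text \<open>Probability measures on \<open>groves I\<close> are given by their mass functions, extended by 0.\<close>

definition prob_cond :: "cond \<Rightarrow> pt set \<Rightarrow> edges \<Rightarrow> real" where
  "prob_cond C I G = (if G \<in> groves I then grove_weight C G / partition_fun C I else 0)"


section \<open>The cube recurrence\<close>

definition cube_recurrence :: "(pt \<Rightarrow> real) \<Rightarrow> bool" where
  "cube_recurrence f \<longleftrightarrow> (\<forall>i j k. (i, j, k) \<in> octant \<longrightarrow>
     f (i, j, k) * f (i - 1, j - 1, k - 1) =
       f (i - 1, j, k) * f (i, j - 1, k - 1) + f (i, j - 1, k) * f (i - 1, j, k - 1)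
       + f (i, j, k - 1) * f (i - 1, j - 1, k))"

definition prob_cube :: "(pt \<Rightarrow> real) \<Rightarrow> pt set \<Rightarrow> edges \<Rightarrow> real" where
  "prob_cube f I G = (if G \<in> groves I then grove_monomial I f G / f (0, 0, 0) else 0)"

fun cond_of :: "(pt \<Rightarrow> real) \<Rightarrow> cond" where
  "cond_of f Dir_a (i, j, k) =
     f (i, j - 1, k) * f (i, j, k - 1) / (f (i, j, k) * f (i, j - 1, k - 1))"
| "cond_of f Dir_b (i, j, k) =
     f (i - 1, j, k) * f (i, j, k - 1) / (f (i, j, k) * f (i - 1, j, k - 1))"
| "cond_of f Dir_c (i, j, k) =
     f (i - 1, j, k) * f (i, j - 1, k) / (f (i, j, k) * f (i - 1, j - 1, k))"


section \<open>The generalized cube recurrence\<close>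

fun cube_Delta :: "cond \<Rightarrow> pt \<Rightarrow> real" where
  "cube_Delta C (i, j, k) =
     C Dir_b (i, j - 1, k) * C Dir_c (i, j, k - 1) +
     C Dir_a (i - 1, j, k) * C Dir_c (i, j, k - 1) +
     C Dir_a (i - 1, j, k) * C Dir_b (i, j - 1, k)"

fun cube_U :: "cond \<Rightarrow> pt \<Rightarrow> real" where
  "cube_U C (i, j, k) = C Dir_b (i, j - 1, k) * C Dir_c (i, j, k - 1) / cube_Delta C (i, j, k)"

fun cube_V :: "cond \<Rightarrow> pt \<Rightarrow> real" where
  "cube_V C (i, j, k) = C Dir_a (i - 1, j, k) * C Dir_c (i, j, k - 1) / cube_Delta C (i, j, k)"

fun cube_W :: "cond \<Rightarrow> pt \<Rightarrow> real" where
  "cube_W C (i, j, k) = C Dir_a (i - 1, j, k) * C Dir_b (i, j - 1, k) / cube_Delta C (i, j, k)"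

text \<open>The field of real rational functions in independent variables \<open>indet v\<close>, one for each lattice
  point \<open>v\<close>. The variables are numbered by the injection \<open>to_nat\<close>, because the integral domain
  instance of polynomials needs a linear order on them.\<close>

type_synonym ratfun = "((nat \<Rightarrow>\<^sub>0 nat) \<Rightarrow>\<^sub>0 real) fract"

definition const :: "real \<Rightarrow> ratfun" where
  "const r = Fraction_Field.Fract (Poly_Mapping.single 0 r) 1"

definition indet :: "pt \<Rightarrow> ratfun" where
  "indet v = Fraction_Field.Fract (Poly_Mapping.single (Poly_Mapping.single (to_nat v) 1) 1) 1"

definition gen_cube_solution :: "cond \<Rightarrow> pt set \<Rightarrow> (pt \<Rightarrow> ratfun) \<Rightarrow> bool" where
  "gen_cube_solution C L g \<longleftrightarrow>
     (\<forall>v\<in>init_conds L. g v = indet v) \<and>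
     (\<forall>i j k. (i, j, k) \<in> upper L \<longrightarrow>
        g (i, j, k) * g (i - 1, j - 1, k - 1) =
          const (cube_U C (i, j, k)) * g (i - 1, j, k) * g (i, j - 1, k - 1) +
          const (cube_V C (i, j, k)) * g (i, j - 1, k) * g (i - 1, j, k - 1) +
          const (cube_W C (i, j, k)) * g (i, j, k - 1) * g (i - 1, j - 1, k))"


section \<open>Grove shuffling\<close>

text \<open>\<open>new_corner q v\<close> is the base point of the rhombus of type \<open>q\<close> that appears when the cube at
  \<open>v\<close> is removed.\<close>

fun new_corner :: "dir \<Rightarrow> pt \<Rightarrow> pt" where
  "new_corner Dir_a (i, j, k) = (i - 1, j, k)"
| "new_corner Dir_b (i, j, k) = (i, j - 1, k)"
| "new_corner Dir_c (i, j, k) = (i, j, k - 1)"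

fun choice_prob :: "cond \<Rightarrow> pt \<Rightarrow> dir \<Rightarrow> real" where
  "choice_prob C v Dir_a = cube_U C v"
| "choice_prob C v Dir_b = cube_V C v"
| "choice_prob C v Dir_c = cube_W C v"

text \<open>Replace the diagonals of the three old rhombi of the cube at \<open>v\<close>, using on the new rhombi
  the long diagonal for the types in \<open>Q\<close> and the short one for the others.\<close>

definition replace_cube :: "pt \<Rightarrow> dir set \<Rightarrow> edges \<Rightarrow> edges" where
  "replace_cube v Q G =
     (G - (\<Union>q. {long_diag q v, short_diag q v})) \<union>
     (\<Union>q. {if q \<in> Q then long_diag q (new_corner q v) else short_diag q (new_corner q v)})"

text \<open>The case of three long diagonals, which would isolate the vertex \<open>v\<close>, does not occur in a
  grove; the value given for it is arbitrary.\<close>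

definition shuffle_step :: "cond \<Rightarrow> pt \<Rightarrow> edges \<Rightarrow> edges pmf" where
  "shuffle_step C v G =
     (let Q = {q. short_diag q v \<in> G} in
      if card Q = 3 then map_pmf (\<lambda>q. replace_cube v (- {q}) G) (embed_pmf (choice_prob C v))
      else if card Q = 1 then return_pmf (replace_cube v {} G)
      else if card Q = 2 then return_pmf (replace_cube v (- Q) G)
      else return_pmf G)"

definition removable :: "pt set \<Rightarrow> pt \<Rightarrow> bool" where
  "removable L v \<longleftrightarrow> (\<forall>q. rhombus q v \<subseteq> init_conds L)"

text \<open>\<open>removal_order vs L\<close>: removing the cubes at \<open>vs\<close>, in this order, from the octant is possible
  and leads to \<open>L\<close>.\<close>

inductive removal_order :: "pt list \<Rightarrow> pt set \<Rightarrow> bool" where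
  start: "removal_order [] octant"
| remove: "removal_order vs L \<Longrightarrow> removable L v \<Longrightarrow> removal_order (vs @ [v]) (L - {v})"

definition start_grove :: edges where
  "start_grove = (THE G. G \<in> groves {(i, j, k). (i, j, k) \<in> octant \<and> max i (max j k) = 0})"

definition grove_shuffling :: "cond \<Rightarrow> pt list \<Rightarrow> edges pmf" where
  "grove_shuffling C vs =
     foldl (\<lambda>\<mu> v. bind_pmf \<mu> (shuffle_step C v)) (return_pmf start_grove) vs"

text \<open>Every initial condition set is reached by some removal order, and the removed cubes are
  those at the points of \<open>upper L\<close>.\<close>

lemma removal_order_upper:
  assumes "removal_order vs L"
  shows "L \<subseteq> octant \<and> distinct vs \<and> set vs = upper L"
  using assms
proof induction
  case start
  then show ?case by simp
next
  case (remove vs L v)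
  obtain i j k where v: "v = (i, j, k)" by (cases v) auto
  from remove.hyps(2) have "rhombus Dir_a v \<subseteq> init_conds L"
    unfolding removable_def by blast
  then have "v \<in> L" unfolding v by (auto simp: init_conds_def)
  then show ?case using remove.IH by auto
qed

lemma removal_order_exists:
  assumes "lower_region L"
  shows "\<exists>vs. removal_order vs L"
  using assms
proof (induction "card (upper L)" arbitrary: L)
  case 0
  then have "L = octant" by (auto simp: lower_region_def)
  then show ?case using removal_order.start by blast
next
  case (Suc n)
  define s :: "pt \<Rightarrow> nat" where "s = (\<lambda>(i, j, k). nat (- (i + j + k)))"
  have fin: "finite (upper L)" and LO: "L \<subseteq> octant"
    using Suc.prems by (auto simp: lower_region_def)
  have down: "(i', j', k') \<in> L" if "(i, j, k) \<in> L" "i' \<le> i" "j' \<le> j" "k' \<le> k" for i j k i' j' k'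
    using Suc.prems that unfolding lower_region_def by blast
  have "card (upper L) \<noteq> 0" using Suc.hyps(2) by simp
  then have "upper L \<noteq> {}" by (metis card.empty)
  obtain v where vU: "v \<in> upper L" and vmax: "\<And>u. u \<in> upper L \<Longrightarrow> s u \<le> s v"
  proof -
    have "Max (s ` upper L) \<in> s ` upper L"
      using fin \<open>upper L \<noteq> {}\<close> by (intro Max_in) simp_all
    then obtain v where "v \<in> upper L" "Max (s ` upper L) = s v" by blast
    moreover have "s u \<le> Max (s ` upper L)" if "u \<in> upper L" for u
      using fin that by (intro Max_ge) simp_all
    ultimately show thesis using that by simp
  qed
  obtain i j k where v: "v = (i, j, k)" by (cases v) auto
  have neg: "i \<le> 0" "j \<le> 0" "k \<le> 0" using vU by (auto simp: v octant_def)
  have below: "(i', j', k') \<in> L" if "i' \<le> i" "j' \<le> j" "k' \<le> k" "(i', j', k') \<noteq> (i, j, k)" for i' j' k'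
  proof (rule ccontr)
    assume "(i', j', k') \<notin> L"
    then have "(i', j', k') \<in> upper L" using that neg by (auto simp: octant_def)
    from vmax[OF this] show False using that neg by (auto simp: s_def v)
  qed
  have above: "(i', j', k') \<notin> insert v L" if "i \<le> i'" "j \<le> j'" "k \<le> k'" "(i', j', k') \<noteq> (i, j, k)" for i' j' k'
    using that down[of i' j' k' i j k] vU unfolding v by blast
  have lr: "lower_region (insert v L)"
    unfolding lower_region_def
  proof (intro conjI allI impI)
    show "insert v L \<subseteq> octant" using LO vU by auto
    show "finite (octant - insert v L)" using fin by (auto intro: finite_subset[of _ "upper L"])
    fix a b c a' b' c'
    assume "(a, b, c) \<in> insert v L \<and> a' \<le> a \<and> b' \<le> b \<and> c' \<le> c"
    then show "(a', b', c') \<in> insert v L" using below[of a' b' c'] down[of a b c a' b' c'] unfolding v insert_iff prod.inject by blast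
  qed
  have "upper L = insert v (upper (insert v L))" using vU by auto
  then have "card (upper L) = Suc (card (upper (insert v L)))"
    using card_Suc_Diff1[OF fin vU] by (metis Diff_insert)
  then have "n = card (upper (insert v L))" using Suc.hyps(2) by simp
  from Suc.hyps(1)[OF this lr] obtain vs where vs: "removal_order vs (insert v L)" by blast
  have "removable (insert v L) v"
    unfolding removable_def
  proof
    fix q show "rhombus q v \<subseteq> init_conds (insert v L)"
      using above below by (cases q) (simp_all add: v init_conds_def)
  qed
  from removal_order.remove[OF vs this] have "removal_order (vs @ [v]) L"
    using vU by auto
  then show ?case by blast
qed

end

theory Submission
  imports Defs
begin

text \<open>
  Everything happens inside one hexagon. Let \<open>v\<close> be a cube that can be removed. Its upper three
  rhombi have the common corner \<open>v\<close>; around it lie the three points \<open>new_corner q v\<close> and, alternating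
  with them, the three points \<open>opp_corner q v\<close>. A short diagonal joins \<open>v\<close> to an \<open>opp_corner\<close>, a long
  diagonal joins two points \<open>new_corner\<close>. After the removal \<open>below v\<close> is the centre, a short diagonal
  joins it to a \<open>new_corner\<close>, and a long diagonal joins two points \<open>opp_corner\<close>. So the two pictures
  are the same, with the two kinds of corners interchanged.

  Groves: three long diagonals would isolate the centre, which the boundary condition forbids. For
  the other sets of long diagonals the connections induced between the six corners match in pairs
  (\<open>exchange\<close>): none before the removal and any two after it; any two before and none after; one and
  the same one before and after. The boundary condition only sees connections between points far
  away, so replacing one member of a pair by the other turns groves into groves
  (\<open>exchange_grove\<close>). Hence the groves before and after the removal are made up of the same choices
  of diagonals outside the hexagon, sorted into the same three classes, and a sum over all groves
  is a sum over these classes (\<open>sum_groves_old\<close>, \<open>sum_groves_new\<close>).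

  One step: Y-Delta consistency says exactly that the conductances inside the hexagon are multiplied
  by \<open>\<Delta> = cube_Delta C v\<close> under the removal (\<open>YDelta\<close>). With this, comparing the three classes
  separately shows that the partition function is multiplied by \<open>\<Delta>\<close>, that a shuffling step maps
  the measure of the old surface to the measure of the new one, that the sum of
  \<open>weight * monomial\<close> is multiplied by \<open>\<Delta>\<close> if the variables satisfy the generalized recurrence at
  \<open>v\<close>, and that the ratio of the monomial in \<open>f\<close> to the weight is divided by \<open>\<Delta>\<close>. All
  claims follow by induction along a removal order.

  Start: on the surface where one coordinate is 0 there is only the grove of short diagonals, with
  weight 1 and monomial \<open>g (0, 0, 0)\<close>. Its uniqueness is a counting argument. A component that
  contains a boundary set with points on two faces has to cross a coordinate axis, and there are
  exactly as many boundary sets of this kind as points of the axes that are close enough to the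
  origin. So distinct points of the axes lie in distinct components (\<open>axis_separated\<close>), and then a
  long diagonal closest to the axes would connect two of them.

  Finally, dividing by a value of a solution of the generalized recurrence requires that it is not
  zero. This holds as the recurrence has no subtractions: all values are quotients of nonzero
  polynomials with nonnegative coefficients (\<open>solution_pos\<close>).
\<close>

section \<open>Diagonals and the corners of a cube\<close>

lemma UNIV_dir: "(UNIV :: dir set) = {Dir_a, Dir_b, Dir_c}"
  using dir.exhaust by auto

instance dir :: finite
  by standard (simp add: UNIV_dir)

lemma Compl_dir:
  "- {Dir_a} = {Dir_b, Dir_c}" "- {Dir_b} = {Dir_a, Dir_c}" "- {Dir_c} = {Dir_a, Dir_b}"
  using dir.exhaust by auto

lemma all_dir: "(\<forall>q. P q) \<longleftrightarrow> P Dir_a \<and> P Dir_b \<and> P Dir_c"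
  using dir.exhaust by metis

fun height :: "pt \<Rightarrow> int" where
  "height (i, j, k) = i + j + k"

fun below :: "pt \<Rightarrow> pt" where
  "below (i, j, k) = (i - 1, j - 1, k - 1)"

fun opp_corner :: "dir \<Rightarrow> pt \<Rightarrow> pt" where
  "opp_corner Dir_a (i, j, k) = (i, j - 1, k - 1)"
| "opp_corner Dir_b (i, j, k) = (i - 1, j, k - 1)"
| "opp_corner Dir_c (i, j, k) = (i - 1, j - 1, k)"

text \<open>The next four facts are the symmetry between the two sides of a cube: passing from the old
  rhombi to the new ones replaces \<open>v\<close> by \<open>below v\<close> and interchanges the two kinds of corners.\<close>

lemma short_diag_old: "short_diag q v = {v, opp_corner q v}"
  by (cases v; cases q) auto

lemma long_diag_old: "long_diag q v = (\<lambda>p. new_corner p v) ` (- {q})"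
  by (cases v; cases q) (auto simp: Compl_dir)

lemma short_diag_new: "short_diag q (new_corner q v) = {below v, new_corner q v}"
  by (cases v; cases q) auto

lemma long_diag_new: "long_diag q (new_corner q v) = (\<lambda>p. opp_corner p v) ` (- {q})"
  by (cases v; cases q) (auto simp: Compl_dir)

text \<open>The difference of the end points of a diagonal determines its type and whether it is long or
  short, so an edge is the diagonal of only one rhombus.\<close>

lemma long_diag_inject [simp]: "long_diag q v = long_diag q' v' \<longleftrightarrow> q = q' \<and> v = v'"
  by (cases v; cases v'; cases q; cases q') (auto simp: doubleton_eq_iff)

lemma short_diag_inject [simp]: "short_diag q v = short_diag q' v' \<longleftrightarrow> q = q' \<and> v = v'"
  by (cases v; cases v'; cases q; cases q') (auto simp: doubleton_eq_iff)

lemma long_neq_short [simp]: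
  "long_diag q v \<noteq> short_diag q' v'" "short_diag q' v' \<noteq> long_diag q v"
  by (cases v; cases v'; cases q; cases q'; auto simp: doubleton_eq_iff)+

section \<open>Choosing a diagonal in every rhombus\<close>

definition diags :: "(dir \<times> pt) set \<Rightarrow> edges" where
  "diags R = (\<Union>(q, v)\<in>R. {long_diag q v, short_diag q v})"

text \<open>The conditions on a grove that concern its rhombi one by one, for an arbitrary set \<open>R\<close> of
  rhombi: this allows to speak about the part of a grove outside a given cube.\<close>

definition diag_choice :: "(dir \<times> pt) set \<Rightarrow> edges \<Rightarrow> bool" where
  "diag_choice R G \<longleftrightarrow> G \<subseteq> diags R \<and>
     (\<forall>q v. (q, v) \<in> R \<longrightarrow> (long_diag q v \<in> G) \<noteq> (short_diag q v \<in> G)) \<and>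
     (\<exists>N. \<forall>q v. (q, v) \<in> R \<longrightarrow> (\<forall>x\<in>rhombus q v. height x < - N) \<longrightarrow> short_diag q v \<in> G)"

lemma diag_choiceD:
  assumes "diag_choice R G"
  shows "G \<subseteq> diags R"
    and "(q, v) \<in> R \<Longrightarrow> long_diag q v \<in> G \<longleftrightarrow> short_diag q v \<notin> G"
    and "\<exists>N. \<forall>q v. (q, v) \<in> R \<longrightarrow> (\<forall>x\<in>rhombus q v. height x < - N) \<longrightarrow> short_diag q v \<in> G"
  using assms unfolding diag_choice_def by (simp_all del: split_paired_All split_paired_Ex)

text \<open>The boundary condition at one value of \<open>N\<close>.\<close>

definition matched_at :: "pt set \<Rightarrow> edges \<Rightarrow> int \<Rightarrow> bool" where
  "matched_at I G N \<longleftrightarrow>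
     (\<forall>K\<in>components I G. \<exists>!S. S \<in> boundary_sets N \<and> S \<subseteq> K) \<and>
     (\<forall>S\<in>boundary_sets N. \<exists>K\<in>components I G. S \<subseteq> K)"

lemma groves_iff:
  "G \<in> groves I \<longleftrightarrow> diag_choice (rhombi_in I) G \<and> (\<exists>N\<^sub>0. \<forall>N\<ge>N\<^sub>0. matched_at I G N)"
proof -
  have h: "(\<forall>(i, j, k)\<in>S. i + j + k < n) \<longleftrightarrow> (\<forall>x\<in>S. height x < n)" for S n
    by fastforce
  show ?thesis
    unfolding groves_def diag_choice_def matched_at_def diags_def Gamma_edges_def h
    by (simp add: Ball_def)
qed

text \<open>A choice of diagonals on three rhombi, one of each type, based at \<open>\<rho> q\<close>; the set \<open>P\<close> consists of
  the types that use the long diagonal.\<close>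

definition local_diags :: "(dir \<Rightarrow> pt) \<Rightarrow> dir set \<Rightarrow> edges" where
  "local_diags \<rho> P = (\<Union>q. {if q \<in> P then long_diag q (\<rho> q) else short_diag q (\<rho> q)})"

lemma long_in_diags [simp]: "long_diag q v \<in> diags R \<longleftrightarrow> (q, v) \<in> R"
  by (auto simp: diags_def)

lemma short_in_diags [simp]: "short_diag q v \<in> diags R \<longleftrightarrow> (q, v) \<in> R"
  by (auto simp: diags_def)

lemma long_in_local [simp]: "long_diag q v \<in> local_diags \<rho> P \<longleftrightarrow> v = \<rho> q \<and> q \<in> P"
  by (auto simp: local_diags_def)

lemma short_in_local [simp]: "short_diag q v \<in> local_diags \<rho> P \<longleftrightarrow> v = \<rho> q \<and> q \<notin> P"
  by (auto simp: local_diags_def)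

lemma top_in_rhombus: "v \<in> rhombus q v"
  by (cases v; cases q) auto

lemma local_diags_cases:
  assumes "e \<in> local_diags \<rho> P"
  obtains q where "q \<in> P" "e = long_diag q (\<rho> q)" | q where "q \<notin> P" "e = short_diag q (\<rho> q)"
  using assms by (auto simp: local_diags_def split: if_splits)

lemma local_diags_outside:
  assumes "\<And>q. (q, \<rho> q) \<notin> R"
  shows "local_diags \<rho> P \<inter> diags R = {}"
  using assms by (auto elim!: local_diags_cases)

lemma diags_insert:
  "diags (R \<union> range (\<lambda>q. (q, \<rho> q))) =
     diags R \<union> {e. \<exists>q. e = long_diag q (\<rho> q) \<or> e = short_diag q (\<rho> q)}"
  unfolding diags_def by blast

text \<open>Distinct rhombi have distinct diagonals, so the choices on \<open>R\<close> and on three further rhombi are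
  independent. The condition that far away only short diagonals occur is not affected by three
  rhombi: it suffices to move the bound below their top corners.\<close>

lemma diag_choice_split:
  assumes disj: "\<And>q. (q, \<rho> q) \<notin> R"
  shows "diag_choice (R \<union> range (\<lambda>q. (q, \<rho> q))) G \<longleftrightarrow>
    (\<exists>H P. diag_choice R H \<and> G = H \<union> local_diags \<rho> P)" (is "?l \<longleftrightarrow> ?r")
proof
  let ?R = "R \<union> range (\<lambda>q. (q, \<rho> q))"
  assume l: ?l
  define P where "P = {q. long_diag q (\<rho> q) \<in> G}"
  define H where "H = G \<inter> diags R"
  note xor = diag_choiceD(2)[OF l]
  obtain N where N: "\<And>q v. (q, v) \<in> ?R \<Longrightarrow>
      (\<forall>x\<in>rhombus q v. height x < - N) \<Longrightarrow> short_diag q v \<in> G"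
    using diag_choiceD(3)[OF l] by metis
  have "diag_choice R H"
    unfolding diag_choice_def
  proof (intro conjI)
    show "H \<subseteq> diags R" by (simp add: H_def)
    show "\<forall>q v. (q, v) \<in> R \<longrightarrow> (long_diag q v \<in> H) \<noteq> (short_diag q v \<in> H)"
      using xor by (simp add: H_def)
    show "\<exists>N. \<forall>q v. (q, v) \<in> R \<longrightarrow> (\<forall>x\<in>rhombus q v. height x < - N) \<longrightarrow> short_diag q v \<in> H"
      using N by (intro exI[of _ N]) (simp add: H_def)
  qed
  moreover have "G = H \<union> local_diags \<rho> P"
  proof (rule set_eqI)
    fix e
    have loc: "e \<in> local_diags \<rho> P \<longleftrightarrow>
        (\<exists>q. (e = long_diag q (\<rho> q) \<or> e = short_diag q (\<rho> q)) \<and> e \<in> G)"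
    proof
      assume "e \<in> local_diags \<rho> P"
      then show "\<exists>q. (e = long_diag q (\<rho> q) \<or> e = short_diag q (\<rho> q)) \<and> e \<in> G"
        using xor by (cases rule: local_diags_cases) (auto simp: P_def simp del: split_paired_All)
    next
      assume "\<exists>q. (e = long_diag q (\<rho> q) \<or> e = short_diag q (\<rho> q)) \<and> e \<in> G"
      then obtain q where "e = long_diag q (\<rho> q) \<or> e = short_diag q (\<rho> q)" "e \<in> G" by blast
      then show "e \<in> local_diags \<rho> P" using xor[of q "\<rho> q"] by (auto simp: P_def)
    qed
    show "e \<in> G \<longleftrightarrow> e \<in> H \<union> local_diags \<rho> P"
      using diag_choiceD(1)[OF l] unfolding Un_iff loc diags_insert H_def by blast
  qed
  ultimately show ?r by blast
next
  assume ?r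
  then obtain H P where H: "diag_choice R H" and G: "G = H \<union> local_diags \<rho> P" by blast
  note sub = diag_choiceD(1)[OF H] and xor = diag_choiceD(2)[OF H]
  obtain N where N: "\<And>q v. (q, v) \<in> R \<Longrightarrow>
      (\<forall>x\<in>rhombus q v. height x < - N) \<Longrightarrow> short_diag q v \<in> H"
    using diag_choiceD(3)[OF H] by metis
  define N' where "N' = Max (insert N (range (\<lambda>q. - height (\<rho> q))))"
  have N'1: "N \<le> N'" and N'2: "- height (\<rho> q) \<le> N'" for q
    unfolding N'_def by (auto intro!: Max_ge simp del: Max_insert)
  have notH: "long_diag q (\<rho> q) \<notin> H" "short_diag q (\<rho> q) \<notin> H" for q
    using sub disj[of q] by auto
  show ?l
    unfolding diag_choice_def
  proof (intro conjI exI[of _ N'] allI impI)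
    show "G \<subseteq> diags (R \<union> range (\<lambda>q. (q, \<rho> q)))"
      using sub unfolding G by (auto simp: diags_def elim!: local_diags_cases)
    show "(long_diag q v \<in> G) \<noteq> (short_diag q v \<in> G)"
      if "(q, v) \<in> R \<union> range (\<lambda>q. (q, \<rho> q))" for q v
      using that xor[of q v] notH[of q] disj[of q] unfolding G by auto
    show "short_diag q v \<in> G" if qv: "(q, v) \<in> R \<union> range (\<lambda>q. (q, \<rho> q))"
      and low: "\<forall>x\<in>rhombus q v. height x < - N'" for q v
    proof -
      have "height v < - N'" using low top_in_rhombus[of v q] by blast
      then have "v \<noteq> \<rho> q" using N'2[of q] by auto
      then have "(q, v) \<in> R" using qv by auto
      moreover have "\<forall>x\<in>rhombus q v. height x < - N"
        using low N'1 by fastforce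
      ultimately show ?thesis using N unfolding G by blast
    qed
  qed
qed

lemma split_unique:
  assumes disj: "\<And>q. (q, \<rho> q) \<notin> R"
    and "H \<subseteq> diags R" "H' \<subseteq> diags R" "H \<union> local_diags \<rho> P = H' \<union> local_diags \<rho> P'"
  shows "H = H' \<and> P = P'"
proof
  show "H = H'"
    using assms(2-4) local_diags_outside[of \<rho> R P] local_diags_outside[of \<rho> R P'] disj by blast
  have "q \<in> P \<longleftrightarrow> q \<in> P'" for q
  proof -
    have "long_diag q (\<rho> q) \<notin> H \<union> H'" using disj[of q] assms(2,3) by auto
    then show ?thesis using assms(4) long_in_local[of q "\<rho> q" \<rho> P] long_in_local[of q "\<rho> q" \<rho> P'] by blast
  qed
  then show "P = P'" by auto
qed

section \<open>Removing a cube changes three rhombi\<close>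

lemma lower_regionD:
  "lower_region L \<Longrightarrow> (i, j, k) \<in> L \<Longrightarrow> i' \<le> i \<Longrightarrow> j' \<le> j \<Longrightarrow> k' \<le> k \<Longrightarrow> (i', j', k') \<in> L"
  unfolding lower_region_def by blast

lemma removable_corners:
  assumes "removable L v"
  shows "v \<in> init_conds L" "new_corner q v \<in> init_conds L" "opp_corner q v \<in> init_conds L"
  using assms unfolding removable_def all_dir by (cases v; cases q; auto)+

text \<open>A removable cube is maximal in \<open>L\<close>: the three points directly above \<open>v\<close> are obtained from its
  opposite corners by adding \<open>(1, 1, 1)\<close>, and these corners are initial conditions.\<close>

lemma removable_top:
  assumes "lower_region L" "removable L (i, j, k)" "(i', j', k') \<in> L" "i \<le> i'" "j \<le> j'" "k \<le> k'"
  shows "i' = i \<and> j' = j \<and> k' = k"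
proof (rule ccontr)
  assume n: "\<not> (i' = i \<and> j' = j \<and> k' = k)"
  have "(i + 1, j, k) \<notin> L" "(i, j + 1, k) \<notin> L" "(i, j, k + 1) \<notin> L"
    using removable_corners(3)[OF assms(2), of Dir_a] removable_corners(3)[OF assms(2), of Dir_b]
      removable_corners(3)[OF assms(2), of Dir_c] by (auto simp: init_conds_def)
  moreover have "(i + 1, j, k) \<in> L \<or> (i, j + 1, k) \<in> L \<or> (i, j, k + 1) \<in> L"
    using n assms(4-6) lower_regionD[OF assms(1,3)]
    by (cases "i' = i"; cases "j' = j"; cases "k' = k") auto
  ultimately show False by blast
qed

lemma lower_region_remove:
  assumes "lower_region L" "removable L v"
  shows "lower_region (L - {v})"
  unfolding lower_region_def
proof (intro conjI allI impI)
  show "L - {v} \<subseteq> octant" using assms(1) by (auto simp: lower_region_def)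
  have "octant - (L - {v}) \<subseteq> insert v (octant - L)" by auto
  then show "finite (octant - (L - {v}))"
    using assms(1) by (auto simp: lower_region_def intro: finite_subset)
  fix i j k i' j' k'
  assume a: "(i, j, k) \<in> L - {v} \<and> i' \<le> i \<and> j' \<le> j \<and> k' \<le> k"
  then have "(i', j', k') \<in> L" using lower_regionD[OF assms(1)] by blast
  moreover have "(i', j', k') \<noteq> v"
    using a removable_top[OF assms(1), of i' j' k' i j k] assms(2) by auto
  ultimately show "(i', j', k') \<in> L - {v}" by simp
qed

lemma removal_order_lower:
  "removal_order vs L \<Longrightarrow> lower_region L"
proof (induction rule: removal_order.induct)
  case start
  then show ?case by (auto simp: lower_region_def octant_def)
next
  case (remove vs L v)
  then show ?case by (intro lower_region_remove)
qed

lemma below_in: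
  assumes "lower_region L" "removable L v"
  shows "below v \<in> L" "below v \<notin> init_conds L" "below v \<noteq> v"
  using removable_corners(1)[OF assms(2)] lower_regionD[OF assms(1)]
  by (cases v; fastforce simp: init_conds_def)+

lemma init_conds_remove:
  assumes "lower_region L" "removable L v"
  shows "init_conds (L - {v}) = insert (below v) (init_conds L - {v})"
proof -
  obtain i j k where v: "v = (i, j, k)" by (cases v)
  show ?thesis
    using below_in(1)[OF assms] removable_corners(1)[OF assms(2)]
    unfolding v init_conds_def by auto
qed

lemma ex_dir: "(\<exists>q. P q) \<longleftrightarrow> P Dir_a \<or> P Dir_b \<or> P Dir_c"
  using dir.exhaust by metis

lemma rhombus_corners:
  "rhombus q u = {u, opp_corner q u} \<union> (\<lambda>p. new_corner p u) ` (- {q})"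
  by (cases u; cases q) (auto simp: Compl_dir)

text \<open>Unless \<open>x\<close> is the lowest corner of a rhombus, another corner is reached from \<open>x\<close> by lowering one
  coordinate.\<close>

lemma rhombus_step_down:
  assumes "x \<in> rhombus q u"
  shows "x = opp_corner q u \<or> (\<exists>p. new_corner p x \<in> rhombus q u)"
proof -
  have "\<exists>p. p \<noteq> q" by (cases q) (simp_all add: ex_dir)
  moreover have "\<exists>p'. new_corner p' (new_corner p u) = opp_corner q u" if "p \<noteq> q" for p
    using that by (cases u; cases p; cases q) (simp_all add: ex_dir)
  ultimately show ?thesis using assms unfolding rhombus_corners by fastforce
qed

lemma below_eq_opp_corner: "below v = opp_corner q u \<longleftrightarrow> u = new_corner q v"
  by (cases u; cases v; cases q) auto

text \<open>The removal replaces the three rhombi based at \<open>v\<close> by the three rhombi with lowest corner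
  \<open>below v\<close> and touches no others. Indeed, a rhombus of the old surface that contains \<open>v\<close> is based
  at a point above \<open>v\<close>, hence at \<open>v\<close>. A rhombus of the new surface that contains \<open>below v\<close> elsewhere
  than at its lowest corner contains some \<open>new_corner p (below v)\<close>, and this point lies strictly
  below the initial condition \<open>new_corner p v\<close>.\<close>

lemma rhombi_in_remove:
  assumes "lower_region L" "removable L v"
  defines "R \<equiv> rhombi_in (init_conds L) - range (\<lambda>q. (q, v))"
  shows "rhombi_in (init_conds L) = R \<union> range (\<lambda>q. (q, v))"
    and "rhombi_in (init_conds (L - {v})) = R \<union> range (\<lambda>q. (q, new_corner q v))"
    and "(q, v) \<notin> R" "(q, new_corner q v) \<notin> R"
    and "(q, u) \<in> R \<Longrightarrow> rhombus q u \<subseteq> init_conds L - {v}"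
proof -
  obtain i j k where v: "v = (i, j, k)" by (cases v)
  have LO: "L \<subseteq> octant" using assms(1) by (simp add: lower_region_def)
  then have IO: "x \<in> init_conds L \<Longrightarrow> x \<in> octant" for x by (auto simp: init_conds_def)
  note C = removable_corners[OF assms(2)]
  have w: "below v \<notin> init_conds L" using below_in[OF assms(1,2)] by simp
  have r1: "(q, v) \<in> rhombi_in (init_conds L)" for q
    using assms(2) IO[OF C(1)] unfolding rhombi_in_def removable_def by auto
  show one: "rhombi_in (init_conds L) = R \<union> range (\<lambda>q. (q, v))"
    using r1 unfolding R_def by auto
  show "(q, v) \<notin> R" for q by (auto simp: R_def)
  have bott: "below v \<in> rhombus q (new_corner q v)" for q
    unfolding v by (cases q) auto
  show two: "(q, new_corner q v) \<notin> R" for q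
    using bott[of q] w by (auto simp: R_def rhombi_in_def)
  have top: "x = v" if "x \<in> init_conds L" "fst v \<le> fst x" "fst (snd v) \<le> fst (snd x)" "snd (snd v) \<le> snd (snd x)" for x
    using removable_top[OF assms(1), of i j k "fst x" "fst (snd x)" "snd (snd x)"] assms(2) that
    unfolding v by (auto simp: init_conds_def)
  have five: "rhombus q u \<subseteq> init_conds L - {v}" if "(q, u) \<in> R" for q u
  proof -
    have u: "rhombus q u \<subseteq> init_conds L" "u \<noteq> v" using that by (auto simp: R_def rhombi_in_def)
    have "v \<notin> rhombus q u"
    proof
      assume "v \<in> rhombus q u"
      then have "u = v" using top[of u] u(1) top_in_rhombus[of u q]
        by (cases u; cases q) (auto simp: v)
      then show False using u(2) by simp
    qed
    then show ?thesis using u by blast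
  qed
  then show "(q, u) \<in> R \<Longrightarrow> rhombus q u \<subseteq> init_conds L - {v}" for q u by blast
  let ?I = "init_conds (L - {v})"
  have I: "?I = insert (below v) (init_conds L - {v})" by (rule init_conds_remove[OF assms(1,2)])
  have nI: "new_corner p (below v) \<notin> ?I" for p
    using C(2)[of p] unfolding I v by (cases p) (auto simp: init_conds_def)
  show "rhombi_in ?I = R \<union> range (\<lambda>q. (q, new_corner q v))" (is "?l = ?r")
  proof (rule set_eqI, clarify)
    fix q u
    show "(q, u) \<in> ?l \<longleftrightarrow> (q, u) \<in> ?r"
    proof
      assume "(q, u) \<in> ?l"
      then have o: "u \<in> octant" and s: "rhombus q u \<subseteq> ?I" by (auto simp: rhombi_in_def)
      show "(q, u) \<in> ?r"
      proof (cases "below v \<in> rhombus q u")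
        case True
        have "u = new_corner q v"
          using rhombus_step_down[OF True] s nI unfolding below_eq_opp_corner by blast
        then show ?thesis by auto
      next
        case False
        then have "rhombus q u \<subseteq> init_conds L - {v}"
          using s unfolding I by (simp add: subset_insert)
        moreover from this have "u \<noteq> v" using top_in_rhombus[of u q] by blast
        ultimately show ?thesis using o by (auto simp: R_def rhombi_in_def)
      qed
    next
      assume "(q, u) \<in> ?r"
      then consider "(q, u) \<in> R" | "u = new_corner q v" by auto
      then show "(q, u) \<in> ?l"
      proof cases
        case 1
        then show ?thesis using five[OF 1] unfolding I by (auto simp: R_def rhombi_in_def)
      next
        case 2
        have c: "opp_corner p v \<noteq> v" "new_corner p v \<noteq> v" for p
          by (cases v; cases p; auto)+
        have "rhombus q (new_corner q v) \<subseteq> insert (below v) (range (\<lambda>p. opp_corner p v) \<union> {new_corner q v})"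
          unfolding v UNIV_dir by (cases q) auto
        moreover have "range (\<lambda>p. opp_corner p v) \<union> {new_corner q v} \<subseteq> init_conds L - {v}"
          using C c(1)[symmetric] c(2) by auto
        ultimately have "rhombus q u \<subseteq> ?I" unfolding I 2 by blast
        then show ?thesis using IO[OF C(2)[of q]] 2 by (auto simp: rhombi_in_def)
      qed
    qed
  qed
qed

section \<open>Connectivity\<close>

definition conn :: "edges \<Rightarrow> pt rel" where
  "conn G = {(x, y). {x, y} \<in> G}\<^sup>*"

lemma conn_refl [simp]: "(x, x) \<in> conn G"
  by (simp add: conn_def)

lemma conn_edge: "{x, y} \<in> G \<Longrightarrow> (x, y) \<in> conn G"
  unfolding conn_def by (rule r_into_rtrancl) simp

lemma conn_trans: "(x, y) \<in> conn G \<Longrightarrow> (y, z) \<in> conn G \<Longrightarrow> (x, z) \<in> conn G"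
  unfolding conn_def by (rule rtrancl_trans)

lemma conn_sym: "(x, y) \<in> conn G \<Longrightarrow> (y, x) \<in> conn G"
proof -
  have "sym (conn G)"
    unfolding conn_def by (rule sym_rtrancl) (auto simp: sym_def insert_commute)
  then show "(x, y) \<in> conn G \<Longrightarrow> (y, x) \<in> conn G" by (rule symD)
qed

lemma conn_class: "(x, x') \<in> conn G \<Longrightarrow> (x, y) \<in> conn G \<longleftrightarrow> (x', y) \<in> conn G"
  using conn_trans conn_sym by blast

lemma conn_mono: "G \<subseteq> G' \<Longrightarrow> (x, y) \<in> conn G \<Longrightarrow> (x, y) \<in> conn G'"
  unfolding conn_def using rtrancl_mono[of "{(x, y). {x, y} \<in> G}" "{(x, y). {x, y} \<in> G'}"] by blast

text \<open>The principle by which connections are carried over from one graph to another: it is enough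
  to carry over single edges, and \<open>\<pi>\<close> may merge vertices.\<close>

lemma conn_map:
  assumes "\<And>x y. {x, y} \<in> G \<Longrightarrow> (\<pi> x, \<pi> y) \<in> conn G'"
  assumes "(x, y) \<in> conn G"
  shows "(\<pi> x, \<pi> y) \<in> conn G'"
  using assms(2) unfolding conn_def[of G]
proof (induction rule: rtrancl_induct)
  case base
  show ?case by simp
next
  case (step y z)
  then show ?case using assms(1) conn_trans by blast
qed

lemma conn_invariant:
  assumes "\<And>x y. {x, y} \<in> G \<Longrightarrow> P x \<Longrightarrow> P y" "(x, y) \<in> conn G" "P x"
  shows "P y"
  using assms(2,3) unfolding conn_def
  by (induction rule: rtrancl_induct) (use assms(1) in auto)

lemma matched_at_iff:
  "matched_at I G N \<longleftrightarrow>
     (\<forall>u\<in>I. \<exists>!S. S \<in> boundary_sets N \<and> S \<subseteq> I \<and> (\<forall>y\<in>S. (u, y) \<in> conn G)) \<and>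
     (\<forall>S\<in>boundary_sets N. S \<subseteq> I \<and> (\<exists>u\<in>I. \<forall>y\<in>S. (u, y) \<in> conn G))"
proof -
  have sub: "S \<subseteq> {y \<in> I. (u, y) \<in> conn G} \<longleftrightarrow> S \<subseteq> I \<and> (\<forall>y\<in>S. (u, y) \<in> conn G)" for S u
    by blast
  show ?thesis
    unfolding matched_at_def components_def conn_def[symmetric] ball_simps(9) bex_simps(7) sub
    by (intro conj_cong ball_cong refl) blast
qed

lemma matched_atD:
  assumes "matched_at I G N"
  shows "u \<in> I \<Longrightarrow> \<exists>!S. S \<in> boundary_sets N \<and> S \<subseteq> I \<and> (\<forall>y\<in>S. (u, y) \<in> conn G)"
    and "S \<in> boundary_sets N \<Longrightarrow> S \<subseteq> I"
    and "S \<in> boundary_sets N \<Longrightarrow> \<exists>u\<in>I. \<forall>y\<in>S. (u, y) \<in> conn G"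
  using assms unfolding matched_at_iff by simp_all

lemma matched_at_unique:
  assumes m: "matched_at I G N" and u: "u \<in> I"
    and S: "S \<in> boundary_sets N" "\<forall>y\<in>S. (u, y) \<in> conn G"
    and S': "S' \<in> boundary_sets N" "\<forall>y\<in>S'. (u, y) \<in> conn G"
  shows "S = S'"
proof -
  note the_eq = the1_equality[OF matched_atD(1)[OF m u]]
  show ?thesis
    using the_eq[OF conjI[OF S(1) conjI[OF matched_atD(2)[OF m S(1)] S(2)]]]
      the_eq[OF conjI[OF S'(1) conjI[OF matched_atD(2)[OF m S'(1)] S'(2)]]]
    by (metis (no_types))
qed

lemma boundary_set_nonempty: "S \<in> boundary_sets N \<Longrightarrow> S \<noteq> {}"
  by (auto simp: boundary_sets_def)

lemma boundary_set_height:
  "S \<in> boundary_sets N \<Longrightarrow> x \<in> S \<Longrightarrow> height x \<le> - N - 1"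
  by (auto simp: boundary_sets_def)

text \<open>The boundary condition only depends on the connections between vertices of the boundary sets.
  Hence an inner vertex \<open>c\<close> that is connected to some other vertex may be exchanged for a new vertex
  \<open>c'\<close>, as long as the connections within the common part \<open>J\<close> are kept.\<close>

lemma matched_at_transfer:
  assumes m: "matched_at (insert c J) G N"
    and far: "\<And>S. S \<in> boundary_sets N \<Longrightarrow> c \<notin> S \<and> c' \<notin> S"
    and agree: "\<And>x y. x \<in> J \<Longrightarrow> y \<in> J \<Longrightarrow> (x, y) \<in> conn G' \<longleftrightarrow> (x, y) \<in> conn G"
    and z: "z \<in> J" "(c, z) \<in> conn G" and z': "z' \<in> J" "(c', z') \<in> conn G'"
  shows "matched_at (insert c' J) G' N"
proof -
  have to_J: "\<exists>x\<in>J. \<forall>y. (u, y) \<in> conn G' \<longleftrightarrow> (x, y) \<in> conn G'" if "u \<in> insert c' J" for u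
  proof (cases "u = c'")
    case True
    then show ?thesis using z'(1) conn_class[OF z'(2)] by (intro bexI[of _ z']) simp_all
  qed (use that in auto)
  have to_J': "\<exists>x\<in>J. \<forall>y. (u, y) \<in> conn G \<longleftrightarrow> (x, y) \<in> conn G" if "u \<in> insert c J" for u
  proof (cases "u = c")
    case True
    then show ?thesis using z(1) conn_class[OF z(2)] by (intro bexI[of _ z]) simp_all
  qed (use that in auto)
  have inJ: "S \<subseteq> J" if "S \<in> boundary_sets N" for S
    using matched_atD(2)[OF m that] far[OF that] by blast
  show ?thesis
    unfolding matched_at_iff
  proof (intro conjI ballI)
    fix u assume "u \<in> insert c' J"
    then obtain x where x: "x \<in> J" "\<And>y. (u, y) \<in> conn G' \<longleftrightarrow> (x, y) \<in> conn G'"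
      using to_J by blast
    have "\<exists>!S. S \<in> boundary_sets N \<and> S \<subseteq> insert c J \<and> (\<forall>y\<in>S. (x, y) \<in> conn G)"
      using matched_atD(1)[OF m] x(1) by simp
    moreover have "S \<in> boundary_sets N \<and> S \<subseteq> insert c J \<and> (\<forall>y\<in>S. (x, y) \<in> conn G) \<longleftrightarrow>
        S \<in> boundary_sets N \<and> S \<subseteq> insert c' J \<and> (\<forall>y\<in>S. (u, y) \<in> conn G')" for S
      using inJ[of S] x agree by blast
    ultimately show "\<exists>!S. S \<in> boundary_sets N \<and> S \<subseteq> insert c' J \<and> (\<forall>y\<in>S. (u, y) \<in> conn G')"
      by simp
  next
    fix S assume S: "S \<in> boundary_sets N"
    then show "S \<subseteq> insert c' J" using inJ by blast
    obtain u where "u \<in> insert c J" "\<forall>y\<in>S. (u, y) \<in> conn G"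
      using matched_atD(3)[OF m S] by blast
    then obtain x where "x \<in> J" "\<forall>y\<in>S. (x, y) \<in> conn G" using to_J' by blast
    then show "\<exists>u\<in>insert c' J. \<forall>y\<in>S. (u, y) \<in> conn G'" using agree inJ[OF S] by blast
  qed
qed

section \<open>Exchanging the inside of a hexagon\<close>

text \<open>The diagonals inside a hexagon with centre \<open>c\<close>, where short diagonals join \<open>c\<close> to points \<open>s q\<close> and
  long ones join two points \<open>t q\<close>. Both sides of a cube have this form, with the roles of \<open>s\<close> and
  \<open>t\<close> interchanged, so each statement about the removal and its inverse is proved only once.\<close>

definition star :: "pt \<Rightarrow> (dir \<Rightarrow> pt) \<Rightarrow> (dir \<Rightarrow> pt) \<Rightarrow> dir set \<Rightarrow> edges" where
  "star c s t P = (\<Union>q. {if q \<in> P then t ` (- {q}) else {c, s q}})"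

lemma local_diags_old:
  "local_diags (\<lambda>q. v) P = star v (\<lambda>q. opp_corner q v) (\<lambda>q. new_corner q v) P"
  unfolding local_diags_def star_def long_diag_old short_diag_old ..

lemma local_diags_new:
  "local_diags (\<lambda>q. new_corner q v) P = star (below v) (\<lambda>q. new_corner q v) (\<lambda>q. opp_corner q v) P"
  unfolding local_diags_def star_def long_diag_new short_diag_new ..

text \<open>\<open>P\<close> and \<open>P'\<close> are sets of long diagonals on the two sides of a cube that induce the same connections
  between the six corners. The relation is symmetric.\<close>

definition exchange :: "dir set \<Rightarrow> dir set \<Rightarrow> bool" where
  "exchange P P' \<longleftrightarrow> (\<exists>q. P = {} \<and> P' = - {q} \<or> P = - {q} \<and> P' = {} \<or> P = {q} \<and> P' = {q})"

lemma third_dir: "\<exists>r :: dir. r \<noteq> p \<and> r \<noteq> p'"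
  by (cases p; cases p') (simp_all add: ex_dir)

lemma exchange_sym: "exchange P P' \<Longrightarrow> exchange P' P"
  unfolding exchange_def by (elim exE disjE conjE) auto

lemma exchange_not_UNIV:
  assumes "exchange P P'"
  shows "P \<noteq> UNIV"
proof -
  obtain q where "P = {} \<or> P = - {q} \<or> P = {q}" using assms unfolding exchange_def by auto
  then show ?thesis using third_dir[of q q] by auto
qed

text \<open>The corner \<open>s r\<^sub>0\<close> can stand in for the centre \<open>c\<close>: on the other side of the cube, long diagonals
  connect it directly to all corners \<open>s p\<close> that were joined to \<open>c\<close>.\<close>

lemma exchange_center:
  assumes "exchange P P'"
  obtains r\<^sub>0 where "r\<^sub>0 \<notin> P" "\<And>p. p \<notin> P \<Longrightarrow> p \<noteq> r\<^sub>0 \<Longrightarrow> \<exists>r\<in>P'. r \<noteq> r\<^sub>0 \<and> r \<noteq> p"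
proof -
  obtain q where "P = {} \<and> P' = - {q} \<or> P = - {q} \<and> P' = {} \<or> P = {q} \<and> P' = {q}"
    using assms unfolding exchange_def by blast
  then consider "P = {}" "P' = - {q}" | "P = - {q}" | "P = {q}" "P' = {q}" by argo
  then show thesis
  proof cases
    case 1
    show thesis
    proof (rule that[of q])
      fix p
      show "\<exists>r\<in>P'. r \<noteq> q \<and> r \<noteq> p" using third_dir[of p q] unfolding 1 by auto
    qed (simp add: 1)
  next
    case 2
    show thesis by (rule that[of q]) (auto simp: 2)
  next
    case 3
    obtain r where "r \<noteq> q" using third_dir[of q q] by blast
    then show thesis by (intro that[of r]) (auto simp: 3)
  qed
qed

lemma exchange_long:
  assumes "exchange P P'" "r \<in> P" "p \<noteq> r" "p' \<noteq> r" "p \<noteq> p'"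
  shows "p \<notin> P'"
  using assms unfolding exchange_def by auto

lemma star_short_edge: "p \<notin> P \<Longrightarrow> {c, s p} \<in> star c s t P"
  unfolding star_def by (intro UN_I[of p]) simp_all

lemma star_long_edge: "r \<in> P \<Longrightarrow> t ` (- {r}) \<in> star c s t P"
  unfolding star_def by (intro UN_I[of r]) simp_all

lemma star_short_conn:
  assumes "p \<notin> P" "p' \<notin> P"
  shows "(s p, s p') \<in> conn (star c s t P)"
  using conn_edge[OF star_short_edge[OF assms(1)]] conn_edge[OF star_short_edge[OF assms(2)]]
    conn_sym conn_trans by metis

lemma star_long_conn:
  assumes "r \<in> P" "p \<noteq> r" "p' \<noteq> r"
  shows "(t p, t p') \<in> conn (star c s t P)"
proof (cases "p = p'")
  case False
  have "- {r} = {p, p'}" using assms(2,3) False by (cases r; cases p; cases p'; simp add: Compl_dir insert_commute)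
  then show ?thesis using conn_edge[of "t p" "t p'"] star_long_edge[of r P t c s] assms(1) by simp
qed simp

text \<open>Contract \<open>c\<close> to a corner that can stand in for it. Short diagonals at \<open>c\<close> become connections
  by long diagonals of the other side, and the long diagonals are replaced by paths through \<open>c'\<close>.\<close>

lemma conn_exchange:
  assumes ex: "exchange P P'"
    and c: "c \<notin> range s" "c \<notin> range t" "\<Union>H \<inter> {c} = {}"
    and xy: "(x, y) \<in> conn (H \<union> star c s t P)" "x \<noteq> c" "y \<noteq> c"
  shows "(x, y) \<in> conn (H \<union> star c' t s P')"
proof -
  let ?G = "H \<union> star c' t s P'"
  obtain r0 where r0: "r0 \<notin> P"
    and center: "\<And>p. p \<notin> P \<Longrightarrow> p \<noteq> r0 \<Longrightarrow> \<exists>r\<in>P'. r \<noteq> r0 \<and> r \<noteq> p"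
    by (rule exchange_center[OF ex]) blast
  define \<pi> where "\<pi> = (\<lambda>x. if x = c then s r0 else x)"
  have mono: "(a, b) \<in> conn ?G" if "(a, b) \<in> conn (star c' t s P')" for a b
    using conn_mono[OF _ that] by blast
  have ss: "(s r0, s p) \<in> conn ?G" if p: "p \<notin> P" for p
  proof (cases "p = r0")
    case False
    then obtain r where "r \<in> P'" "r \<noteq> r0" "r \<noteq> p" using center[OF p] by blast
    then show ?thesis by (intro mono star_long_conn[of r]) auto
  qed simp
  have tt: "(t p, t p') \<in> conn ?G" if "r \<in> P" "p \<noteq> r" "p' \<noteq> r" for p p' r
  proof (cases "p = p'")
    case False
    then show ?thesis
      using exchange_long[OF ex that] exchange_long[OF ex that(1,3,2)]
      by (intro mono star_short_conn) auto
  qed simp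
  have "(\<pi> x, \<pi> y) \<in> conn ?G" if e: "{x, y} \<in> H \<union> star c s t P" for x y
  proof -
    consider "{x, y} \<in> H" | q where "q \<in> P" "{x, y} = t ` (- {q})" | q where "q \<notin> P" "{x, y} = {c, s q}"
      using e by (auto simp: star_def split: if_splits)
    then show ?thesis
    proof cases
      case 1
      then have "\<pi> x = x" "\<pi> y = y" using c(3) by (auto simp: \<pi>_def)
      then show ?thesis using 1 conn_edge[of x y ?G] by simp
    next
      case (2 q)
      have "x \<in> t ` (- {q})" "y \<in> t ` (- {q})" unfolding 2(2)[symmetric] by simp_all
      then obtain p p' where p: "x = t p" "y = t p'" "p \<noteq> q" "p' \<noteq> q" by blast
      then have "\<pi> x = x" "\<pi> y = y" using c(2) by (auto simp: \<pi>_def)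
      then show ?thesis using tt[OF 2(1) p(3,4)] p by simp
    next
      case (3 q)
      have "s q \<noteq> c" using c(1) by auto
      then have "\<pi> x = s r0 \<and> \<pi> y = s q \<or> \<pi> x = s q \<and> \<pi> y = s r0"
        using 3(2) unfolding doubleton_eq_iff \<pi>_def by auto
      then show ?thesis using ss[OF 3(1)] conn_sym[OF ss[OF 3(1)]] by auto
    qed
  qed
  from conn_map[of _ \<pi>, OF this xy(1)] show ?thesis using xy(2,3) by (simp add: \<pi>_def)
qed

lemma matched_at_exchange:
  assumes ex: "exchange P P'"
    and J: "c \<notin> J" "c' \<notin> J" "range s \<subseteq> J" "range t \<subseteq> J" "\<Union>H \<subseteq> J"
    and far: "- N - 1 < height c" "- N - 1 < height c'"
    and m: "matched_at (insert c J) (H \<union> star c s t P) N"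
  shows "matched_at (insert c' J) (H \<union> star c' t s P') N"
proof -
  obtain r where r: "r \<notin> P" using exchange_not_UNIV[OF ex] by blast
  obtain r' where r': "r' \<notin> P'" using exchange_not_UNIV[OF exchange_sym[OF ex]] by blast
  show ?thesis
  proof (rule matched_at_transfer[OF m])
    show "c \<notin> S \<and> c' \<notin> S" if "S \<in> boundary_sets N" for S
      using boundary_set_height[OF that, of c] boundary_set_height[OF that, of c'] far by auto
    show "(x, y) \<in> conn (H \<union> star c' t s P') \<longleftrightarrow> (x, y) \<in> conn (H \<union> star c s t P)"
      if "x \<in> J" "y \<in> J" for x y
    proof -
      have ne: "x \<noteq> c" "y \<noteq> c" "x \<noteq> c'" "y \<noteq> c'" using that J(1,2) by blast+
      have c: "c \<notin> range s" "c \<notin> range t" "\<Union>H \<inter> {c} = {}"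
        and c': "c' \<notin> range s" "c' \<notin> range t" "\<Union>H \<inter> {c'} = {}"
        using J by blast+
      show ?thesis
        using conn_exchange[OF ex c _ ne(1,2)] conn_exchange[OF exchange_sym[OF ex] c'(2,1,3) _ ne(3,4)]
        by blast
    qed
    show "s r \<in> J" "t r' \<in> J" using J by auto
    show "(c, s r) \<in> conn (H \<union> star c s t P)"
      using star_short_edge[OF r] by (intro conn_edge UnI2)
    show "(c', t r') \<in> conn (H \<union> star c' t s P')"
      using star_short_edge[OF r'] by (intro conn_edge UnI2)
  qed
qed

text \<open>With three long diagonals the centre is a component by itself, but it lies too high to form a
  boundary set.\<close>

lemma matched_at_not_isolated:
  assumes J: "c \<notin> J" "range t \<subseteq> J" "\<Union>H \<subseteq> J" and far: "- N - 1 < height c"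
  shows "\<not> matched_at (insert c J) (H \<union> star c s t UNIV) N"
proof
  assume "matched_at (insert c J) (H \<union> star c s t UNIV) N"
  then obtain S where S: "S \<in> boundary_sets N" "\<forall>y\<in>S. (c, y) \<in> conn (H \<union> star c s t UNIV)"
    using matched_atD(1)[of _ _ N c] by blast
  obtain y where y: "y \<in> S" using boundary_set_nonempty[OF S(1)] by blast
  have no: "c \<notin> e" if "e \<in> H \<union> star c s t UNIV" for e
    using that J unfolding star_def by auto
  have "y = c"
  proof (rule conn_invariant[of _ "\<lambda>x. x = c" c])
    show "(c, y) \<in> conn (H \<union> star c s t UNIV)" using S y by blast
    show "b = c" if "{a, b} \<in> H \<union> star c s t UNIV" "a = c" for a b
      using no[OF that(1)] that(2) by simp
  qed simp
  then show False using boundary_set_height[OF S(1) y] far by simp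
qed

section \<open>Groves before and after the removal of a cube\<close>

definition old_diags :: "pt \<Rightarrow> dir set \<Rightarrow> edges" where
  "old_diags v = local_diags (\<lambda>q. v)"

definition new_diags :: "pt \<Rightarrow> dir set \<Rightarrow> edges" where
  "new_diags v = local_diags (\<lambda>q. new_corner q v)"

lemma opp_neq_corner: "opp_corner p v \<noteq> v" "opp_corner p v \<noteq> below v" "new_corner p v \<noteq> v" "new_corner p v \<noteq> below v"
  by (cases v; cases p; simp)+

lemma sum_dir: "(\<Sum>q\<in>UNIV. F (q :: dir)) = F Dir_a + F Dir_b + F Dir_c"
  by (simp add: UNIV_dir add.assoc)

lemma finite_UNIV_dir [simp]: "finite (A :: dir set)"
  by (rule finite)

lemma all_dir_sets:
  "(P :: dir set) = {} \<or> P = UNIV \<or> (\<exists>q. P = {q}) \<or> (\<exists>q. P = - {q})"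
  by (simp only: set_eq_iff all_dir ex_dir) (simp, argo)

lemma sum_dir_sets:
  fixes F :: "dir set \<Rightarrow> 'a::comm_monoid_add"
  assumes "F UNIV = 0"
  shows "(\<Sum>P\<in>UNIV. F P) = F {} + (\<Sum>q\<in>UNIV. F (- {q})) + (\<Sum>q\<in>UNIV. F {q})"
proof -
  have ne: "- {q} \<noteq> {}" "- {q} \<noteq> {q'}" "{q} \<noteq> UNIV" "- {q} \<noteq> UNIV" for q q' :: dir
    using third_dir[of q q] third_dir[of q q'] by (auto simp: set_eq_iff)
  define A where "A = range (\<lambda>q :: dir. - {q})"
  define B where "B = range (\<lambda>q :: dir. {q})"
  have U: "(UNIV :: dir set set) = insert {} (insert UNIV (A \<union> B))"
    unfolding A_def B_def by (rule UNIV_eq_I) (use all_dir_sets in auto)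
  have disj: "A \<inter> B = {}" "{} \<notin> A \<union> B" "UNIV \<notin> A \<union> B"
    using ne(2) ne(1)[symmetric] ne(3,4)[symmetric] unfolding A_def B_def by auto
  have "(\<Sum>P\<in>UNIV. F P) = F {} + (F UNIV + (sum F A + sum F B))"
    unfolding U using disj by (simp add: sum.union_disjoint)
  also have "sum F A = (\<Sum>q\<in>UNIV. F (- {q}))"
    unfolding A_def by (subst sum.reindex) (auto simp: inj_on_def)
  also have "sum F B = (\<Sum>q\<in>UNIV. F {q})"
    unfolding B_def by (subst sum.reindex) (auto simp: inj_on_def)
  finally show ?thesis using assms by (simp add: add.assoc)
qed

locale cube_removal =
  fixes L :: "pt set" and v :: pt
  assumes lower: "lower_region L" and removable: "removable L v"
begin

abbreviation "I \<equiv> init_conds L"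
abbreviation "I' \<equiv> init_conds (L - {v})"

definition rest :: "(dir \<times> pt) set" where
  "rest = rhombi_in I - range (\<lambda>q. (q, v))"

lemmas rhombi = rhombi_in_remove[OF lower removable, folded rest_def]

lemma v_in_L: "v \<in> L"
  using removable_corners(1)[OF removable] by (auto simp: init_conds_def)

lemma corners:
  "v \<in> I" "new_corner q v \<in> I - {v}" "opp_corner q v \<in> I - {v}" "below v \<notin> I" "below v \<noteq> v"
  using removable_corners[OF removable] below_in[OF lower removable] opp_neq_corner by simp_all

lemma corner_sets:
  "range (\<lambda>q. new_corner q v) \<subseteq> I - {v}" "range (\<lambda>q. opp_corner q v) \<subseteq> I - {v}"
  "below v \<notin> I - {v}" "v \<notin> I - {v}"
  using corners by (simp_all add: image_subset_iff)

lemma I_insert: "I = insert v (I - {v})" "I' = insert (below v) (I - {v})"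
  using corners init_conds_remove[OF lower removable] by blast+

lemma diag_subset_rhombus: "long_diag q u \<subseteq> rhombus q u" "short_diag q u \<subseteq> rhombus q u"
  by (cases u; cases q; auto)+

lemma rest_edges:
  assumes "H \<subseteq> diags rest"
  shows "\<Union>H \<subseteq> I - {v}"
proof (rule Union_least)
  fix e assume "e \<in> H"
  then obtain q u where "(q, u) \<in> rest" "e = long_diag q u \<or> e = short_diag q u"
    using assms unfolding diags_def by blast
  then show "e \<subseteq> I - {v}"
    using rhombi(5)[of q u] diag_subset_rhombus[of q u] by blast
qed

lemma groves_old_iff:
  "G \<in> groves I \<longleftrightarrow> (\<exists>H P. diag_choice rest H \<and> G = H \<union> old_diags v P) \<and>
     (\<exists>N\<^sub>0. \<forall>N\<ge>N\<^sub>0. matched_at I G N)"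
  unfolding groves_iff rhombi(1) old_diags_def using diag_choice_split[of "\<lambda>q. v", OF rhombi(3)] by simp

lemma groves_new_iff:
  "G \<in> groves I' \<longleftrightarrow> (\<exists>H P. diag_choice rest H \<and> G = H \<union> new_diags v P) \<and>
     (\<exists>N\<^sub>0. \<forall>N\<ge>N\<^sub>0. matched_at I' G N)"
  unfolding groves_iff rhombi(2) new_diags_def
  using diag_choice_split[of "\<lambda>q. new_corner q v", OF rhombi(4)] by simp

lemma exchange_grove:
  assumes H: "diag_choice rest H" and ex: "exchange P P'"
  shows "H \<union> old_diags v P \<in> groves I \<longleftrightarrow> H \<union> new_diags v P' \<in> groves I'"
proof -
  note E = rest_edges[OF diag_choiceD(1)[OF H]]
  have far: "- N - 1 < height v \<and> - N - 1 < height (below v)" if "N \<ge> - height v + 3" for N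
    using that by (cases v) auto
  note J = corner_sets
  have "matched_at I (H \<union> old_diags v P) N \<longleftrightarrow> matched_at I' (H \<union> new_diags v P') N"
    if "N \<ge> - height v + 3" for N
    unfolding I_insert(2) old_diags_def new_diags_def local_diags_old local_diags_new
    apply (subst (1) I_insert(1))
    using matched_at_exchange[OF ex J(4,3,2,1) E, of N] far[OF that]
      matched_at_exchange[OF exchange_sym[OF ex] J(3,4,1,2) E, of N] by blast
  then have "(\<exists>N\<^sub>0. \<forall>N\<ge>N\<^sub>0. matched_at I (H \<union> old_diags v P) N) \<longleftrightarrow>
      (\<exists>N\<^sub>0. \<forall>N\<ge>N\<^sub>0. matched_at I' (H \<union> new_diags v P') N)"
    by (meson dual_order.trans nle_le)
  then show ?thesis unfolding groves_old_iff groves_new_iff using H by blast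
qed

lemma not_isolated:
  assumes H: "diag_choice rest H"
  shows "H \<union> old_diags v UNIV \<notin> groves I" "H \<union> new_diags v UNIV \<notin> groves I'"
proof -
  note E = rest_edges[OF diag_choiceD(1)[OF H]]
  note J = corner_sets
  have far: "- N - 1 < height v \<and> - N - 1 < height (below v)" if "N \<ge> - height v + 3" for N
    using that by (cases v) auto
  have "\<not> matched_at I (H \<union> old_diags v UNIV) N \<and> \<not> matched_at I' (H \<union> new_diags v UNIV) N"
    if "N \<ge> - height v + 3" for N
    unfolding I_insert(2) old_diags_def new_diags_def local_diags_old local_diags_new
    apply (subst (1) I_insert(1))
    using matched_at_not_isolated[OF J(4,1) E, of N] matched_at_not_isolated[OF J(3,2) E, of N]
      far[OF that] by blast
  then show "H \<union> old_diags v UNIV \<notin> groves I" "H \<union> new_diags v UNIV \<notin> groves I'"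
    unfolding groves_old_iff groves_new_iff by (meson nle_le)+
qed

definition outer :: "dir set \<Rightarrow> edges set" where
  "outer P = {H. diag_choice rest H \<and> H \<union> old_diags v P \<in> groves I}"

definition outer' :: "dir set \<Rightarrow> edges set" where
  "outer' P = {H. diag_choice rest H \<and> H \<union> new_diags v P \<in> groves I'}"

lemma outer_UNIV: "outer UNIV = {}" "outer' UNIV = {}"
  unfolding outer_def outer'_def using not_isolated by blast+

lemma outer_exchange: "exchange P P' \<Longrightarrow> outer' P' = outer P"
  unfolding outer_def outer'_def using exchange_grove by blast

text \<open>All sums over groves are organised by three classes: \<open>outer {}\<close>, \<open>outer' {}\<close> and the sets
  \<open>outer {q}\<close>. On one side of the cube a member of the first or of the second class has a unique
  completion, on the other side it has three.\<close>

lemma outer'_eq: "outer' {} = outer (- {q})" "outer' (- {q}) = outer {}" "outer' {q} = outer {q}"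
  by (rule outer_exchange; auto simp: exchange_def)+

lemma outer_const: "outer (- {q}) = outer' {}"
  by (rule outer'_eq(1)[symmetric])

lemma bij_old: "bij_betw (\<lambda>(P, H). H \<union> old_diags v P) (Sigma UNIV outer) (groves I)"
  unfolding bij_betw_def
proof
  show "inj_on (\<lambda>(P, H). H \<union> old_diags v P) (Sigma UNIV outer)"
  proof (rule inj_onI, clarify)
    fix P H P' H'
    assume "H \<in> outer P" "H' \<in> outer P'" "H \<union> old_diags v P = H' \<union> old_diags v P'"
    then show "P = P' \<and> H = H'"
      using split_unique[of "\<lambda>q. v" rest H H' P P', OF rhombi(3)]
      unfolding outer_def old_diags_def diag_choice_def by blast
  qed
  show "(\<lambda>(P, H). H \<union> old_diags v P) ` Sigma UNIV outer = groves I"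
  proof (intro equalityI subsetI)
    fix G assume G: "G \<in> groves I"
    then obtain H P where H: "diag_choice rest H" "G = H \<union> old_diags v P"
      unfolding groves_old_iff by blast
    then have "(P, H) \<in> Sigma UNIV outer" using G by (simp add: outer_def)
    then show "G \<in> (\<lambda>(P, H). H \<union> old_diags v P) ` Sigma UNIV outer"
      by (rule rev_image_eqI) (simp add: H(2))
  qed (auto simp: outer_def)
qed

lemma bij_new: "bij_betw (\<lambda>(P, H). H \<union> new_diags v P) (Sigma UNIV outer') (groves I')"
  unfolding bij_betw_def
proof
  show "inj_on (\<lambda>(P, H). H \<union> new_diags v P) (Sigma UNIV outer')"
  proof (rule inj_onI, clarify)
    fix P H P' H'
    assume "H \<in> outer' P" "H' \<in> outer' P'" "H \<union> new_diags v P = H' \<union> new_diags v P'"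
    then show "P = P' \<and> H = H'"
      using split_unique[of "\<lambda>q. new_corner q v" rest H H' P P', OF rhombi(4)]
      unfolding outer'_def new_diags_def diag_choice_def by blast
  qed
  show "(\<lambda>(P, H). H \<union> new_diags v P) ` Sigma UNIV outer' = groves I'"
  proof (intro equalityI subsetI)
    fix G assume G: "G \<in> groves I'"
    then obtain H P where H: "diag_choice rest H" "G = H \<union> new_diags v P"
      unfolding groves_new_iff by blast
    then have "(P, H) \<in> Sigma UNIV outer'" using G by (simp add: outer'_def)
    then show "G \<in> (\<lambda>(P, H). H \<union> new_diags v P) ` Sigma UNIV outer'"
      by (rule rev_image_eqI) (simp add: H(2))
  qed (auto simp: outer'_def)
qed

lemma finite_outer:
  assumes "finite (groves I)"
  shows "finite (outer P)" "finite (outer' P)"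
proof -
  have "finite (Sigma UNIV outer)" using bij_betw_finite[OF bij_old] assms by blast
  then have "finite (snd ` Sigma UNIV outer)" by (rule finite_imageI)
  then show fin: "finite (outer P)" for P by (rule rev_finite_subset) force
  show "finite (outer' P)"
    using all_dir_sets[of P] fin
    by (elim disjE exE) (simp_all add: outer_UNIV outer'_eq(1)[of Dir_a] outer'_eq(2,3))
qed

lemma finite_groves_remove:
  assumes "finite (groves I)"
  shows "finite (groves I')"
proof -
  have "finite (Sigma UNIV outer')" using finite_outer(2)[OF assms] by (intro finite_SigmaI) auto
  then show ?thesis using bij_betw_finite[OF bij_new] by blast
qed

lemma sum_groves_old:
  assumes "finite (groves I)"
  shows "(\<Sum>G\<in>groves I. \<phi> G) =
    (\<Sum>H\<in>outer {}. \<phi> (H \<union> old_diags v {})) +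
    (\<Sum>H\<in>outer' {}. \<Sum>q\<in>UNIV. \<phi> (H \<union> old_diags v (- {q}))) +
    (\<Sum>q\<in>UNIV. \<Sum>H\<in>outer {q}. \<phi> (H \<union> old_diags v {q}))"
proof -
  have "(\<Sum>G\<in>groves I. \<phi> G) = (\<Sum>(P, H)\<in>Sigma UNIV outer. \<phi> (H \<union> old_diags v P))"
    using sum.reindex_bij_betw[OF bij_old, of \<phi>] by (simp add: case_prod_beta)
  also have "\<dots> = (\<Sum>P\<in>UNIV. \<Sum>H\<in>outer P. \<phi> (H \<union> old_diags v P))"
    using finite_outer(1)[OF assms] by (subst sum.Sigma) auto
  also have "\<dots> = (\<Sum>H\<in>outer {}. \<phi> (H \<union> old_diags v {})) +
      (\<Sum>q\<in>UNIV. \<Sum>H\<in>outer (- {q}). \<phi> (H \<union> old_diags v (- {q}))) +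
      (\<Sum>q\<in>UNIV. \<Sum>H\<in>outer {q}. \<phi> (H \<union> old_diags v {q}))"
    by (rule sum_dir_sets) (simp add: outer_UNIV)
  also have "(\<Sum>q\<in>UNIV. \<Sum>H\<in>outer (- {q}). \<phi> (H \<union> old_diags v (- {q}))) =
      (\<Sum>H\<in>outer' {}. \<Sum>q\<in>UNIV. \<phi> (H \<union> old_diags v (- {q})))"
    unfolding outer_const by (rule sum.swap)
  finally show ?thesis .
qed

lemma sum_groves_new:
  assumes "finite (groves I)"
  shows "(\<Sum>G\<in>groves I'. \<phi> G) =
    (\<Sum>H\<in>outer {}. \<Sum>q\<in>UNIV. \<phi> (H \<union> new_diags v (- {q}))) +
    (\<Sum>H\<in>outer' {}. \<phi> (H \<union> new_diags v {})) +
    (\<Sum>q\<in>UNIV. \<Sum>H\<in>outer {q}. \<phi> (H \<union> new_diags v {q}))"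
proof -
  have "(\<Sum>G\<in>groves I'. \<phi> G) = (\<Sum>(P, H)\<in>Sigma UNIV outer'. \<phi> (H \<union> new_diags v P))"
    using sum.reindex_bij_betw[OF bij_new, of \<phi>] by (simp add: case_prod_beta)
  also have "\<dots> = (\<Sum>P\<in>UNIV. \<Sum>H\<in>outer' P. \<phi> (H \<union> new_diags v P))"
    using finite_outer(2)[OF assms] by (subst sum.Sigma) auto
  also have "\<dots> = (\<Sum>H\<in>outer' {}. \<phi> (H \<union> new_diags v {})) +
      (\<Sum>q\<in>UNIV. \<Sum>H\<in>outer' (- {q}). \<phi> (H \<union> new_diags v (- {q}))) +
      (\<Sum>q\<in>UNIV. \<Sum>H\<in>outer' {q}. \<phi> (H \<union> new_diags v {q}))"
    by (rule sum_dir_sets) (simp add: outer_UNIV)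
  also have "(\<Sum>q\<in>UNIV. \<Sum>H\<in>outer' (- {q}). \<phi> (H \<union> new_diags v (- {q}))) =
      (\<Sum>H\<in>outer {}. \<Sum>q\<in>UNIV. \<phi> (H \<union> new_diags v (- {q})))"
    unfolding outer'_eq(2) by (rule sum.swap)
  finally show ?thesis unfolding outer'_eq(3) by (simp only: ac_simps)
qed

end

section \<open>Weights\<close>

definition long_set :: "edges \<Rightarrow> (dir \<times> pt) set" where
  "long_set G = {(q, u). u \<in> octant \<and> long_diag q u \<in> G}"

lemma grove_weight_alt: "grove_weight C G = (\<Prod>(q, u)\<in>long_set G. C q u)"
  unfolding grove_weight_def long_set_def ..

lemma finite_octant_above: "finite {x \<in> octant. - N \<le> height x}"
proof (rule finite_subset)
  show "{x \<in> octant. - N \<le> height x} \<subseteq> {- N..0} \<times> {- N..0} \<times> {- N..0}"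
    by (auto simp: octant_def)
qed auto

lemma rhombus_height: "x \<in> rhombus q u \<Longrightarrow> height x \<le> height u"
  by (cases u; cases q) auto

text \<open>Long diagonals occur only at bounded depth, and there the octant has finitely many points.\<close>

lemma finite_long_set:
  assumes "diag_choice R H"
  shows "finite (long_set H)"
proof -
  obtain N where N: "\<And>q v. (q, v) \<in> R \<Longrightarrow> (\<forall>x\<in>rhombus q v. height x < - N) \<Longrightarrow> short_diag q v \<in> H"
    using diag_choiceD(3)[OF assms] by metis
  have "long_set H \<subseteq> UNIV \<times> {x \<in> octant. - N \<le> height x}"
  proof (rule subrelI)
    fix q u assume qu: "(q, u) \<in> long_set H"
    then have R: "(q, u) \<in> R" using diag_choiceD(1)[OF assms] unfolding long_set_def by auto
    then have "short_diag q u \<notin> H" using diag_choiceD(2)[OF assms R] qu by (simp add: long_set_def)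
    then have "\<not> (\<forall>x\<in>rhombus q u. height x < - N)" using N[OF R] by blast
    then have "- N \<le> height u" using rhombus_height[of _ q u] by force
    then show "(q, u) \<in> UNIV \<times> {x \<in> octant. - N \<le> height x}"
      using qu by (simp add: long_set_def)
  qed
  then show ?thesis by (rule finite_subset) (simp add: finite_octant_above)
qed

lemma grove_weight_split:
  assumes H: "diag_choice R H" and disj: "\<And>q. (q, \<rho> q) \<notin> R" and oct: "\<And>q. \<rho> q \<in> octant"
  shows "grove_weight C (H \<union> local_diags \<rho> P) = grove_weight C H * (\<Prod>q\<in>P. C q (\<rho> q))"
proof -
  have s: "long_set (H \<union> local_diags \<rho> P) = long_set H \<union> (\<lambda>q. (q, \<rho> q)) ` P"
    using oct unfolding long_set_def by auto
  have d: "long_set H \<inter> (\<lambda>q. (q, \<rho> q)) ` P = {}"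
  proof -
    have "long_diag q (\<rho> q) \<notin> H" for q using diag_choiceD(1)[OF H] disj[of q] by auto
    then show ?thesis unfolding long_set_def by auto
  qed
  have "(\<Prod>(q, u)\<in>(\<lambda>q. (q, \<rho> q)) ` P. C q u) = (\<Prod>q\<in>P. C q (\<rho> q))"
    by (subst prod.reindex) (auto simp: inj_on_def)
  then show ?thesis
    unfolding grove_weight_alt s
    by (subst prod.union_disjoint) (use finite_long_set[OF H] d in auto)
qed

section \<open>Degrees and monomials\<close>

definition fin_edges :: "edges \<Rightarrow> bool" where
  "fin_edges G \<longleftrightarrow> (\<forall>x. finite {e \<in> G. x \<in> e})"

lemma fin_edges_diags: "G \<subseteq> diags R \<Longrightarrow> fin_edges G"
  unfolding fin_edges_def
proof
  fix x :: pt assume G: "G \<subseteq> diags R"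
  obtain i j k where x: "x = (i, j, k)" by (cases x)
  \<comment> \<open>the base points of all rhombi that can contain \<open>x\<close>\<close>
  define B where "B = {i..i+1} \<times> {j..j+1} \<times> {k..k+1}"
  have "{e \<in> G. x \<in> e} \<subseteq> (\<Union>q. \<Union>u\<in>B. {long_diag q u, short_diag q u})"
  proof
    fix e assume e: "e \<in> {e \<in> G. x \<in> e}"
    then obtain q u where qu: "e = long_diag q u \<or> e = short_diag q u"
      using G unfolding diags_def by blast
    obtain a b c where u: "u = (a, b, c)" by (cases u)
    have "u \<in> B" using qu e unfolding B_def x u by (cases q) auto
    then show "e \<in> (\<Union>q. \<Union>u\<in>B. {long_diag q u, short_diag q u})" using qu by blast
  qed
  moreover have "finite (\<Union>q. \<Union>u\<in>B. {long_diag q u, short_diag q u})"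
    by (auto simp: B_def)
  ultimately show "finite {e \<in> G. x \<in> e}" by (rule finite_subset)
qed

lemma degree_Un:
  assumes "fin_edges H" "finite D" "H \<inter> D = {}"
  shows "degree (H \<union> D) x = degree H x + degree D x"
proof -
  have "{e \<in> H \<union> D. x \<in> e} = {e \<in> H. x \<in> e} \<union> {e \<in> D. x \<in> e}" by blast
  moreover have "finite {e \<in> H. x \<in> e}" using assms(1) unfolding fin_edges_def by blast
  moreover have "finite {e \<in> D. x \<in> e}" using assms(2) by simp
  moreover have "{e \<in> H. x \<in> e} \<inter> {e \<in> D. x \<in> e} = {}" using assms(3) by blast
  ultimately show ?thesis unfolding degree_def by (simp only: card_Un_disjoint)
qed

lemma degree_outside: "x \<notin> \<Union>G \<Longrightarrow> degree G x = 0"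
  unfolding degree_def by (metis (mono_tags, lifting) Collect_empty_eq UnionI card.empty)

lemma prod_degree:
  fixes g :: "pt \<Rightarrow> 'a::comm_monoid_mult"
  assumes "finite D" "finite S"
  shows "(\<Prod>x\<in>S. g x ^ degree D x) = (\<Prod>e\<in>D. \<Prod>x\<in>e \<inter> S. g x)"
proof -
  have "(\<Prod>x\<in>S. g x ^ degree D x) = (\<Prod>x\<in>S. \<Prod>e | e \<in> D \<and> x \<in> e. g x)"
    by (simp add: degree_def)
  also have "\<dots> = (\<Prod>e\<in>D. \<Prod>x | x \<in> S \<and> x \<in> e. g x)"
    by (rule prod.swap_restrict[OF assms(2,1)])
  also have "\<dots> = (\<Prod>e\<in>D. \<Prod>x\<in>e \<inter> S. g x)"
    by (intro prod.cong refl) auto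
  finally show ?thesis .
qed

text \<open>Vertices of degree 2 contribute the factor 1, so the product may be taken over any finite set
  that contains all other vertices.\<close>

lemma grove_monomial_superset:
  assumes "finite F" "F \<subseteq> I" "\<And>x. x \<in> I - F \<Longrightarrow> degree G x = 2"
  shows "grove_monomial I g G = (\<Prod>x\<in>F. g x powi (int (degree G x) - 2))"
  unfolding grove_monomial_def
  by (rule prod.mono_neutral_left) (use assms in auto)

definition star_edge :: "pt \<Rightarrow> (dir \<Rightarrow> pt) \<Rightarrow> (dir \<Rightarrow> pt) \<Rightarrow> dir set \<Rightarrow> dir \<Rightarrow> pt set" where
  "star_edge c s t P q = (if q \<in> P then t ` (- {q}) else {c, s q})"

lemma star_alt: "star c s t P = range (star_edge c s t P)"
  unfolding star_def star_edge_def[abs_def] UNION_singleton_eq_range ..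

lemma finite_star [simp]: "finite (star c s t P)"
  by (simp add: star_alt)

text \<open>A hexagon as in \<open>star\<close>, together with a set \<open>H\<close> of edges that avoids its centre and its
  diagonals.\<close>

locale hexagon =
  fixes c :: pt and s t :: "dir \<Rightarrow> pt" and J :: "pt set" and H :: edges
  assumes inj_s: "inj s" and inj_t: "inj t" and st: "range s \<inter> range t = {}"
    and J: "c \<notin> J" "range s \<subseteq> J" "range t \<subseteq> J" "\<Union>H \<subseteq> J"
    and H: "fin_edges H" "\<And>P. H \<inter> star c s t P = {}"
begin

lemma c_notin: "c \<noteq> s q" "c \<noteq> t q" "c \<notin> t ` A"
  using J by auto

lemma inj_star_edge: "inj (star_edge c s t P)"
proof (rule injI)
  fix q q' assume e: "star_edge c s t P q = star_edge c s t P q'"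
  have "c \<in> star_edge c s t P q \<longleftrightarrow> q \<notin> P" for q using c_notin by (auto simp: star_edge_def)
  then have P: "q \<in> P \<longleftrightarrow> q' \<in> P" using e by metis
  show "q = q'"
  proof (cases "q \<in> P")
    case True
    then have "t ` (- {q}) = t ` (- {q'})" using e P by (simp add: star_edge_def)
    then have "- {q} = - {q'}" by (simp only: inj_image_eq_iff[OF inj_t])
    then show ?thesis by simp
  next
    case False
    then have "{c, s q} = {c, s q'}" using e P by (simp add: star_edge_def)
    then have "s q = s q'" using c_notin by (metis doubleton_eq_iff)
    then show ?thesis using inj_s by (simp add: inj_eq)
  qed
qed

lemma degree_center: "degree (H \<union> star c s t P) c = card (- P)"
proof -
  have "degree H c = 0" using J by (intro degree_outside) blast
  moreover have "{e \<in> star c s t P. c \<in> e} = star_edge c s t P ` (- P)"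
    using c_notin unfolding star_alt by (auto simp: star_edge_def)
  moreover have "card (star_edge c s t P ` (- P)) = card (- P)"
    by (rule card_image) (meson inj_star_edge inj_on_subset subset_UNIV)
  ultimately show ?thesis unfolding degree_Un[OF H(1) finite_star H(2)] by (simp add: degree_def)
qed

lemma star_vertices: "\<Union>(star c s t P) \<subseteq> insert c (range s \<union> range t)"
  unfolding star_def by (auto split: if_splits)

lemma degree_else:
  assumes "x \<in> J" "x \<notin> range s \<union> range t"
  shows "degree (H \<union> star c s t P) x = degree H x"
proof -
  have "degree (star c s t P) x = 0"
    using assms J star_vertices[of P] by (intro degree_outside) blast
  then show ?thesis unfolding degree_Un[OF H(1) finite_star H(2)] by simp
qed

lemma finite_nontrivial_iff:
  "finite {x \<in> insert c J. degree (H \<union> star c s t P) x \<noteq> 2} \<longleftrightarrow> finite {x \<in> J. degree H x \<noteq> 2}"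
proof -
  let ?F = "insert c (range s \<union> range t)"
  let ?A = "{x \<in> insert c J. degree (H \<union> star c s t P) x \<noteq> 2}"
  let ?B = "{x \<in> J. degree H x \<noteq> 2}"
  have e: "?A - ?F = ?B - ?F"
  proof (rule set_eqI)
    fix x
    show "x \<in> ?A - ?F \<longleftrightarrow> x \<in> ?B - ?F"
    proof (cases "x \<in> J \<and> x \<notin> ?F")
      case True
      then have "degree (H \<union> star c s t P) x = degree H x" by (intro degree_else) blast+
      then show ?thesis using True by simp
    next
      case False
      then show ?thesis by blast
    qed
  qed
  have "finite ?A \<longleftrightarrow> finite (?A - ?F)" by (rule finite_Diff2[symmetric]) simp
  also have "\<dots> \<longleftrightarrow> finite ?B" unfolding e by (rule finite_Diff2) simp
  finally show ?thesis .
qed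

definition base_support :: "pt set" where
  "base_support = range s \<union> range t \<union> {x \<in> J. degree H x \<noteq> 2}"

text \<open>Degrees add up, so the monomial splits into a part that depends on \<open>H\<close> only and a part that
  depends on the diagonals of the hexagon only. The latter is a product over these three diagonals
  of the variables at their end points (other than \<open>c\<close>), together with a power of the variable at
  the centre, whose degree is the number of short diagonals.\<close>

lemma grove_monomial_hexagon:
  fixes g :: "pt \<Rightarrow> 'a::field"
  assumes fin: "finite {x \<in> J. degree H x \<noteq> 2}" and nz: "\<And>x. x \<in> J \<Longrightarrow> g x \<noteq> 0"
  shows "grove_monomial (insert c J) g (H \<union> star c s t P) =
    (\<Prod>x\<in>base_support. g x powi (int (degree H x) - 2)) *
    (g c powi (int (card (- P)) - 2) *
      (\<Prod>q\<in>UNIV. if q \<in> P then (\<Prod>p\<in>- {q}. g (t p)) else g (s q)))"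
proof -
  let ?D = "star c s t P"
  let ?G = "H \<union> ?D"
  let ?S = "range s \<union> range t"
  have F: "finite base_support" "base_support \<subseteq> J" "?S \<subseteq> base_support"
    using fin J unfolding base_support_def by auto
  have c: "c \<notin> base_support" using F J by blast
  have deg: "degree ?G x = degree H x + degree ?D x" for x
    by (rule degree_Un[OF H(1) finite_star H(2)])
  have "grove_monomial (insert c J) g ?G = (\<Prod>x\<in>insert c base_support. g x powi (int (degree ?G x) - 2))"
  proof (rule grove_monomial_superset)
    show "degree ?G x = 2" if "x \<in> insert c J - insert c base_support" for x
      using that degree_else[of x P] unfolding base_support_def by auto
  qed (use F in auto)
  also have "\<dots> = g c powi (int (card (- P)) - 2) * (\<Prod>x\<in>base_support. g x powi (int (degree ?G x) - 2))"
    using F(1) c degree_center by simp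
  also have "(\<Prod>x\<in>base_support. g x powi (int (degree ?G x) - 2)) =
      (\<Prod>x\<in>base_support. g x powi (int (degree H x) - 2) * g x ^ degree ?D x)"
  proof (intro prod.cong refl)
    fix x assume "x \<in> base_support"
    then have "g x \<noteq> 0" using nz F by blast
    then have "g x powi ((int (degree H x) - 2) + int (degree ?D x)) =
        g x powi (int (degree H x) - 2) * g x ^ degree ?D x"
      by (subst power_int_add) auto
    then show "g x powi (int (degree ?G x) - 2) = g x powi (int (degree H x) - 2) * g x ^ degree ?D x"
      unfolding deg by (simp add: algebra_simps)
  qed
  also have "\<dots> = (\<Prod>x\<in>base_support. g x powi (int (degree H x) - 2)) * (\<Prod>x\<in>base_support. g x ^ degree ?D x)"
    by (rule prod.distrib)
  also have "(\<Prod>x\<in>base_support. g x ^ degree ?D x) = (\<Prod>x\<in>?S. g x ^ degree ?D x)"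
  proof (rule prod.mono_neutral_right[OF F(1,3)], rule ballI)
    fix x assume x: "x \<in> base_support - ?S"
    then have "x \<noteq> c" using c by blast
    then have "degree ?D x = 0" using star_vertices[of P] x by (intro degree_outside) blast
    then show "g x ^ degree ?D x = 1" by simp
  qed
  also have "\<dots> = (\<Prod>e\<in>?D. \<Prod>x\<in>e \<inter> ?S. g x)"
    by (rule prod_degree) auto
  also have "\<dots> = (\<Prod>q\<in>UNIV. \<Prod>x\<in>star_edge c s t P q \<inter> ?S. g x)"
    unfolding star_alt by (rule prod.reindex_cong[OF inj_star_edge refl refl])
  also have "\<dots> = (\<Prod>q\<in>UNIV. if q \<in> P then (\<Prod>p\<in>- {q}. g (t p)) else g (s q))"
  proof (intro prod.cong refl)
    fix q
    show "(\<Prod>x\<in>star_edge c s t P q \<inter> ?S. g x) = (if q \<in> P then (\<Prod>p\<in>- {q}. g (t p)) else g (s q))"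
    proof (cases "q \<in> P")
      case True
      then have "star_edge c s t P q \<inter> ?S = t ` (- {q})" by (auto simp: star_edge_def)
      moreover have "inj_on t (- {q})" using inj_t by (rule inj_on_subset) simp
      ultimately show ?thesis using True by (simp add: prod.reindex)
    next
      case False
      then have "star_edge c s t P q \<inter> ?S = {s q}" using c_notin by (auto simp: star_edge_def)
      then show ?thesis using False by simp
    qed
  qed
  finally show ?thesis by (simp only: ac_simps)
qed

end

lemma prod_dir: "(\<Prod>q\<in>UNIV. F (q :: dir)) = F Dir_a * F Dir_b * F Dir_c"
  by (simp add: UNIV_dir mult.assoc)

lemma Compl_dir2:
  "- {Dir_b, Dir_c} = {Dir_a}" "- {Dir_a, Dir_c} = {Dir_b}" "- {Dir_a, Dir_b} = {Dir_c}"
  using dir.exhaust by auto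

lemma inj_corners: "inj (\<lambda>q. new_corner q v)" "inj (\<lambda>q. opp_corner q v)"
proof -
  obtain i j k where v: "v = (i, j, k)" by (cases v)
  show "inj (\<lambda>q. new_corner q v)" "inj (\<lambda>q. opp_corner q v)"
    unfolding v inj_def all_dir by simp_all
qed

lemma corners_disjoint: "new_corner q v \<noteq> opp_corner p v"
  by (cases v; cases p; cases q) simp_all

text \<open>The finiteness that makes sums over groves and grove monomials meaningful. It is preserved by
  removals.\<close>

definition tame :: "pt set \<Rightarrow> bool" where
  "tame I \<longleftrightarrow> finite (groves I) \<and> (\<forall>G\<in>groves I. finite {x \<in> I. degree G x \<noteq> 2})"

context cube_removal
begin

lemma corners_octant: "v \<in> octant" "new_corner q v \<in> octant" "opp_corner q v \<in> octant" "below v \<in> octant"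
proof -
  have "L \<subseteq> octant" using lower by (simp add: lower_region_def)
  then have "I \<subseteq> octant" by (auto simp: init_conds_def)
  then show "v \<in> octant" "new_corner q v \<in> octant" "opp_corner q v \<in> octant"
    using corners by blast+
  show "below v \<in> octant" using below_in(1)[OF lower removable] \<open>L \<subseteq> octant\<close> by blast
qed

lemma hexagons:
  assumes "diag_choice rest H"
  shows "hexagon v (\<lambda>q. opp_corner q v) (\<lambda>q. new_corner q v) (I - {v}) H"
    and "hexagon (below v) (\<lambda>q. new_corner q v) (\<lambda>q. opp_corner q v) (I - {v}) H"
proof -
  have sub: "H \<subseteq> diags rest" using assms by (rule diag_choiceD)
  have d: "range (\<lambda>q. opp_corner q v) \<inter> range (\<lambda>q. new_corner q v) = {}"
    by (intro equals0I) (auto, metis corners_disjoint)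
  show "hexagon v (\<lambda>q. opp_corner q v) (\<lambda>q. new_corner q v) (I - {v}) H"
  proof
    show "H \<inter> star v (\<lambda>q. opp_corner q v) (\<lambda>q. new_corner q v) P = {}" for P
      using local_diags_outside[of "\<lambda>q. v" rest P, OF rhombi(3)] sub
      unfolding local_diags_old by blast
  qed (use inj_corners d corner_sets rest_edges[OF sub] fin_edges_diags[OF sub] in blast)+
  show "hexagon (below v) (\<lambda>q. new_corner q v) (\<lambda>q. opp_corner q v) (I - {v}) H"
  proof
    show "H \<inter> star (below v) (\<lambda>q. new_corner q v) (\<lambda>q. opp_corner q v) P = {}" for P
      using local_diags_outside[of "\<lambda>q. new_corner q v" rest P, OF rhombi(4)] sub
      unfolding local_diags_new by blast
  qed (use inj_corners d corner_sets rest_edges[OF sub] fin_edges_diags[OF sub] in blast)+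
qed

lemma nontrivial_old:
  assumes "diag_choice rest H"
  shows "finite {x \<in> I. degree (H \<union> old_diags v P) x \<noteq> 2} \<longleftrightarrow> finite {x \<in> I - {v}. degree H x \<noteq> 2}"
  unfolding old_diags_def local_diags_old
  by (subst (1) I_insert(1)) (rule hexagon.finite_nontrivial_iff[OF hexagons(1)[OF assms]])

lemma nontrivial_new:
  assumes "diag_choice rest H"
  shows "finite {x \<in> I'. degree (H \<union> new_diags v P) x \<noteq> 2} \<longleftrightarrow> finite {x \<in> I - {v}. degree H x \<noteq> 2}"
  unfolding new_diags_def local_diags_new I_insert(2)
  using hexagon.finite_nontrivial_iff[OF hexagons(2)[OF assms], of P] .

text \<open>The factor of the grove monomial that is the same before and after the removal.\<close>

definition outer_monomial :: "(pt \<Rightarrow> 'a::field) \<Rightarrow> edges \<Rightarrow> 'a" where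
  "outer_monomial g H = (\<Prod>x\<in>range (\<lambda>q. opp_corner q v) \<union> range (\<lambda>q. new_corner q v) \<union>
     {x \<in> I - {v}. degree H x \<noteq> 2}. g x powi (int (degree H x) - 2))"

lemma monomial_old:
  fixes g :: "pt \<Rightarrow> 'a::field"
  assumes H: "diag_choice rest H" and fin: "finite {x \<in> I - {v}. degree H x \<noteq> 2}"
    and nz: "\<forall>x\<in>I. g x \<noteq> 0"
  shows "grove_monomial I g (H \<union> old_diags v P) = outer_monomial g H *
    (g v powi (int (card (- P)) - 2) *
      (\<Prod>q\<in>UNIV. if q \<in> P then (\<Prod>p\<in>- {q}. g (new_corner p v)) else g (opp_corner q v)))"
  unfolding old_diags_def local_diags_old outer_monomial_def
  using hexagon.grove_monomial_hexagon[OF hexagons(1)[OF H] fin, of g P] nz I_insert(1)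
  by (simp add: hexagon.base_support_def[OF hexagons(1)[OF H]])

lemma monomial_new:
  fixes g :: "pt \<Rightarrow> 'a::field"
  assumes H: "diag_choice rest H" and fin: "finite {x \<in> I - {v}. degree H x \<noteq> 2}"
    and nz: "\<forall>x\<in>I. g x \<noteq> 0"
  shows "grove_monomial I' g (H \<union> new_diags v P) = outer_monomial g H *
    (g (below v) powi (int (card (- P)) - 2) *
      (\<Prod>q\<in>UNIV. if q \<in> P then (\<Prod>p\<in>- {q}. g (opp_corner p v)) else g (new_corner q v)))"
  unfolding new_diags_def local_diags_new outer_monomial_def I_insert(2)
  using hexagon.grove_monomial_hexagon[OF hexagons(2)[OF H] fin, of g P] nz
  by (simp add: hexagon.base_support_def[OF hexagons(2)[OF H]] Un_commute)

lemma weight_old: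
  assumes "diag_choice rest H"
  shows "grove_weight C (H \<union> old_diags v P) = grove_weight C H * (\<Prod>q\<in>P. C q v)"
  unfolding old_diags_def by (rule grove_weight_split[OF assms rhombi(3) corners_octant(1)])

lemma weight_new:
  assumes "diag_choice rest H"
  shows "grove_weight C (H \<union> new_diags v P) = grove_weight C H * (\<Prod>q\<in>P. C q (new_corner q v))"
  unfolding new_diags_def by (rule grove_weight_split[OF assms rhombi(4) corners_octant(2)])

lemma grove_new_cases:
  assumes "G \<in> groves I'"
  obtains H P P' where "exchange P P'" "diag_choice rest H" "G = H \<union> new_diags v P'"
    "H \<union> old_diags v P \<in> groves I"
proof -
  obtain H P' where H: "diag_choice rest H" and G: "G = H \<union> new_diags v P'"
    using assms unfolding groves_new_iff by blast
  have "P' \<noteq> UNIV" using not_isolated(2)[OF H] assms G by blast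
  then have "\<exists>P. exchange P P'" using all_dir_sets[of P'] unfolding exchange_def by blast
  then obtain P where P: "exchange P P'" by blast
  then show thesis using that[OF P H G] exchange_grove[OF H P] assms G by simp
qed

lemma tame_remove:
  assumes "tame I"
  shows "tame I'"
  unfolding tame_def
proof
  show "finite (groves I')" using assms finite_groves_remove by (simp add: tame_def)
  show "\<forall>G\<in>groves I'. finite {x \<in> I'. degree G x \<noteq> 2}"
  proof
    fix G assume "G \<in> groves I'"
    then obtain H P P' where G: "diag_choice rest H" "G = H \<union> new_diags v P'"
      "H \<union> old_diags v P \<in> groves I"
      by (rule grove_new_cases) blast
    then have "finite {x \<in> I. degree (H \<union> old_diags v P) x \<noteq> 2}" using assms by (simp add: tame_def)
    then show "finite {x \<in> I'. degree G x \<noteq> 2}"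
      unfolding G(2) nontrivial_new[OF G(1)] nontrivial_old[OF G(1)] .
  qed
qed

lemma outer_facts:
  assumes "tame I" "H \<in> outer P"
  shows "diag_choice rest H" "finite {x \<in> I - {v}. degree H x \<noteq> 2}"
proof -
  show H: "diag_choice rest H" using assms by (simp add: outer_def)
  have "finite {x \<in> I. degree (H \<union> old_diags v P) x \<noteq> 2}"
    using assms unfolding tame_def outer_def by blast
  then show "finite {x \<in> I - {v}. degree H x \<noteq> 2}" unfolding nontrivial_old[OF H] .
qed

end

section \<open>Y-Delta consistency and one removal\<close>

locale cube_step = cube_removal +
  fixes C :: cond
  assumes C_pos: "\<And>q u. u \<in> octant \<Longrightarrow> C q u > 0"
    and C_cons: "YDelta_consistent C"
begin

abbreviation "new_c q \<equiv> C q (new_corner q v)"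
abbreviation "old_c q \<equiv> C q v"
abbreviation "\<Delta> \<equiv> cube_Delta C v"

lemma c_pos: "new_c q > 0" "old_c q > 0"
  using C_pos corners_octant by blast+

lemma Delta_eq: "\<Delta> = new_c Dir_b * new_c Dir_c + new_c Dir_a * new_c Dir_c + new_c Dir_a * new_c Dir_b"
  by (cases v) simp

lemma Delta_pos: "\<Delta> > 0"
  unfolding Delta_eq using c_pos by (simp add: add_pos_pos)

lemma choice_prob_eq: "choice_prob C v q = (\<Prod>p\<in>- {q}. new_c p) / \<Delta>"
  by (cases v; cases q) (simp_all add: Compl_dir)

lemma choice_prob_sum: "(\<Sum>q\<in>UNIV. choice_prob C v q) = 1"
proof -
  have "(\<Sum>q\<in>UNIV. choice_prob C v q) = (new_c Dir_b * new_c Dir_c + new_c Dir_a * new_c Dir_c + new_c Dir_a * new_c Dir_b) / \<Delta>"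
    unfolding sum_dir choice_prob_eq by (simp add: Compl_dir add_divide_distrib)
  then show ?thesis using Delta_pos unfolding Delta_eq by simp
qed

text \<open>If \<open>S\<close> denotes the common value in the condition of Y-Delta consistency, then the condition reads
  \<open>old_c q = S * new_c q\<close>. Inserting this into the definition of \<open>S\<close> gives \<open>S = S\<^sup>2 * \<Delta>\<close>, so \<open>S\<close> is
  the inverse of \<open>\<Delta>\<close>.\<close>

lemma YDelta: "new_c q = \<Delta> * old_c q"
proof -
  obtain i j k where v: "v = (i, j, k)" by (cases v)
  define S where "S = old_c Dir_a * old_c Dir_b + old_c Dir_a * old_c Dir_c + old_c Dir_b * old_c Dir_c"
  have S: "S > 0" unfolding S_def using c_pos by (simp add: add_pos_pos)
  have "old_c q * (1 / new_c q) = S" for q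
    using C_cons corners_octant(1) unfolding YDelta_consistent_def S_def v Let_def short_cond_def
    by (cases q) (simp_all add: add.assoc del: times_divide_eq_right)
  then have K: "old_c q = S * new_c q" for q
    using c_pos(1)[of q] by (metis mult.right_neutral nonzero_eq_divide_eq order_less_irrefl times_divide_eq_right)
  have "S = S * S * \<Delta>"
    unfolding Delta_eq by (subst S_def) (simp add: K algebra_simps)
  then have "S * \<Delta> = 1" using S by simp
  then show ?thesis unfolding K by (simp add: algebra_simps)
qed

lemma card_dir: "card (UNIV :: dir set) = 3" "card (- {q :: dir}) = 2"
  by (simp add: UNIV_dir) (cases q; simp add: Compl_dir)

text \<open>The sum over groves of weight times monomial is multiplied by \<open>\<Delta>\<close> in each of the three
  classes. In the first one, three new completions replace a single old one, and their total
  is evaluated by the recurrence; in the second one, three old completions are evaluated in this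
  way; in the third one, completions correspond one to one. The coefficient map \<open>\<kappa>\<close> is the
  embedding of the reals into rational functions, or the identity when \<open>g\<close> is constant.\<close>

lemma weighted_sum_remove:
  fixes g :: "pt \<Rightarrow> 'a::field" and \<kappa> :: "real \<Rightarrow> 'a"
  assumes tame: "tame I"
    and add: "\<And>x y. \<kappa> (x + y) = \<kappa> x + \<kappa> y" and mult: "\<And>x y. \<kappa> (x * y) = \<kappa> x * \<kappa> y"
    and one: "\<kappa> 1 = 1"
    and nz: "\<forall>x\<in>I. g x \<noteq> 0" "g (below v) \<noteq> 0"
    and rec: "g v * g (below v) =
      (\<Sum>q\<in>UNIV. \<kappa> (choice_prob C v q) * (g (new_corner q v) * g (opp_corner q v)))"
  shows "(\<Sum>G\<in>groves I'. \<kappa> (grove_weight C G) * grove_monomial I' g G) =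
    \<kappa> \<Delta> * (\<Sum>G\<in>groves I. \<kappa> (grove_weight C G) * grove_monomial I g G)"
proof -
  let ?old = "\<lambda>P H. \<kappa> (grove_weight C (H \<union> old_diags v P)) * grove_monomial I g (H \<union> old_diags v P)"
  let ?new = "\<lambda>P H. \<kappa> (grove_weight C (H \<union> new_diags v P)) * grove_monomial I' g (H \<union> new_diags v P)"
  have nzc: "g v \<noteq> 0" using nz corners by blast
  have "\<kappa> \<Delta> * \<kappa> (1 / \<Delta>) = 1" using Delta_pos one by (simp add: mult[symmetric])
  then have \<kappa>\<Delta>: "\<kappa> \<Delta> \<noteq> 0" by auto
  have \<Delta>choice: "\<kappa> \<Delta> * \<kappa> (choice_prob C v q) = \<kappa> (\<Prod>p\<in>- {q}. new_c p)" for q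
    unfolding mult[symmetric] choice_prob_eq using Delta_pos by simp
  have rec': "\<kappa> \<Delta> * (g v * g (below v)) =
      \<kappa> (new_c Dir_b) * \<kappa> (new_c Dir_c) * (g (new_corner Dir_a v) * g (opp_corner Dir_a v)) +
      \<kappa> (new_c Dir_a) * \<kappa> (new_c Dir_c) * (g (new_corner Dir_b v) * g (opp_corner Dir_b v)) +
      \<kappa> (new_c Dir_a) * \<kappa> (new_c Dir_b) * (g (new_corner Dir_c v) * g (opp_corner Dir_c v))"
    unfolding rec sum_distrib_left mult.assoc[symmetric] \<Delta>choice
    by (simp add: sum_dir Compl_dir mult)
  let ?a = "g (new_corner Dir_a v)" and ?b = "g (new_corner Dir_b v)" and ?d = "g (new_corner Dir_c v)"
  let ?a' = "g (opp_corner Dir_a v)" and ?b' = "g (opp_corner Dir_b v)" and ?d' = "g (opp_corner Dir_c v)"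
  have A: "(\<Sum>q\<in>UNIV. ?new (- {q}) H) = \<kappa> \<Delta> * ?old {} H" if "H \<in> outer {}" for H
  proof -
    note H = outer_facts[OF tame that]
    \<comment> \<open>the factor common to the three new completions\<close>
    define M where "M = \<kappa> (grove_weight C H) * outer_monomial g H * ?a' * ?b' * ?d' / g (below v)"
    have new: "?new (- {Dir_a}) H = M * (\<kappa> (new_c Dir_b) * \<kappa> (new_c Dir_c) * (?a * ?a'))"
      "?new (- {Dir_b}) H = M * (\<kappa> (new_c Dir_a) * \<kappa> (new_c Dir_c) * (?b * ?b'))"
      "?new (- {Dir_c}) H = M * (\<kappa> (new_c Dir_a) * \<kappa> (new_c Dir_b) * (?d * ?d'))"
      using monomial_new[OF H nz(1)]
      by (simp_all add: M_def weight_new[OF H(1)] prod_dir Compl_dir Compl_dir2 mult power_int_minus field_simps)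
    have "(\<Sum>q\<in>UNIV. ?new (- {q}) H) = M * (\<kappa> \<Delta> * (g v * g (below v)))"
      unfolding sum_dir new rec' distrib_left ..
    also have "\<dots> = \<kappa> \<Delta> * ?old {} H"
      using monomial_old[OF H nz(1)] nz(2)
      by (simp add: M_def weight_old[OF H(1)] prod_dir card_dir field_simps)
    finally show ?thesis .
  qed
  have B: "?new {} H = \<kappa> \<Delta> * (\<Sum>q\<in>UNIV. ?old (- {q}) H)" if "H \<in> outer' {}" for H
  proof -
    note H = outer_facts[OF tame that[unfolded outer'_eq(1)[of Dir_a]]]
    \<comment> \<open>the factor common to the three old completions\<close>
    define M where "M = \<kappa> (grove_weight C H) * outer_monomial g H * ?a * ?b * ?d / g v"
    have old: "\<kappa> \<Delta> * \<kappa> \<Delta> * ?old (- {Dir_a}) H = M * (\<kappa> (new_c Dir_b) * \<kappa> (new_c Dir_c) * (?a * ?a'))"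
      "\<kappa> \<Delta> * \<kappa> \<Delta> * ?old (- {Dir_b}) H = M * (\<kappa> (new_c Dir_a) * \<kappa> (new_c Dir_c) * (?b * ?b'))"
      "\<kappa> \<Delta> * \<kappa> \<Delta> * ?old (- {Dir_c}) H = M * (\<kappa> (new_c Dir_a) * \<kappa> (new_c Dir_b) * (?d * ?d'))"
      using monomial_old[OF H nz(1)]
      by (simp_all add: M_def weight_old[OF H(1)] prod_dir Compl_dir Compl_dir2 mult YDelta power_int_minus field_simps)
    have "\<kappa> \<Delta> * (\<kappa> \<Delta> * (\<Sum>q\<in>UNIV. ?old (- {q}) H)) =
        (\<Sum>q\<in>UNIV. \<kappa> \<Delta> * \<kappa> \<Delta> * ?old (- {q}) H)"
      by (simp only: sum_distrib_left mult.assoc)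
    also have "\<dots> = M * (\<kappa> \<Delta> * (g v * g (below v)))"
      unfolding sum_dir old rec' distrib_left ..
    also have "\<dots> = \<kappa> \<Delta> * ?new {} H"
      using monomial_new[OF H nz(1)] nzc
      by (simp add: M_def weight_new[OF H(1)] prod_dir card_dir field_simps)
    finally show ?thesis using \<kappa>\<Delta> by simp
  qed
  have D: "?new {q} H = \<kappa> \<Delta> * ?old {q} H" if "H \<in> outer {q}" for q H
  proof -
    note H = outer_facts[OF tame that]
    show ?thesis
      using monomial_old[OF H nz(1)] monomial_new[OF H nz(1)]
      by (cases q) (simp_all add: weight_old[OF H(1)] weight_new[OF H(1)] card_dir mult YDelta prod_dir Compl_dir ac_simps)
  qed
  have fin: "finite (groves I)" using tame by (simp add: tame_def)
  show ?thesis
    unfolding sum_groves_old[OF fin] sum_groves_new[OF fin] distrib_left sum_distrib_left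
    using A B D by (simp add: sum_distrib_left)
qed

end

context cube_step
begin

text \<open>The constant function 1 satisfies the recurrence at \<open>v\<close>, as the three coefficients add up to 1.\<close>

lemma partition_fun_remove:
  assumes "tame I"
  shows "partition_fun C I' = \<Delta> * partition_fun C I"
proof -
  have m: "grove_monomial J (\<lambda>_. 1 :: real) G = 1" for J G
    by (simp add: grove_monomial_def)
  have "(\<Sum>G\<in>groves I'. grove_weight C G * grove_monomial I' (\<lambda>_. 1) G) =
      \<Delta> * (\<Sum>G\<in>groves I. grove_weight C G * grove_monomial I (\<lambda>_. 1) G)"
    using choice_prob_sum by (intro weighted_sum_remove[OF assms, of "\<lambda>x. x"]) simp_all
  then show ?thesis unfolding partition_fun_def m by simp
qed

lemma replace_cube_eq:
  assumes "diag_choice rest H"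
  shows "replace_cube v R (H \<union> old_diags v P) = H \<union> new_diags v R"
proof -
  let ?X = "\<Union>q. {long_diag q v, short_diag q v}"
  have "long_diag q v \<notin> H" "short_diag q v \<notin> H" for q
    using diag_choiceD(1)[OF assms] rhombi(3)[of q] by auto
  then have "H \<inter> ?X = {}" by blast
  moreover have "old_diags v P \<subseteq> ?X"
    unfolding old_diags_def by (auto elim!: local_diags_cases)
  ultimately have "(H \<union> old_diags v P) - ?X = H" by blast
  then show ?thesis
    unfolding replace_cube_def new_diags_def local_diags_def by simp
qed

lemma short_set_eq:
  assumes "diag_choice rest H"
  shows "{q. short_diag q v \<in> H \<union> old_diags v P} = - P"
proof -
  have "short_diag q v \<notin> H" for q
    using diag_choiceD(1)[OF assms] rhombi(3)[of q] by auto
  then show ?thesis unfolding old_diags_def by auto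
qed

lemma choice_prob_nonneg: "choice_prob C v q \<ge> 0"
  unfolding choice_prob_eq using c_pos Delta_pos by (simp add: prod_nonneg less_imp_le)

lemma pmf_choice: "pmf (embed_pmf (choice_prob C v)) q = choice_prob C v q"
proof (rule pmf_embed_pmf[OF choice_prob_nonneg])
  have "(\<integral>\<^sup>+ x. ennreal (choice_prob C v x) \<partial>count_space UNIV) = ennreal (\<Sum>q\<in>UNIV. choice_prob C v q)"
    by (simp add: nn_integral_count_space_finite sum_ennreal choice_prob_nonneg)
  then show "(\<integral>\<^sup>+ x. ennreal (choice_prob C v x) \<partial>count_space UNIV) = 1"
    by (simp add: choice_prob_sum)
qed

lemma pmf_shuffle:
  assumes H: "diag_choice rest H"
  shows "pmf (shuffle_step C v (H \<union> old_diags v {})) G =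
      (\<Sum>q\<in>UNIV. choice_prob C v q * of_bool (G = H \<union> new_diags v (- {q})))"
    and "pmf (shuffle_step C v (H \<union> old_diags v (- {q}))) G = of_bool (G = H \<union> new_diags v {})"
    and "pmf (shuffle_step C v (H \<union> old_diags v {q})) G = of_bool (G = H \<union> new_diags v {q})"
proof -
  note E = short_set_eq[OF H] replace_cube_eq[OF H]
  have "pmf (map_pmf (\<lambda>q. H \<union> new_diags v (- {q})) (embed_pmf (choice_prob C v))) G =
      (\<Sum>q | H \<union> new_diags v (- {q}) = G. choice_prob C v q)"
    by (simp add: pmf_map measure_measure_pmf_finite pmf_choice vimage_def)
  also have "\<dots> = (\<Sum>q\<in>UNIV. choice_prob C v q * of_bool (G = H \<union> new_diags v (- {q})))"
    by (rule sum.mono_neutral_cong_left) auto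
  finally show "pmf (shuffle_step C v (H \<union> old_diags v {})) G =
      (\<Sum>q\<in>UNIV. choice_prob C v q * of_bool (G = H \<union> new_diags v (- {q})))"
    unfolding shuffle_step_def Let_def E by (simp add: card_dir)
  show "pmf (shuffle_step C v (H \<union> old_diags v (- {q}))) G = of_bool (G = H \<union> new_diags v {})"
    unfolding shuffle_step_def Let_def E by (auto simp: indicator_def)
  show "pmf (shuffle_step C v (H \<union> old_diags v {q})) G = of_bool (G = H \<union> new_diags v {q})"
    unfolding shuffle_step_def Let_def E by (auto simp: indicator_def card_dir)
qed

lemma Delta_old_conductances: "\<Delta> * (old_c Dir_b * old_c Dir_c + old_c Dir_a * old_c Dir_c + old_c Dir_a * old_c Dir_b) = 1"
proof -
  have "\<Delta> * (\<Delta> * (old_c Dir_b * old_c Dir_c + old_c Dir_a * old_c Dir_c + old_c Dir_a * old_c Dir_b)) = \<Delta>"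
    by (subst (3) Delta_eq) (simp add: YDelta algebra_simps)
  then show ?thesis using Delta_pos by simp
qed

text \<open>The balance equation of a shuffling step, checked class by class: where one old grove has three
  successors, the choice probabilities are proportional to the weights of the successors; where
  three old groves have a common successor, their weights add up to \<open>1 / \<Delta>\<close> times its weight; the
  remaining steps are bijective.\<close>

lemma shuffle_sum:
  assumes tame: "tame I"
  shows "(\<Sum>A\<in>groves I. \<Delta> * grove_weight C A * pmf (shuffle_step C v A) G) =
    (if G \<in> groves I' then grove_weight C G else 0)"
proof -
  let ?old = "\<lambda>P H. \<Delta> * grove_weight C (H \<union> old_diags v P) * pmf (shuffle_step C v (H \<union> old_diags v P)) G"
  let ?new = "\<lambda>P H. grove_weight C (H \<union> new_diags v P) * of_bool (G = H \<union> new_diags v P)"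
  have fin: "finite (groves I)" using tame by (simp add: tame_def)
  have A: "?old {} H = (\<Sum>q\<in>UNIV. ?new (- {q}) H)" if "H \<in> outer {}" for H
  proof -
    note H = outer_facts(1)[OF tame that]
    have "grove_weight C (H \<union> new_diags v (- {q})) =
        \<Delta> * grove_weight C (H \<union> old_diags v {}) * choice_prob C v q" for q
      unfolding weight_new[OF H] weight_old[OF H] choice_prob_eq using Delta_pos by simp
    then show ?thesis unfolding pmf_shuffle[OF H] by (simp only: sum_distrib_left mult.assoc)
  qed
  have B: "(\<Sum>q\<in>UNIV. ?old (- {q}) H) = ?new {} H" if "H \<in> outer' {}" for H
  proof -
    note H = outer_facts(1)[OF tame that[unfolded outer'_eq(1)[of Dir_a]]]
    have "(\<Sum>q\<in>UNIV. \<Delta> * grove_weight C (H \<union> old_diags v (- {q}))) =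
        grove_weight C H * (\<Delta> * (old_c Dir_b * old_c Dir_c + old_c Dir_a * old_c Dir_c + old_c Dir_a * old_c Dir_b))"
      unfolding weight_old[OF H] by (simp add: sum_dir Compl_dir algebra_simps)
    also have "\<dots> = grove_weight C (H \<union> new_diags v {})"
      unfolding Delta_old_conductances weight_new[OF H] by simp
    finally show ?thesis unfolding pmf_shuffle[OF H] by (simp flip: sum_distrib_right)
  qed
  have D: "?old {q} H = ?new {q} H" if "H \<in> outer {q}" for q H
  proof -
    note H = outer_facts(1)[OF tame that]
    show ?thesis unfolding pmf_shuffle[OF H] weight_old[OF H] weight_new[OF H] by (simp add: YDelta)
  qed
  have "(\<Sum>A\<in>groves I. \<Delta> * grove_weight C A * pmf (shuffle_step C v A) G) =
      (\<Sum>A\<in>groves I'. grove_weight C A * of_bool (G = A))"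
    unfolding sum_groves_old[OF fin] sum_groves_new[OF fin] using A B D by simp
  also have "\<dots> = (if G \<in> groves I' then grove_weight C G else 0)"
    using finite_groves_remove[OF fin] by (simp add: of_bool_def if_distrib cong: if_cong)
  finally show ?thesis .
qed

lemma shuffle_step_distribution:
  assumes tame: "tame I" and \<mu>: "\<And>G. pmf \<mu> G = prob_cond C I G"
  shows "pmf (bind_pmf \<mu> (shuffle_step C v)) G = prob_cond C I' G"
proof -
  have fin: "finite (groves I)" using tame by (simp add: tame_def)
  have supp: "A \<in> groves I" if "A \<in> set_pmf \<mu>" for A
    using that \<mu>[of A] by (auto simp: set_pmf_iff prob_cond_def split: if_splits)
  have "pmf (bind_pmf \<mu> (shuffle_step C v)) G = (\<Sum>A\<in>groves I. pmf \<mu> A * pmf (shuffle_step C v A) G)"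
    unfolding pmf_bind using supp by (subst integral_measure_pmf[OF fin]) auto
  also have "\<dots> = (\<Sum>A\<in>groves I. \<Delta> * grove_weight C A * pmf (shuffle_step C v A) G) / (\<Delta> * partition_fun C I)"
    unfolding sum_divide_distrib using Delta_pos
    by (intro sum.cong refl) (simp add: \<mu> prob_cond_def)
  also have "\<dots> = prob_cond C I' G"
    unfolding shuffle_sum[OF tame] partition_fun_remove[OF tame, symmetric] prob_cond_def by simp
  finally show ?thesis .
qed

text \<open>With \<open>f\<close> satisfying the cube recurrence and \<open>C\<close> its conductance function, all conductances
  inside the cube are monomials in the values of \<open>f\<close> at its eight corners, and so is \<open>\<Delta>\<close>. The
  relation is then an identity of monomials for each of the three kinds of exchanges.\<close>

lemma cube_monomial_remove:
  assumes tame: "tame I"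
    and f: "\<And>x. x \<in> octant \<Longrightarrow> f x > 0" "cube_recurrence f" "\<And>q x. x \<in> octant \<Longrightarrow> cond_of f q x = C q x"
    and ex: "exchange P P'" and H: "diag_choice rest H" and G: "H \<union> old_diags v P \<in> groves I"
  shows "grove_monomial I' f (H \<union> new_diags v P') * \<Delta> * grove_weight C (H \<union> old_diags v P) =
    grove_monomial I f (H \<union> old_diags v P) * grove_weight C (H \<union> new_diags v P')"
proof -
  obtain i j k where v: "v = (i, j, k)" by (cases v)
  have fin: "finite {x \<in> I - {v}. degree H x \<noteq> 2}"
    using outer_facts(2)[OF tame] H G unfolding outer_def by blast
  let ?x = "f v" and ?y = "f (below v)"
  let ?a = "f (new_corner Dir_a v)" and ?b = "f (new_corner Dir_b v)" and ?d = "f (new_corner Dir_c v)"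
  let ?a' = "f (opp_corner Dir_a v)" and ?b' = "f (opp_corner Dir_b v)" and ?d' = "f (opp_corner Dir_c v)"
  have pos: "?x > 0" "?y > 0" "?a > 0" "?b > 0" "?d > 0" "?a' > 0" "?b' > 0" "?d' > 0"
    using f(1) corners_octant by auto
  have c: "new_c Dir_a = ?b' * ?d' / (?a * ?y)" "new_c Dir_b = ?a' * ?d' / (?b * ?y)" "new_c Dir_c = ?a' * ?b' / (?d * ?y)"
    using f(3)[OF corners_octant(2)[of Dir_a], of Dir_a, symmetric]
      f(3)[OF corners_octant(2)[of Dir_b], of Dir_b, symmetric]
      f(3)[OF corners_octant(2)[of Dir_c], of Dir_c, symmetric]
    unfolding v by (simp_all add: algebra_simps)
  have K: "old_c Dir_a = ?b * ?d / (?x * ?a')" "old_c Dir_b = ?a * ?d / (?x * ?b')" "old_c Dir_c = ?a * ?b / (?x * ?d')"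
    using f(3)[OF corners_octant(1), of Dir_a, symmetric]
      f(3)[OF corners_octant(1), of Dir_b, symmetric] f(3)[OF corners_octant(1), of Dir_c, symmetric]
    unfolding v by (simp_all add: algebra_simps)
  have \<Delta>: "\<Delta> = ?a' * ?b' * ?d' * ?x / (?a * ?b * ?d * ?y)"
  proof -
    have "new_c Dir_a = \<Delta> * old_c Dir_a" by (rule YDelta)
    then show ?thesis unfolding c K using pos by (simp add: field_simps)
  qed
  have nz: "\<forall>x\<in>I. f x \<noteq> 0"
    using f(1) lower unfolding init_conds_def lower_region_def by fastforce
  note eqs = weight_old[OF H] weight_new[OF H] monomial_old[OF H fin nz] monomial_new[OF H fin nz]
  note simps = prod_dir Compl_dir Compl_dir2 card_dir power_int_minus c K \<Delta>
  from ex obtain q where "P = {} \<and> P' = - {q} \<or> P = - {q} \<and> P' = {} \<or> P = {q} \<and> P' = {q}"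
    unfolding exchange_def by blast
  then show ?thesis
    unfolding eqs using pos
    by (cases q; elim disjE conjE; simp add: simps; simp add: field_simps)
qed

end

section \<open>Coordinates on the initial surface\<close>

definition I0 :: "pt set" where
  "I0 = init_conds octant"

lemma octant_iff: "(i, j, k) \<in> octant \<longleftrightarrow> i \<le> 0 \<and> j \<le> 0 \<and> k \<le> 0"
  by (simp add: octant_def)

lemma I0_iff: "(i, j, k) \<in> I0 \<longleftrightarrow> i \<le> 0 \<and> j \<le> 0 \<and> k \<le> 0 \<and> (i = 0 \<or> j = 0 \<or> k = 0)"
  by (auto simp: I0_def init_conds_def octant_def)

lemma I0_eq: "{(i, j, k). (i, j, k) \<in> octant \<and> max i (max j k) = 0} = I0"
proof (rule set_eqI)
  fix x :: pt
  obtain i j k where "x = (i, j, k)" by (cases x)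
  then show "x \<in> {(i, j, k). (i, j, k) \<in> octant \<and> max i (max j k) = 0} \<longleftrightarrow> x \<in> I0"
    by (simp add: I0_iff octant_iff max_def) arith
qed

lemma rhombi_I0: "(q, (i, j, k)) \<in> rhombi_in I0 \<longleftrightarrow>
    i \<le> 0 \<and> j \<le> 0 \<and> k \<le> 0 \<and> (case q of Dir_a \<Rightarrow> i = 0 | Dir_b \<Rightarrow> j = 0 | Dir_c \<Rightarrow> k = 0)"
  by (cases q; simp add: rhombi_in_def I0_iff octant_iff; arith)

text \<open>On the initial surface short diagonals run along diagonal rays of the faces. Subtracting the
  middle one of the three coordinates, and cutting off at 0, moves a point along its ray to the
  coordinate axis.\<close>

fun ray_end :: "pt \<Rightarrow> pt" where
  "ray_end (i, j, k) = (let m = max (min i j) (max (min j k) (min i k)) in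
     (min 0 (i - m), min 0 (j - m), min 0 (k - m)))"

fun axis :: "pt \<Rightarrow> bool" where
  "axis (i, j, k) \<longleftrightarrow> i \<le> 0 \<and> j \<le> 0 \<and> k \<le> 0 \<and> (i = 0 \<and> j = 0 \<or> i = 0 \<and> k = 0 \<or> j = 0 \<and> k = 0)"

lemma axis_I0: "axis x \<Longrightarrow> x \<in> I0"
  by (cases x) (auto simp: I0_iff)

lemma axis_ray_end: "x \<in> I0 \<Longrightarrow> axis (ray_end x)"
  by (cases x) (auto simp: I0_iff Let_def min_def max_def)

lemma ray_end_axis: "axis x \<Longrightarrow> ray_end x = x"
  by (cases x) (auto simp: Let_def min_def max_def)

text \<open>The three faces of the initial surface, each with both orders of its two coordinates. Thus
  symmetric arguments for the three faces and for the two sides of a face are made once, for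
  a generic \<open>(q, E)\<close>.\<close>

definition faces :: "(dir \<times> (int \<Rightarrow> int \<Rightarrow> pt)) set" where
  "faces = {(Dir_a, \<lambda>j k. (0, j, k)), (Dir_a, \<lambda>j k. (0, k, j)),
            (Dir_b, \<lambda>j k. (j, 0, k)), (Dir_b, \<lambda>j k. (k, 0, j)),
            (Dir_c, \<lambda>j k. (j, k, 0)), (Dir_c, \<lambda>j k. (k, j, 0))}"

lemma face_rhombus: "(q, E) \<in> faces \<Longrightarrow> j \<le> 0 \<Longrightarrow> k \<le> 0 \<Longrightarrow> (q, E j k) \<in> rhombi_in I0"
  unfolding faces_def by (auto simp: rhombi_I0)

lemma face_short: "(q, E) \<in> faces \<Longrightarrow> short_diag q (E j k) = {E j k, E (j - 1) (k - 1)}"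
  unfolding faces_def by auto

lemma face_long: "(q, E) \<in> faces \<Longrightarrow> long_diag q (E j k) = {E (j - 1) k, E j (k - 1)}"
  unfolding faces_def by auto

lemma face_ray_end:
  "(q, E) \<in> faces \<Longrightarrow> j \<le> 0 \<Longrightarrow> k \<le> 0 \<Longrightarrow> ray_end (E j k) = E (j - max j k) (k - max j k)"
  unfolding faces_def by (auto simp: Let_def min_def max_def)

lemma face_inject: "(q, E) \<in> faces \<Longrightarrow> E j k = E j' k' \<longleftrightarrow> j = j' \<and> k = k'"
  unfolding faces_def by auto

lemma face_I0: "(q, E) \<in> faces \<Longrightarrow> j \<le> 0 \<Longrightarrow> k \<le> 0 \<Longrightarrow> E j k \<in> I0"
  unfolding faces_def by (auto simp: I0_iff)

lemma face_cover:
  assumes "(q, u) \<in> rhombi_in I0"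
  obtains E j k where "(q, E) \<in> faces" "k \<le> j" "j \<le> 0" "u = E j k"
proof -
  obtain x y z where u: "u = (x, y, z)" by (cases u)
  show thesis
  proof (cases q)
    case Dir_a
    then show thesis
      using assms that[of "\<lambda>j k. (0, j, k)" z y] that[of "\<lambda>j k. (0, k, j)" y z]
      unfolding u rhombi_I0 faces_def by (cases "z \<le> y") auto
  next
    case Dir_b
    then show thesis
      using assms that[of "\<lambda>j k. (j, 0, k)" z x] that[of "\<lambda>j k. (k, 0, j)" x z]
      unfolding u rhombi_I0 faces_def by (cases "z \<le> x") auto
  next
    case Dir_c
    then show thesis
      using assms that[of "\<lambda>j k. (j, k, 0)" y x] that[of "\<lambda>j k. (k, j, 0)" x y]
      unfolding u rhombi_I0 faces_def by (cases "y \<le> x") auto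
  qed
qed

lemma face_cover_point:
  assumes "x \<in> I0"
  obtains q E j k where "(q, E) \<in> faces" "j \<le> 0" "k \<le> 0" "x = E j k"
proof -
  obtain i j k where x: "x = (i, j, k)" by (cases x)
  then have "(Dir_a, x) \<in> rhombi_in I0 \<or> (Dir_b, x) \<in> rhombi_in I0 \<or> (Dir_c, x) \<in> rhombi_in I0"
    using assms by (auto simp: rhombi_I0 I0_iff)
  then obtain q where "(q, x) \<in> rhombi_in I0" by blast
  then show thesis by (rule face_cover) (use that order.trans in blast)
qed

text \<open>If all rhombi at depth less than \<open>m\<close> use their short diagonal, then these lead from every point at
  depth at most \<open>m\<close> to the axis.\<close>

lemma conn_ray_end:
  assumes "(q, E) \<in> faces" "j \<le> 0" "k \<le> 0"
    and "\<And>j k. j \<le> 0 \<Longrightarrow> k \<le> 0 \<Longrightarrow> max j k > - m \<Longrightarrow> short_diag q (E j k) \<in> G"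
    and "max j k \<ge> - m"
  shows "(E j k, ray_end (E j k)) \<in> conn G"
proof -
  have "(E j k, ray_end (E j k)) \<in> conn G"
    if "max j k = - int d" "int d \<le> m" "j \<le> 0" "k \<le> 0" for d j k
    using that
  proof (induction d arbitrary: j k)
    case 0
    then show ?case by (simp add: face_ray_end[OF assms(1)])
  next
    case (Suc d)
    then have jk: "j + 1 \<le> 0" "k + 1 \<le> 0" "max (j + 1) (k + 1) = - int d" by auto
    have IH: "(E (j + 1) (k + 1), ray_end (E (j + 1) (k + 1))) \<in> conn G"
      using Suc.IH[OF jk(3) _ jk(1,2)] Suc.prems by simp
    have "short_diag q (E (j + 1) (k + 1)) \<in> G"
      using assms(4)[OF jk(1,2)] Suc.prems jk(3) by simp
    then have "(E j k, E (j + 1) (k + 1)) \<in> conn G"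
      unfolding face_short[OF assms(1)] by (intro conn_edge) (simp add: insert_commute)
    moreover have "ray_end (E (j + 1) (k + 1)) = ray_end (E j k)"
    proof -
      have top: "max j k = - int d - 1" using Suc.prems by simp
      then show ?thesis
        unfolding face_ray_end[OF assms(1) jk(1,2)] face_ray_end[OF assms(1) Suc.prems(3,4)] jk(3) top
        by (simp add: algebra_simps)
    qed
    ultimately show ?case using IH conn_trans by metis
  qed
  from this[of j k "nat (- max j k)"] show ?thesis using assms(2,3,5) by simp
qed

section \<open>Boundary sets of the initial surface\<close>

text \<open>The boundary set at level \<open>N\<close> that lies on the rays ending in the given point of an axis. The
  coordinate \<open>p\<close> is the one for which the height of the boundary points is \<open>-N - 1\<close> or \<open>-N - 2\<close>,
  whichever has the right parity; points of the axes below this level are boundary sets on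
  their own.\<close>

fun bset :: "int \<Rightarrow> pt \<Rightarrow> pt set" where
  "bset N (i, j, k) =
     (let n = - (i + j + k); p = - ((N + 2 - n) div 2) in
      if n \<ge> N + 1 then {(i, j, k)}
      else if k \<noteq> 0 then {(0, p, p - n), (p, 0, p - n)}
      else if j \<noteq> 0 then {(p, p - n, 0), (0, p - n, p)}
      else if i \<noteq> 0 then {(p - n, 0, p), (p - n, p, 0)}
      else {(0, p, p), (p, 0, p), (p, p, 0)})"

lemma bset_below:
  assumes n: "n = - (i + j + k)" and p: "p = - ((N + 2 - n) div 2)" and "\<not> N + 1 \<le> n"
  shows "bset N (i, j, k) =
     (if k \<noteq> 0 then {(0, p, p - n), (p, 0, p - n)}
      else if j \<noteq> 0 then {(p, p - n, 0), (0, p - n, p)}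
      else if i \<noteq> 0 then {(p - n, 0, p), (p - n, p, 0)}
      else {(0, p, p), (p, 0, p), (p, p, 0)})"
  unfolding bset.simps Let_def n[symmetric] p[symmetric] by (rule if_not_P[OF assms(3)])

lemma boundary_setsE:
  assumes "S \<in> boundary_sets N"
  obtains p q where "0 > p" "p > q" "p + q \<in> {- N - 1, - N - 2}" "S = {(0, p, q), (p, 0, q)}"
    | p q where "0 > p" "p > q" "p + q \<in> {- N - 1, - N - 2}" "S = {(p, q, 0), (0, q, p)}"
    | p q where "0 > p" "p > q" "p + q \<in> {- N - 1, - N - 2}" "S = {(q, 0, p), (q, p, 0)}"
    | p where "2 * p \<in> {- N - 1, - N - 2}" "S = {(0, p, p), (p, 0, p), (p, p, 0)}"
    | q where "q \<le> - N - 1" "S = {(0, 0, q)} \<or> S = {(0, q, 0)} \<or> S = {(q, 0, 0)}"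
  using assms unfolding boundary_sets_def
  by (elim UnE CollectE exE conjE)
    ((rule that(1), assumption+) | (rule that(2), assumption+) | (rule that(3), assumption+) |
     (rule that(4), assumption+) | (rule that(5), assumption, simp))+

lemma boundary_setsI:
  shows "0 > p \<Longrightarrow> p > q \<Longrightarrow> p + q \<in> {- N - 1, - N - 2} \<Longrightarrow> {(0, p, q), (p, 0, q)} \<in> boundary_sets N"
    and "0 > p \<Longrightarrow> p > q \<Longrightarrow> p + q \<in> {- N - 1, - N - 2} \<Longrightarrow> {(p, q, 0), (0, q, p)} \<in> boundary_sets N"
    and "0 > p \<Longrightarrow> p > q \<Longrightarrow> p + q \<in> {- N - 1, - N - 2} \<Longrightarrow> {(q, 0, p), (q, p, 0)} \<in> boundary_sets N"
    and "2 * p \<in> {- N - 1, - N - 2} \<Longrightarrow> {(0, p, p), (p, 0, p), (p, p, 0)} \<in> boundary_sets N"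
    and "q \<le> - N - 1 \<Longrightarrow> {(0, 0, q)} \<in> boundary_sets N"
    and "q \<le> - N - 1 \<Longrightarrow> {(0, q, 0)} \<in> boundary_sets N"
    and "q \<le> - N - 1 \<Longrightarrow> {(q, 0, 0)} \<in> boundary_sets N"
  unfolding boundary_sets_def
  subgoal by (rule UnI1, rule UnI1, rule UnI1, rule UnI1, rule UnI1, rule UnI1, rule CollectI, blast)
  subgoal by (rule UnI1, rule UnI1, rule UnI1, rule UnI1, rule UnI1, rule UnI2, rule CollectI, blast)
  subgoal by (rule UnI1, rule UnI1, rule UnI1, rule UnI1, rule UnI2, rule CollectI, blast)
  subgoal by (rule UnI1, rule UnI1, rule UnI1, rule UnI2, rule CollectI, blast)
  subgoal by (rule UnI1, rule UnI1, rule UnI2, rule CollectI, blast)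
  subgoal by (rule UnI1, rule UnI2, rule CollectI, blast)
  subgoal by (rule UnI2, rule CollectI, blast)
  done

text \<open>The boundary sets are thereby indexed by the points of the axes. This is the bijection behind the
  counting argument for uniqueness.\<close>

lemma boundary_sets_eq:
  assumes "N \<ge> 0"
  shows "boundary_sets N = bset N ` {x. axis x}"
proof (intro equalityI subsetI)
  fix S assume "S \<in> boundary_sets N"
  then show "S \<in> bset N ` {x. axis x}"
  proof (cases rule: boundary_setsE)
    case (1 p q)
    then have "(N + 2 - (p - q)) div 2 = - p" by auto
    then have S: "S = bset N (0, 0, q - p)" using 1 by (auto simp: Let_def)
    show ?thesis unfolding S by (rule imageI) (use 1 in auto)
  next
    case (2 p q)
    then have "(N + 2 - (p - q)) div 2 = - p" by auto
    then have S: "S = bset N (0, q - p, 0)" using 2 by (auto simp: Let_def)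
    show ?thesis unfolding S by (rule imageI) (use 2 in auto)
  next
    case (3 p q)
    then have "(N + 2 - (p - q)) div 2 = - p" by auto
    then have S: "S = bset N (q - p, 0, 0)" using 3 by (auto simp: Let_def)
    show ?thesis unfolding S by (rule imageI) (use 3 in auto)
  next
    case (4 p)
    then have "(N + 2) div 2 = - p" by auto
    then have S: "S = bset N (0, 0, 0)" using 4 assms by (auto simp: Let_def)
    show ?thesis unfolding S by (rule imageI) simp
  next
    case (5 q)
    then have "S = bset N (0, 0, q) \<or> S = bset N (0, q, 0) \<or> S = bset N (q, 0, 0)" by auto
    moreover have "axis (0, 0, q)" "axis (0, q, 0)" "axis (q, 0, 0)" using 5 assms by auto
    ultimately show ?thesis by blast
  qed
next
  fix S assume "S \<in> bset N ` {x. axis x}"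
  then obtain i j k where x: "axis (i, j, k)" "S = bset N (i, j, k)" by auto
  define n where "n = - (i + j + k)"
  define p where "p = - ((N + 2 - n) div 2)"
  show "S \<in> boundary_sets N"
  proof (cases "n \<ge> N + 1")
    case True
    then have S: "S = {(i, j, k)}" using x by (simp add: n_def)
    have "S = {(0, 0, - n)} \<or> S = {(0, - n, 0)} \<or> S = {(- n, 0, 0)}"
      using x(1) unfolding S n_def by auto
    moreover have "- n \<le> - N - 1" using True by simp
    ultimately show ?thesis using boundary_setsI(5-7) by metis
  next
    case False
    have n0: "n \<ge> 0" using x(1) by (auto simp: n_def)
    have p: "p < 0" "p + (p - n) \<in> {- N - 1, - N - 2}" using False by (auto simp: p_def)
    have S: "S = (if k \<noteq> 0 then {(0, p, p - n), (p, 0, p - n)}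
      else if j \<noteq> 0 then {(p, p - n, 0), (0, p - n, p)}
      else if i \<noteq> 0 then {(p - n, 0, p), (p - n, p, 0)}
      else {(0, p, p), (p, 0, p), (p, p, 0)})"
      unfolding x(2) by (rule bset_below[OF n_def p_def False])
    show ?thesis
    proof (cases "n = 0")
      case True
      then have "i = 0" "j = 0" "k = 0" using x(1) by (auto simp: n_def)
      then have "S = {(0, p, p), (p, 0, p), (p, p, 0)}" using S by simp
      moreover have "2 * p \<in> {- N - 1, - N - 2}" using p True by simp
      ultimately show ?thesis using boundary_setsI(4) by metis
    next
      case False
      then have "p > p - n" using n0 by simp
      moreover have "i \<noteq> 0 \<or> j \<noteq> 0 \<or> k \<noteq> 0" using False by (auto simp: n_def)
      then have "S = {(0, p, p - n), (p, 0, p - n)} \<or> S = {(p, p - n, 0), (0, p - n, p)} \<or>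
          S = {(p - n, 0, p), (p - n, p, 0)}"
        using S by auto
      ultimately show ?thesis using p boundary_setsI(1-3) by metis
    qed
  qed
qed

lemma bset_facts:
  assumes "axis x" "N \<ge> 0" "y \<in> bset N x"
  shows "y \<in> I0" "ray_end y = x"
proof -
  obtain i j k where x: "x = (i, j, k)" by (cases x)
  define n where "n = - (i + j + k)"
  define p where "p = - ((N + 2 - n) div 2)"
  have "y \<in> I0 \<and> ray_end y = x"
  proof (cases "n \<ge> N + 1")
    case True
    then have "y = x" using assms by (simp add: x n_def)
    then show ?thesis using assms ray_end_axis axis_I0 by simp
  next
    case False
    have n0: "n \<ge> 0" using assms(1) by (auto simp: n_def x)
    have p: "p < 0" using False by (auto simp: p_def)
    have "y \<in> (if k \<noteq> 0 then {(0, p, p - n), (p, 0, p - n)}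
      else if j \<noteq> 0 then {(p, p - n, 0), (0, p - n, p)}
      else if i \<noteq> 0 then {(p - n, 0, p), (p - n, p, 0)}
      else {(0, p, p), (p, 0, p), (p, p, 0)})"
      using assms(3) unfolding x bset_below[OF n_def p_def False] .
    then consider "k \<noteq> 0" "y = (0, p, p - n) \<or> y = (p, 0, p - n)"
      | "k = 0" "j \<noteq> 0" "y = (p, p - n, 0) \<or> y = (0, p - n, p)"
      | "k = 0" "j = 0" "i \<noteq> 0" "y = (p - n, 0, p) \<or> y = (p - n, p, 0)"
      | "k = 0" "j = 0" "i = 0" "y = (0, p, p) \<or> y = (p, 0, p) \<or> y = (p, p, 0)"
      by (auto split: if_splits)
    then show ?thesis
    proof cases
      case 1
      then have "x = (0, 0, - n)" using assms(1) by (auto simp: x n_def)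
      then show ?thesis using 1(2) p n0 by (auto simp: I0_iff Let_def)
    next
      case 2
      then have "x = (0, - n, 0)" using assms(1) by (auto simp: x n_def)
      then show ?thesis using 2(3) p n0 by (auto simp: I0_iff Let_def)
    next
      case 3
      then have "x = (- n, 0, 0)" by (auto simp: x n_def)
      then show ?thesis using 3(4) p n0 by (auto simp: I0_iff Let_def)
    next
      case 4
      then have "x = (0, 0, 0)" by (auto simp: x)
      then show ?thesis using 4(4) p by (auto simp: I0_iff Let_def)
    qed
  qed
  then show "y \<in> I0" "ray_end y = x" by simp_all
qed

lemma bset_nonempty: "bset N x \<noteq> {}"
  by (cases x) (auto simp: Let_def)


lemma bset_inject:
  assumes "axis x" "axis x'" "N \<ge> 0" "bset N x = bset N x'"
  shows "x = x'"
proof -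
  obtain y where "y \<in> bset N x" using bset_nonempty by blast
  then show ?thesis using bset_facts(2) assms by metis
qed

section \<open>The grove of short diagonals\<close>

definition short_grove :: edges where
  "short_grove = (\<lambda>(q, u). short_diag q u) ` rhombi_in I0"

lemma short_in_short_grove [simp]: "short_diag q u \<in> short_grove \<longleftrightarrow> (q, u) \<in> rhombi_in I0"
  unfolding short_grove_def by auto

lemma long_notin_short_grove [simp]: "long_diag q u \<notin> short_grove"
  unfolding short_grove_def by auto

lemma short_grove_ray_end:
  assumes "{x, y} \<in> short_grove"
  shows "ray_end x = ray_end y"
proof -
  obtain q u where qu: "(q, u) \<in> rhombi_in I0" "{x, y} = short_diag q u"
    using assms unfolding short_grove_def by auto
  obtain E j k where E: "(q, E) \<in> faces" "k \<le> j" "j \<le> 0" "u = E j k"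
    using face_cover[OF qu(1)] by blast
  have "ray_end (E j k) = ray_end (E (j - 1) (k - 1))"
    using E by (simp add: face_ray_end[OF E(1)])
  then show ?thesis using qu(2) unfolding E(4) face_short[OF E(1)] doubleton_eq_iff by metis
qed

text \<open>The components of the grove of short diagonals are the unions of the rays with a common end.\<close>

lemma conn_short_grove:
  assumes "x \<in> I0" "y \<in> I0"
  shows "(x, y) \<in> conn short_grove \<longleftrightarrow> ray_end x = ray_end y"
proof
  assume xy: "(x, y) \<in> conn short_grove"
  show "ray_end x = ray_end y"
  proof (rule conn_invariant[OF _ xy, of "\<lambda>z. ray_end x = ray_end z"])
    show "ray_end x = ray_end b" if "{a, b} \<in> short_grove" "ray_end x = ray_end a" for a b
      using short_grove_ray_end[OF that(1)] that(2) by simp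
  qed simp
next
  have up: "(z, ray_end z) \<in> conn short_grove" if "z \<in> I0" for z
  proof -
    obtain q E j k where E: "(q, E) \<in> faces" "j \<le> 0" "k \<le> 0" "z = E j k"
      using face_cover_point[OF \<open>z \<in> I0\<close>] by blast
    show ?thesis
      unfolding E(4) by (rule conn_ray_end[OF E(1-3), of "- max j k"]) (simp_all add: face_rhombus[OF E(1)])
  qed
  assume "ray_end x = ray_end y"
  then show "(x, y) \<in> conn short_grove" using up[OF assms(1)] up[OF assms(2)] conn_sym conn_trans by metis
qed

lemma short_grove_matched:
  assumes "N \<ge> 0"
  shows "matched_at I0 short_grove N"
  unfolding matched_at_iff boundary_sets_eq[OF assms]
proof (intro conjI ballI)
  have conn_bset: "(\<forall>y\<in>bset N x. (u, y) \<in> conn short_grove) \<longleftrightarrow> ray_end u = x" if "axis x" "u \<in> I0" for x u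
  proof -
    have "(u, y) \<in> conn short_grove \<longleftrightarrow> ray_end u = x" if "y \<in> bset N x" for y
      using conn_short_grove[OF \<open>u \<in> I0\<close>, of y] bset_facts[OF \<open>axis x\<close> assms that] by simp
    then show ?thesis using bset_nonempty[of N x] by blast
  qed
  have sub: "bset N x \<subseteq> I0" if "axis x" for x
    using bset_facts(1)[OF that assms] by blast
  fix u assume u: "u \<in> I0"
  show "\<exists>!S. S \<in> bset N ` {x. axis x} \<and> S \<subseteq> I0 \<and> (\<forall>y\<in>S. (u, y) \<in> conn short_grove)"
  proof (rule ex1I[of _ "bset N (ray_end u)"])
    show "bset N (ray_end u) \<in> bset N ` {x. axis x} \<and> bset N (ray_end u) \<subseteq> I0 \<and>
        (\<forall>y\<in>bset N (ray_end u). (u, y) \<in> conn short_grove)"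
      using axis_ray_end[OF u] conn_bset[OF axis_ray_end[OF u] u] sub by blast
    fix S assume S: "S \<in> bset N ` {x. axis x} \<and> S \<subseteq> I0 \<and> (\<forall>y\<in>S. (u, y) \<in> conn short_grove)"
    then obtain x where "axis x" "S = bset N x" by blast
    then show "S = bset N (ray_end u)" using S conn_bset[OF _ u, of x] by simp
  qed
next
  fix S assume "S \<in> bset N ` {x. axis x}"
  then obtain x where x: "axis x" "S = bset N x" by blast
  then show "S \<subseteq> I0" using bset_facts(1)[OF x(1) assms] by blast
  show "\<exists>u\<in>I0. \<forall>y\<in>S. (u, y) \<in> conn short_grove"
  proof (intro bexI[of _ x] ballI)
    fix y assume "y \<in> S"
    then show "(x, y) \<in> conn short_grove"
      using conn_short_grove[OF axis_I0[OF x(1)], of y] bset_facts[OF x(1) assms, of y] x ray_end_axis[OF x(1)] by simp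
  qed (rule axis_I0[OF x(1)])
qed

lemma short_grove_grove: "short_grove \<in> groves I0"
proof -
  have "diag_choice (rhombi_in I0) short_grove"
    unfolding diag_choice_def by (auto simp: short_grove_def diags_def)
  then show ?thesis unfolding groves_iff using short_grove_matched by blast
qed

section \<open>Uniqueness of the initial grove\<close>

fun zeros :: "pt \<Rightarrow> bool \<times> bool \<times> bool" where
  "zeros (i, j, k) = (i = 0, j = 0, k = 0)"

text \<open>Edges stay in a face, so a path can change the face only in a point of an axis.\<close>

lemma edge_zeros:
  assumes "{x, y} \<in> diags (rhombi_in I0)" "\<not> axis x" "\<not> axis y"
  shows "zeros x = zeros y"
proof -
  obtain q u where qu: "(q, u) \<in> rhombi_in I0" "{x, y} = short_diag q u \<or> {x, y} = long_diag q u"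
    using assms(1) unfolding diags_def by auto
  obtain E j k where E: "(q, E) \<in> faces" "k \<le> j" "j \<le> 0" "u = E j k"
    using face_cover[OF qu(1)] by blast
  have z: "zeros (E a b) = zeros (E (-1) (-1))" if "\<not> axis (E a b)" "a \<le> 0" "b \<le> 0" for a b
    using E(1) that unfolding faces_def by auto
  have "x \<in> {E j k, E (j - 1) (k - 1), E (j - 1) k, E j (k - 1)}"
    "y \<in> {E j k, E (j - 1) (k - 1), E (j - 1) k, E j (k - 1)}"
    using qu(2) unfolding E(4) face_short[OF E(1)] face_long[OF E(1)] by auto
  then show ?thesis using z assms(2,3) E(2,3) by auto
qed

lemma bset_two_faces:
  assumes "axis x" "N \<ge> 0" "height x \<ge> - N"
  obtains y y' where "y \<in> bset N x" "y' \<in> bset N x" "zeros y \<noteq> zeros y'"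
proof -
  obtain i j k where x: "x = (i, j, k)" by (cases x)
  define n where "n = - (i + j + k)"
  define p where "p = - ((N + 2 - n) div 2)"
  have n: "\<not> N + 1 \<le> n" "n \<ge> 0" using assms by (auto simp: n_def x)
  have p: "p < 0" using n by (auto simp: p_def)
  note B = bset_below[OF n_def p_def n(1), folded x]
  consider "k \<noteq> 0" | "k = 0" "j \<noteq> 0" | "k = 0" "j = 0" "i \<noteq> 0" | "k = 0" "j = 0" "i = 0" by blast
  then show thesis
  proof cases
    case 1
    show thesis
      by (rule that[of "(0, p, p - n)" "(p, 0, p - n)"]) (use 1 p in \<open>auto simp: B\<close>)
  next
    case 2
    show thesis
      by (rule that[of "(p, p - n, 0)" "(0, p - n, p)"]) (use 2 p in \<open>auto simp: B\<close>)
  next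
    case 3
    show thesis
      by (rule that[of "(p - n, 0, p)" "(p - n, p, 0)"]) (use 3 p in \<open>auto simp: B\<close>)
  next
    case 4
    show thesis
      by (rule that[of "(0, p, p)" "(p, 0, p)"]) (use 4 p in \<open>auto simp: B\<close>)
  qed
qed

text \<open>The boundary set of \<open>x\<close> has points on two faces, so its component contains a point \<open>z\<close> of an axis.
  This point is not below the level \<open>-N\<close>, since otherwise \<open>{z}\<close> would be a second boundary set in
  the same component.\<close>

lemma axis_in_component:
  assumes G: "G \<in> groves I0" and x: "axis x" and N: "N \<ge> 0" "matched_at I0 G N" "height x \<ge> - N"
  shows "\<exists>z. axis z \<and> height z \<ge> - N \<and> (\<forall>y\<in>bset N x. (z, y) \<in> conn G)"
proof -
  have sub: "G \<subseteq> diags (rhombi_in I0)" using G by (simp add: groves_iff diag_choice_def)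
  have S: "bset N x \<in> boundary_sets N" using x boundary_sets_eq[OF N(1)] by blast
  obtain u where u: "\<forall>y\<in>bset N x. (u, y) \<in> conn G" using matched_atD(3)[OF N(2) S] by blast
  obtain y y' where y: "y \<in> bset N x" "y' \<in> bset N x" "zeros y \<noteq> zeros y'"
    using bset_two_faces[OF x N(1,3)] by blast
  have all: "\<forall>y'\<in>bset N x. (z, y') \<in> conn G" if "(y, z) \<in> conn G" for z
  proof
    fix y' assume "y' \<in> bset N x"
    then have "(y, y') \<in> conn G" using u y(1) conn_sym conn_trans by metis
    then show "(z, y') \<in> conn G" using that conn_sym conn_trans by metis
  qed
  have "\<exists>z. axis z \<and> (y, z) \<in> conn G"
  proof (rule ccontr)
    assume no: "\<nexists>z. axis z \<and> (y, z) \<in> conn G"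
    have yy': "(y, y') \<in> conn G" using all[OF conn_refl] y(2) by blast
    have "(y, y') \<in> conn G \<and> zeros y = zeros y'"
    proof (rule conn_invariant[OF _ yy', of "\<lambda>z. (y, z) \<in> conn G \<and> zeros y = zeros z"])
      fix a b assume e: "{a, b} \<in> G" and a: "(y, a) \<in> conn G \<and> zeros y = zeros a"
      then have b: "(y, b) \<in> conn G" using conn_edge[OF e] conn_trans by metis
      have "zeros a = zeros b" by (rule edge_zeros) (use e sub no a b in blast)+
      then show "(y, b) \<in> conn G \<and> zeros y = zeros b" using a b by simp
    qed simp
    then show False using y(3) by simp
  qed
  then obtain z where z: "axis z" "(y, z) \<in> conn G" by blast
  have "height z \<ge> - N"
  proof (rule ccontr)
    assume low: "\<not> height z \<ge> - N"
    then have bz: "bset N z = {z}" by (cases z) (simp add: Let_def)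
    have zz: "z \<in> I0" by (rule axis_I0[OF z(1)])
    have "bset N z \<in> boundary_sets N" using z(1) boundary_sets_eq[OF N(1)] by blast
    then have "bset N z = bset N x"
      by (intro matched_at_unique[OF N(2) zz] S all[OF z(2)]) (simp_all add: bz)
    then have "z = x" by (rule bset_inject[OF z(1) x N(1)])
    then show False using N(3) low by simp
  qed
  then show ?thesis using z(1) all[OF z(2)] by blast
qed

text \<open>Let \<open>A\<close> be the set of points of the axes down to height \<open>-N\<close>. Choosing for each \<open>x \<in> A\<close> a point
  \<open>rep x \<in> A\<close> in the component of the boundary set of \<open>x\<close> gives an injective, hence surjective map of
  the finite set \<open>A\<close> to itself. Two points of \<open>A\<close> are therefore of the form \<open>rep a\<close> and \<open>rep b\<close>, and
  if they are connected, then \<open>a\<close> and \<open>b\<close> have the same boundary set.\<close>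

lemma axis_separated:
  assumes G: "G \<in> groves I0" and xy: "axis x" "axis y" "(x, y) \<in> conn G"
  shows "x = y"
proof -
  obtain N0 where N0: "\<And>N. N \<ge> N0 \<Longrightarrow> matched_at I0 G N" using G unfolding groves_iff by blast
  \<comment> \<open>large enough for the boundary condition, and for \<open>x\<close> and \<open>y\<close> to be counted\<close>
  define N where "N = max (max N0 0) (max (- height x) (- height y))"
  have N: "N \<ge> 0" "matched_at I0 G N" "height x \<ge> - N" "height y \<ge> - N"
    using N0[of N] by (auto simp: N_def)
  define A where "A = {x. axis x \<and> height x \<ge> - N}"
  have fin: "finite A"
  proof (rule finite_subset[OF _ finite_octant_above[of N]])
    show "A \<subseteq> {x \<in> octant. - N \<le> height x}" by (auto simp: A_def octant_iff)
  qed
  have "\<forall>x\<in>A. \<exists>z. z \<in> A \<and> (\<forall>y\<in>bset N x. (z, y) \<in> conn G)"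
    using axis_in_component[OF G _ N(1,2)] unfolding A_def by blast
  then obtain rep where rep: "\<And>x. x \<in> A \<Longrightarrow> rep x \<in> A" "\<And>x y. x \<in> A \<Longrightarrow> y \<in> bset N x \<Longrightarrow> (rep x, y) \<in> conn G"
    by metis
  have sep: "a = b" if "a \<in> A" "b \<in> A" "(rep a, rep b) \<in> conn G" for a b
  proof -
    have ax: "axis a" "axis b" using that by (auto simp: A_def)
    have S: "bset N a \<in> boundary_sets N" "bset N b \<in> boundary_sets N"
      using ax boundary_sets_eq[OF N(1)] by blast+
    have I: "rep a \<in> I0" using rep(1)[OF that(1)] axis_I0 by (auto simp: A_def)
    have "\<forall>y\<in>bset N a. (rep a, y) \<in> conn G" "\<forall>y\<in>bset N b. (rep a, y) \<in> conn G"
      using rep(2) that conn_trans by blast+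
    then have "bset N a = bset N b"
      by (intro matched_at_unique[OF N(2) I] S)
    then show ?thesis by (rule bset_inject[OF ax N(1)])
  qed
  have "inj_on rep A" by (rule inj_onI) (use sep in simp)
  then have "rep ` A = A" using rep(1) fin by (intro endo_inj_surj) auto
  moreover have "x \<in> A" "y \<in> A" using xy N by (simp_all add: A_def)
  ultimately obtain a b where ab: "a \<in> A" "x = rep a" "b \<in> A" "y = rep b"
    by (metis imageE)
  then show ?thesis using sep[OF ab(1,3)] xy(3) by simp
qed

text \<open>Induction on the depth \<open>m\<close> of a rhombus. If all rhombi at smaller depth use short diagonals,
  then points at depth \<open>m\<close> whose rays end in different points are not connected, by
  \<open>axis_separated\<close>. Along the rhombi at depth \<open>m\<close> one proceeds from the middle of the face outwards:
  the long diagonal of a rhombus, together with the short diagonal of the preceding one, would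
  connect two such points; the long diagonal of the rhombus in the middle does so alone.\<close>

lemma unique_grove:
  assumes G: "G \<in> groves I0"
  shows "G = short_grove"
proof -
  have dc: "diag_choice (rhombi_in I0) G" using G by (simp add: groves_iff)
  have "short_diag q (E j k) \<in> G" if "(q, E) \<in> faces" "j \<le> 0" "k \<le> 0" for q E j k
    using that
  proof (induction "nat (- max j k)" arbitrary: q E j k rule: less_induct)
    case less
    define m where "m = - max j k"
    have up: "(E a b, ray_end (E a b)) \<in> conn G"
      if "(q, E) \<in> faces" "a \<le> 0" "b \<le> 0" "max a b = - m" for q E a b
    proof (rule conn_ray_end[OF that(1-3), of m])
      show "short_diag q (E a' b') \<in> G" if "a' \<le> 0" "b' \<le> 0" "max a' b' > - m" for a' b'
      proof (rule less.hyps[OF _ \<open>(q, E) \<in> faces\<close> that(1,2)])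
        show "nat (- max a' b') < nat (- max j k)" using that unfolding m_def by linarith
      qed
    qed (use that in simp)
    have sep: "ray_end x = ray_end y"
      if "(x, ray_end x) \<in> conn G" "(y, ray_end y) \<in> conn G" "(x, y) \<in> conn G" "x \<in> I0" "y \<in> I0" for x y
    proof (rule axis_separated[OF G axis_ray_end axis_ray_end])
      show "(ray_end x, ray_end y) \<in> conn G" using that conn_sym conn_trans by metis
    qed (use that in simp_all)
    \<comment> \<open>\<open>n\<close> is the distance of the rhombus from the middle of the face\<close>
    have sorted: "short_diag q (E j (j - int n)) \<in> G" if E: "(q, E) \<in> faces" "j = - m" "j \<le> 0" for q E j n
      using that(2,3)
    proof (induction n)
      case 0
      show ?case
      proof (rule ccontr)
        assume "short_diag q (E j (j - int 0)) \<notin> G"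
        then have "long_diag q (E j j) \<in> G"
          using diag_choiceD(2)[OF dc face_rhombus[OF E(1,3,3)]] by simp
        then have c: "(E (j - 1) j, E j (j - 1)) \<in> conn G"
          unfolding face_long[OF E(1)] by (rule conn_edge)
        have "ray_end (E (j - 1) j) = ray_end (E j (j - 1))"
          using 0 by (intro sep[OF up[OF E(1)] up[OF E(1)] c] face_I0[OF E(1)]) auto
        then show False using 0 by (simp add: face_ray_end[OF E(1)] face_inject[OF E(1)])
      qed
    next
      case (Suc n)
      define b where "b = j - int n - 1"
      have b: "b < j" "b < 0" using Suc.prems by (simp_all add: b_def)
      show ?case
      proof (rule ccontr)
        assume "short_diag q (E j (j - int (Suc n))) \<notin> G"
        then have ns: "short_diag q (E j b) \<notin> G" by (simp add: b_def algebra_simps)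
        have "(q, E j b) \<in> rhombi_in I0" using face_rhombus[OF E(1)] b Suc.prems by simp
        then have "long_diag q (E j b) \<in> G" using diag_choiceD(2)[OF dc] ns by blast
        then have 1: "(E (j - 1) b, E j (b - 1)) \<in> conn G"
          unfolding face_long[OF E(1)] by (rule conn_edge)
        have "short_diag q (E j (b + 1)) \<in> G" using Suc.IH Suc.prems by (simp add: b_def)
        then have 2: "(E j (b + 1), E (j - 1) b) \<in> conn G"
          unfolding face_short[OF E(1)] by (intro conn_edge) simp
        have "ray_end (E j (b + 1)) = ray_end (E j (b - 1))"
          using b Suc.prems
          by (intro sep[OF up[OF E(1)] up[OF E(1)] conn_trans[OF 2 1]] face_I0[OF E(1)]) auto
        then show False using b Suc.prems by (simp add: face_ray_end[OF E(1)] face_inject[OF E(1)])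
      qed
    qed
    show ?case
    proof (cases "k \<le> j")
      case True
      then show ?thesis using sorted[OF less.prems(1), of j "nat (j - k)"] less.prems by (simp add: m_def)
    next
      case False
      have "(q, \<lambda>a b. E b a) \<in> faces" using less.prems(1) unfolding faces_def by auto
      then show ?thesis
        using sorted[of q "\<lambda>a b. E b a" k "nat (k - j)"] less.prems False by (simp add: m_def)
    qed
  qed
  then have all: "short_diag q u \<in> G" if "(q, u) \<in> rhombi_in I0" for q u
    using face_cover[OF that] by (metis order.trans)
  show ?thesis
  proof (intro equalityI subsetI)
    fix e assume e: "e \<in> G"
    then obtain q u where qu: "(q, u) \<in> rhombi_in I0" "e = long_diag q u \<or> e = short_diag q u"
      using diag_choiceD(1)[OF dc] unfolding diags_def by blast
    then show "e \<in> short_grove" using all[OF qu(1)] diag_choiceD(2)[OF dc qu(1)] e by auto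
  next
    fix e assume "e \<in> short_grove"
    then show "e \<in> G" using all unfolding short_grove_def by auto
  qed
qed

lemma groves_I0: "groves I0 = {short_grove}"
  using unique_grove short_grove_grove by blast

lemma start_grove_eq: "start_grove = short_grove"
  unfolding start_grove_def I0_eq groves_I0 by simp

lemma weight_short_grove: "grove_weight C short_grove = 1"
  unfolding grove_weight_alt long_set_def by simp

lemma degree_short_grove:
  "degree short_grove x = card {(q, u) \<in> rhombi_in I0. u = x \<or> opp_corner q u = x}"
proof -
  have "{e \<in> short_grove. x \<in> e} =
      (\<lambda>(q, u). short_diag q u) ` {(q, u) \<in> rhombi_in I0. u = x \<or> opp_corner q u = x}"
    unfolding short_grove_def short_diag_old by auto
  then show ?thesis
    unfolding degree_def by (simp add: card_image inj_on_def)
qed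

text \<open>Inside a face a vertex is the upper end of one short diagonal and the lower end of another; on an
  axis it is the upper end of two, and at the origin of three.\<close>

lemma degree_short_grove_cases:
  assumes "x \<in> I0"
  shows "degree short_grove x = (if x = (0, 0, 0) then 3 else 2)"
proof -
  obtain i j k where x: "x = (i, j, k)" by (cases x)
  let ?R = "{(q, u) \<in> rhombi_in I0. u = x \<or> opp_corner q u = x}"
  have mem: "(q, u) \<in> ?R \<longleftrightarrow>
      (q = Dir_a \<and> i = 0 \<and> u = x \<or> q = Dir_a \<and> i = 0 \<and> j < 0 \<and> k < 0 \<and> u = (0, j + 1, k + 1)) \<or>
      (q = Dir_b \<and> j = 0 \<and> u = x \<or> q = Dir_b \<and> j = 0 \<and> i < 0 \<and> k < 0 \<and> u = (i + 1, 0, k + 1)) \<or>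
      (q = Dir_c \<and> k = 0 \<and> u = x \<or> q = Dir_c \<and> k = 0 \<and> i < 0 \<and> j < 0 \<and> u = (i + 1, j + 1, 0))" for q u
  proof -
    obtain a b c where u: "u = (a, b, c)" by (cases u)
    show ?thesis using assms unfolding u x by (cases q; simp add: rhombi_I0 I0_iff; arith)
  qed
  have nonpos: "i \<le> 0" "j \<le> 0" "k \<le> 0" "i = 0 \<or> j = 0 \<or> k = 0" using assms by (simp_all add: x I0_iff)
  consider "i = 0" "j = 0" "k = 0" | "i = 0" "j = 0" "k < 0" | "i = 0" "j < 0" "k = 0" | "i < 0" "j = 0" "k = 0"
    | "i = 0" "j < 0" "k < 0" | "i < 0" "j = 0" "k < 0" | "i < 0" "j < 0" "k = 0"
    using nonpos by (cases "i = 0"; cases "j = 0"; cases "k = 0") force+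
  then show ?thesis
  proof cases
    case 1
    then have "?R = {(Dir_a, x), (Dir_b, x), (Dir_c, x)}" using mem by auto
    then show ?thesis unfolding degree_short_grove using 1 by (simp add: x)
  next
    case 2
    then have "?R = {(Dir_a, x), (Dir_b, x)}" using mem by auto
    then show ?thesis unfolding degree_short_grove using 2 by (simp add: x)
  next
    case 3
    then have "?R = {(Dir_a, x), (Dir_c, x)}" using mem by auto
    then show ?thesis unfolding degree_short_grove using 3 by (simp add: x)
  next
    case 4
    then have "?R = {(Dir_b, x), (Dir_c, x)}" using mem by auto
    then show ?thesis unfolding degree_short_grove using 4 by (simp add: x)
  next
    case 5
    then have "?R = {(Dir_a, x), (Dir_a, (0, j + 1, k + 1))}" using mem by auto
    then show ?thesis unfolding degree_short_grove using 5 by (simp add: x)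
  next
    case 6
    then have "?R = {(Dir_b, x), (Dir_b, (i + 1, 0, k + 1))}" using mem by auto
    then show ?thesis unfolding degree_short_grove using 6 by (simp add: x)
  next
    case 7
    then have "?R = {(Dir_c, x), (Dir_c, (i + 1, j + 1, 0))}" using mem by auto
    then show ?thesis unfolding degree_short_grove using 7 by (simp add: x)
  qed
qed

lemma nontrivial_short_grove: "{x \<in> I0. degree short_grove x \<noteq> 2} = {(0, 0, 0)}"
proof (rule set_eqI)
  fix x
  have "(0, 0, 0) \<in> I0" by (simp add: I0_iff)
  then show "x \<in> {x \<in> I0. degree short_grove x \<noteq> 2} \<longleftrightarrow> x \<in> {(0, 0, 0)}"
    using degree_short_grove_cases[of x] by (auto split: if_splits)
qed

lemma monomial_short_grove: "grove_monomial I0 g short_grove = g (0, 0, 0)"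
  unfolding grove_monomial_def nontrivial_short_grove
  by (simp add: degree_short_grove_cases I0_iff)

lemma tame_I0: "tame I0"
  unfolding tame_def groves_I0 by (simp add: nontrivial_short_grove)

section \<open>Sums and distributions along a removal order\<close>

lemma removal_order_tame: "removal_order vs L \<Longrightarrow> tame (init_conds L)"
proof (induction rule: removal_order.induct)
  case start
  then show ?case using tame_I0 by (simp add: I0_def)
next
  case (remove vs L v)
  interpret cube_removal L v using remove removal_order_lower by unfold_locales
  show ?case using tame_remove remove by blast
qed

lemma upper_remove:
  assumes "lower_region L" "v \<in> L"
  shows "upper (L - {v}) = insert v (upper L)" "v \<notin> upper L" "finite (upper L)"
  using assms unfolding lower_region_def by auto

text \<open>The generalized recurrence at one point, over an arbitrary field into which \<open>\<kappa>\<close> maps the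
  coefficients.\<close>

definition gen_cube_at :: "cond \<Rightarrow> (real \<Rightarrow> 'a::field) \<Rightarrow> (pt \<Rightarrow> 'a) \<Rightarrow> pt \<Rightarrow> bool" where
  "gen_cube_at C \<kappa> g v \<longleftrightarrow> g v * g (below v) =
      (\<Sum>q\<in>UNIV. \<kappa> (choice_prob C v q) * (g (new_corner q v) * g (opp_corner q v)))"

context
  fixes C :: cond
  assumes C_pos: "\<forall>q. \<forall>v\<in>octant. C q v > 0" and C_cons: "YDelta_consistent C"
begin

lemma cube_stepI: "removal_order vs L \<Longrightarrow> removable L v \<Longrightarrow> cube_step L v C"
  by unfold_locales (use C_pos C_cons removal_order_lower in auto)

lemma partition_fun_product:
  "removal_order vs L \<Longrightarrow> partition_fun C (init_conds L) = (\<Prod>v\<in>upper L. cube_Delta C v)"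
proof (induction rule: removal_order.induct)
  case start
  then show ?case
    unfolding partition_fun_def I0_def[symmetric] groves_I0 by (simp add: weight_short_grove)
next
  case (remove vs L v)
  interpret cube_step L v C by (rule cube_stepI) fact+
  note U = upper_remove[OF lower v_in_L]
  show ?case
    unfolding partition_fun_remove[OF removal_order_tame[OF remove.hyps(1)]] U(1) remove.IH
    using U(2,3) by simp
qed

lemma cube_Delta_pos: "removal_order vs L \<Longrightarrow> v \<in> upper L \<Longrightarrow> cube_Delta C v > 0"
proof (induction rule: removal_order.induct)
  case (remove vs L u)
  interpret cube_step L u C by (rule cube_stepI) fact+
  show ?case using remove Delta_pos by auto
qed simp

lemma grove_weight_pos: "grove_weight C G > 0"
  unfolding grove_weight_alt using C_pos by (intro prod_pos) (auto simp: long_set_def)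

lemma shuffling_distribution:
  "removal_order vs L \<Longrightarrow> pmf (grove_shuffling C vs) G = prob_cond C (init_conds L) G"
proof (induction arbitrary: G rule: removal_order.induct)
  case start
  then show ?case
    unfolding grove_shuffling_def prob_cond_def partition_fun_def I0_def[symmetric] groves_I0
    by (simp add: weight_short_grove start_grove_eq indicator_def)
next
  case (remove vs L v)
  interpret cube_step L v C by (rule cube_stepI) fact+
  have "grove_shuffling C (vs @ [v]) = bind_pmf (grove_shuffling C vs) (shuffle_step C v)"
    by (simp add: grove_shuffling_def)
  then show ?case
    using shuffle_step_distribution[OF removal_order_tame[OF remove.hyps(1)] remove.IH] by simp
qed

text \<open>As \<open>f (0, 0, 0)\<close> and the product of the values of \<open>cube_Delta\<close> do not depend on the grove, both
  measures are proportional to each other, with the right normalisation.\<close>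

lemma cube_monomial_eq_weight:
  assumes f: "\<forall>v\<in>octant. f v > 0" "cube_recurrence f" "\<forall>q. \<forall>v\<in>octant. cond_of f q v = C q v"
    and "removal_order vs L" "G \<in> groves (init_conds L)"
  shows "grove_monomial (init_conds L) f G * (\<Prod>v\<in>upper L. cube_Delta C v) = f (0, 0, 0) * grove_weight C G"
  using assms(4,5)
proof (induction arbitrary: G rule: removal_order.induct)
  case start
  then show ?case
    unfolding I0_def[symmetric] groves_I0 by (simp add: weight_short_grove monomial_short_grove)
next
  case (remove vs L v)
  interpret cube_step L v C by (rule cube_stepI) fact+
  note U = upper_remove[OF lower v_in_L]
  obtain H P P' where ex: "exchange P P'" and H: "diag_choice rest H" and G: "G = H \<union> new_diags v P'"
    and old: "H \<union> old_diags v P \<in> groves I"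
    using grove_new_cases[OF remove.prems] by blast
  let ?old = "H \<union> old_diags v P"
  let ?D = "\<Prod>v\<in>upper L. cube_Delta C v"
  have step: "grove_monomial I' f G * \<Delta> * grove_weight C ?old = grove_monomial I f ?old * grove_weight C G"
    unfolding G using f by (intro cube_monomial_remove[OF removal_order_tame[OF remove.hyps(1)] _ _ _ ex H old]) auto
  have w: "grove_weight C ?old > 0" by (rule grove_weight_pos)
  have "(grove_monomial I' f G * (\<Delta> * ?D)) * grove_weight C ?old =
      (grove_monomial I f ?old * ?D) * grove_weight C G"
    using step by (simp add: algebra_simps)
  also have "\<dots> = (f (0, 0, 0) * grove_weight C G) * grove_weight C ?old"
    unfolding remove.IH[OF old] by simp
  finally have "grove_monomial I' f G * (\<Delta> * ?D) = f (0, 0, 0) * grove_weight C G"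
    using w by simp
  then show ?case unfolding U(1) using U(2,3) by simp
qed

lemma weighted_sum_groves:
  fixes g :: "pt \<Rightarrow> 'a::field" and \<kappa> :: "real \<Rightarrow> 'a"
  assumes hom: "\<And>x y. \<kappa> (x + y) = \<kappa> x + \<kappa> y" "\<And>x y. \<kappa> (x * y) = \<kappa> x * \<kappa> y" "\<kappa> 1 = 1"
  shows "removal_order vs L \<Longrightarrow> \<forall>v\<in>upper L. gen_cube_at C \<kappa> g v \<Longrightarrow> \<forall>v\<in>upper L \<union> init_conds L. g v \<noteq> 0 \<Longrightarrow>
    (\<Sum>G\<in>groves (init_conds L). \<kappa> (grove_weight C G) * grove_monomial (init_conds L) g G) =
      \<kappa> (\<Prod>v\<in>upper L. cube_Delta C v) * g (0, 0, 0)"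
proof (induction rule: removal_order.induct)
  case start
  then show ?case
    unfolding I0_def[symmetric] groves_I0 by (simp add: weight_short_grove monomial_short_grove hom)
next
  case (remove vs L v)
  interpret cube_step L v C by (rule cube_stepI) fact+
  note U = upper_remove[OF lower v_in_L]
  have sub: "I \<subseteq> insert v I'" unfolding I_insert(2) by blast
  have nz: "\<forall>u\<in>upper L \<union> I. g u \<noteq> 0" "g (below v) \<noteq> 0"
    using remove.prems(2) sub unfolding U(1) I_insert(2) by blast+
  have IH: "(\<Sum>G\<in>groves I. \<kappa> (grove_weight C G) * grove_monomial I g G) =
      \<kappa> (\<Prod>v\<in>upper L. cube_Delta C v) * g (0, 0, 0)"
    using remove.prems(1) nz(1) unfolding U(1) by (intro remove.IH) blast+
  have "gen_cube_at C \<kappa> g v" using remove.prems(1) unfolding U(1) by blast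
  then have "(\<Sum>G\<in>groves I'. \<kappa> (grove_weight C G) * grove_monomial I' g G) =
      \<kappa> \<Delta> * (\<Sum>G\<in>groves I. \<kappa> (grove_weight C G) * grove_monomial I g G)"
    using nz unfolding gen_cube_at_def
    by (intro weighted_sum_remove[OF removal_order_tame[OF remove.hyps(1)] hom]) blast+
  then show ?case unfolding IH U(1) using U(2,3) by (simp add: hom mult.assoc)
qed

end

section \<open>Positive rational functions\<close>

definition nonneg_poly :: "('a \<Rightarrow>\<^sub>0 real) \<Rightarrow> bool" where
  "nonneg_poly p \<longleftrightarrow> (\<forall>k. Poly_Mapping.lookup p k \<ge> 0)"

lemma nonneg_poly_add: "nonneg_poly p \<Longrightarrow> nonneg_poly q \<Longrightarrow> nonneg_poly (p + q)"
  by (simp add: nonneg_poly_def lookup_add)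

lemma nonneg_poly_mult:
  fixes p q :: "'a::monoid_add \<Rightarrow>\<^sub>0 real"
  assumes "nonneg_poly p" "nonneg_poly q"
  shows "nonneg_poly (p * q)"
  using assms unfolding nonneg_poly_def lookup_mult Sum_any.expand_set
  by (intro allI sum_nonneg mult_nonneg_nonneg) (auto simp: when_def)

lemma nonneg_poly_single: "r \<ge> 0 \<Longrightarrow> nonneg_poly (Poly_Mapping.single k r)"
  by (simp add: nonneg_poly_def lookup_single when_def)

lemma nonneg_poly_add_nonzero:
  assumes "nonneg_poly p" "nonneg_poly q" "p \<noteq> 0"
  shows "p + q \<noteq> 0"
proof -
  obtain k where "Poly_Mapping.lookup p k \<noteq> 0"
    using assms(3) by (metis lookup_zero poly_mapping_eqI)
  then have "Poly_Mapping.lookup p k > 0" "Poly_Mapping.lookup q k \<ge> 0"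
    using assms(1,2) by (simp_all add: nonneg_poly_def order_less_le)
  then have "Poly_Mapping.lookup (p + q) k > 0" by (simp add: lookup_add)
  then show ?thesis by (metis less_irrefl lookup_zero)
qed

text \<open>A class of nonzero rational functions that is closed under addition, multiplication and
  division.\<close>

definition pos_rat :: "ratfun \<Rightarrow> bool" where
  "pos_rat x \<longleftrightarrow> (\<exists>p q. x = Fraction_Field.Fract p q \<and> p \<noteq> 0 \<and> q \<noteq> 0 \<and> nonneg_poly p \<and> nonneg_poly q)"

lemma pos_ratI:
  "p \<noteq> 0 \<Longrightarrow> q \<noteq> 0 \<Longrightarrow> nonneg_poly p \<Longrightarrow> nonneg_poly q \<Longrightarrow> pos_rat (Fraction_Field.Fract p q)"
  unfolding pos_rat_def by blast

lemma pos_ratE: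
  assumes "pos_rat x"
  obtains p q where "x = Fraction_Field.Fract p q" "p \<noteq> 0" "q \<noteq> 0" "nonneg_poly p" "nonneg_poly q"
  using assms unfolding pos_rat_def by blast

lemma pos_rat_nonzero: "pos_rat x \<Longrightarrow> x \<noteq> 0"
  by (auto elim!: pos_ratE simp: Zero_fract_def eq_fract)

lemma pos_rat_add:
  assumes "pos_rat x" "pos_rat y"
  shows "pos_rat (x + y)"
proof -
  obtain p q where x: "x = Fraction_Field.Fract p q" "p \<noteq> 0" "q \<noteq> 0" "nonneg_poly p" "nonneg_poly q"
    using assms(1) by (rule pos_ratE)
  obtain p' q' where y: "y = Fraction_Field.Fract p' q'" "p' \<noteq> 0" "q' \<noteq> 0" "nonneg_poly p'" "nonneg_poly q'"
    using assms(2) by (rule pos_ratE)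
  have "x + y = Fraction_Field.Fract (p * q' + p' * q) (q * q')"
    using x y by simp
  moreover have "pos_rat \<dots>"
    using x y by (intro pos_ratI nonneg_poly_add nonneg_poly_mult nonneg_poly_add_nonzero) simp_all
  ultimately show ?thesis by simp
qed

lemma pos_rat_mult:
  assumes "pos_rat x" "pos_rat y"
  shows "pos_rat (x * y)"
proof -
  obtain p q where x: "x = Fraction_Field.Fract p q" "p \<noteq> 0" "q \<noteq> 0" "nonneg_poly p" "nonneg_poly q"
    using assms(1) by (rule pos_ratE)
  obtain p' q' where y: "y = Fraction_Field.Fract p' q'" "p' \<noteq> 0" "q' \<noteq> 0" "nonneg_poly p'" "nonneg_poly q'"
    using assms(2) by (rule pos_ratE)
  show ?thesis
    using x y by (auto intro!: pos_ratI nonneg_poly_mult)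
qed

lemma pos_rat_divide:
  assumes "pos_rat x" "pos_rat y"
  shows "pos_rat (x / y)"
proof -
  obtain p q where x: "x = Fraction_Field.Fract p q" "p \<noteq> 0" "q \<noteq> 0" "nonneg_poly p" "nonneg_poly q"
    using assms(1) by (rule pos_ratE)
  obtain p' q' where y: "y = Fraction_Field.Fract p' q'" "p' \<noteq> 0" "q' \<noteq> 0" "nonneg_poly p'" "nonneg_poly q'"
    using assms(2) by (rule pos_ratE)
  show ?thesis
    using x y by (auto intro!: pos_ratI nonneg_poly_mult)
qed

lemma single_nonzero: "r \<noteq> 0 \<Longrightarrow> Poly_Mapping.single k r \<noteq> 0"
  by (metis lookup_single_eq lookup_zero)

lemma nonneg_poly_one: "nonneg_poly (1 :: (nat \<Rightarrow>\<^sub>0 nat) \<Rightarrow>\<^sub>0 real)"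
  unfolding single_one[symmetric] by (rule nonneg_poly_single) simp

lemma pos_rat_const: "r > 0 \<Longrightarrow> pos_rat (const r)"
  unfolding const_def by (intro pos_ratI nonneg_poly_one nonneg_poly_single single_nonzero) simp_all

lemma pos_rat_indet: "pos_rat (indet v)"
  unfolding indet_def by (intro pos_ratI nonneg_poly_one nonneg_poly_single single_nonzero) simp_all

lemma const_hom:
  "const (x + y) = const x + const y" "const (x * y) = const x * const y" "const 1 = 1"
  by (simp_all add: const_def single_add mult_single One_fract_def)

section \<open>Solutions of the generalized cube recurrence\<close>

lemma gen_cube_solution_iff:
  "gen_cube_solution C L g \<longleftrightarrow>
     (\<forall>v\<in>init_conds L. g v = indet v) \<and> (\<forall>v\<in>upper L. gen_cube_at C const g v)"
proof -
  have "gen_cube_at C const g (i, j, k) \<longleftrightarrow>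
      g (i, j, k) * g (i - 1, j - 1, k - 1) =
          const (cube_U C (i, j, k)) * g (i - 1, j, k) * g (i, j - 1, k - 1) +
          const (cube_V C (i, j, k)) * g (i, j - 1, k) * g (i - 1, j, k - 1) +
          const (cube_W C (i, j, k)) * g (i, j, k - 1) * g (i - 1, j - 1, k)" for i j k
    unfolding gen_cube_at_def by (simp add: sum_dir mult.assoc)
  then show ?thesis unfolding gen_cube_solution_def by fast
qed

text \<open>So the recurrence at points of \<open>upper L\<close> never refers to values outside \<open>upper L\<close> and the initial
  conditions.\<close>

lemma cube_points:
  assumes "lower_region L" "u \<in> upper L"
    and "x = u \<or> x = below u \<or> x = new_corner q u \<or> x = opp_corner q u"
  shows "x \<in> upper L \<union> init_conds L"
proof -
  obtain i j k where u: "u = (i, j, k)" by (cases u)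
  obtain a b c where x: "x = (a, b, c)" by (cases x)
  have le: "a \<le> i" "b \<le> j" "c \<le> k" "i \<le> a + 1" "j \<le> b + 1" "k \<le> c + 1"
    using assms(3) unfolding u x by (cases q; auto)+
  have "(a + 1, b + 1, c + 1) \<notin> L"
    using lower_regionD[OF assms(1), of "a + 1" "b + 1" "c + 1" i j k] le(4-6) assms(2) u by blast
  moreover have "x \<in> octant" using assms(2) le unfolding u x by (simp add: octant_iff)
  ultimately show ?thesis unfolding x by (simp add: init_conds_def)
qed

lemma (in cube_step) choice_prob_pos: "choice_prob C v q > 0"
  unfolding choice_prob_eq using c_pos Delta_pos by (simp add: prod_pos)

lemma (in cube_step) pos_rat_rhs:
  assumes "\<And>u. u \<in> I' \<Longrightarrow> pos_rat (g u)"
  shows "pos_rat (\<Sum>q\<in>UNIV. const (choice_prob C v q) * (g (new_corner q v) * g (opp_corner q v)))"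
  unfolding sum_dir
  by (intro pos_rat_add pos_rat_mult pos_rat_const choice_prob_pos assms)
    (use corners I_insert(2) in blast)+

context
  fixes C :: cond
  assumes C_pos: "\<forall>q. \<forall>v\<in>octant. C q v > 0" and C_cons: "YDelta_consistent C"
begin

lemma solution_pos:
  "removal_order vs L \<Longrightarrow> \<forall>v\<in>upper L. gen_cube_at C const g v \<Longrightarrow> \<forall>v\<in>init_conds L. pos_rat (g v) \<Longrightarrow>
    \<forall>v\<in>upper L. pos_rat (g v)"
proof (induction rule: removal_order.induct)
  case (remove vs L v)
  interpret cube_step L v C by (rule cube_stepI[OF C_pos C_cons]) fact+
  note U = upper_remove[OF lower v_in_L]
  have w: "pos_rat (g (below v))" using remove.prems(2) I_insert(2) by blast
  have "g v * g (below v) = (\<Sum>q\<in>UNIV. const (choice_prob C v q) * (g (new_corner q v) * g (opp_corner q v)))"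
    using remove.prems(1) unfolding U(1) gen_cube_at_def by blast
  then have "pos_rat (g v * g (below v))" using pos_rat_rhs[of g] remove.prems(2) by simp
  from pos_rat_divide[OF this w] have gv: "pos_rat (g v)" using pos_rat_nonzero[OF w] by simp
  have "\<forall>u\<in>I. pos_rat (g u)" using remove.prems(2) gv unfolding I_insert(2) by blast
  then have "\<forall>u\<in>upper L. pos_rat (g u)" using remove.prems(1) unfolding U(1) by (intro remove.IH) blast+
  then show ?case using gv unfolding U(1) by blast
qed simp

text \<open>Induction along the removals, for arbitrary positive initial values. To solve with values \<open>h\<close> on
  the surface after the removal of \<open>v\<close>, use the recurrence at \<open>v\<close> to compute the value at \<open>v\<close>,
  solve on the surface before the removal, and add the given value at \<open>below v\<close>, a point that the
  recurrences at the other cubes do not contain.\<close>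

lemma solution_exists:
  "removal_order vs L \<Longrightarrow> \<forall>v\<in>init_conds L. pos_rat (h v) \<Longrightarrow>
    \<exists>g. (\<forall>v\<in>init_conds L. g v = h v) \<and> (\<forall>v\<in>upper L. gen_cube_at C const g v)"
proof (induction arbitrary: h rule: removal_order.induct)
  case start
  show ?case by (intro exI[of _ h]) simp
next
  case (remove vs L v)
  interpret cube_step L v C by (rule cube_stepI[OF C_pos C_cons]) fact+
  note U = upper_remove[OF lower v_in_L]
  let ?rhs = "\<lambda>g. \<Sum>q\<in>UNIV. const (choice_prob C v q) * (g (new_corner q v) * g (opp_corner q v))"
  define h' where "h' = h(v := ?rhs h / h (below v))"
  have w: "pos_rat (h (below v))" using remove.prems I_insert(2) by blast
  have "pos_rat (?rhs h)" using pos_rat_rhs[of h] remove.prems by blast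
  then have "pos_rat (h' v)" using pos_rat_divide[OF _ w] by (simp add: h'_def)
  then have "\<forall>u\<in>I. pos_rat (h' u)" using remove.prems unfolding I_insert(2) by (auto simp: h'_def)
  from remove.IH[OF this] obtain g where g: "\<forall>u\<in>I. g u = h' u" "\<forall>u\<in>upper L. gen_cube_at C const g u"
    by blast
  define g' where "g' = g(below v := h (below v))"
  have below_out: "below v \<notin> upper L \<union> I"
    using below_in[OF lower removable] by blast
  have g'_eq: "g' u = g u" if "u \<in> upper L \<union> I" for u
    using that below_out by (auto simp: g'_def)
  have on_I': "g' u = h u" if "u \<in> I'" for u
  proof (cases "u = below v")
    case False
    then have "u \<in> I" "u \<noteq> v" using that unfolding I_insert(2) by blast+
    then show ?thesis using g(1) g'_eq[of u] by (simp add: h'_def)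
  qed (simp add: g'_def)
  have "gen_cube_at C const g' u" if u: "u \<in> upper L" for u
  proof -
    have "g' u = g u" "g' (below u) = g (below u)" "g' (new_corner q u) = g (new_corner q u)"
      "g' (opp_corner q u) = g (opp_corner q u)" for q
      by (rule g'_eq, rule cube_points[OF lower u], blast)+
    then show ?thesis using g(2) u unfolding gen_cube_at_def by simp
  qed
  moreover have "gen_cube_at C const g' v"
  proof -
    have "g' v = h' v" using g'_eq[of v] g(1) corners(1) by simp
    moreover have "g' (below v) = h (below v)" by (simp add: g'_def)
    moreover have "?rhs g' = ?rhs h"
      by (intro sum.cong refl) (use on_I' corners I_insert(2) in simp)
    ultimately show ?thesis
      unfolding gen_cube_at_def using pos_rat_nonzero[OF w] by (simp add: h'_def)
  qed
  ultimately show ?case using on_I' unfolding U(1) by blast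
qed

end

theorem theorem2p4:
  fixes C :: cond and f :: "pt \<Rightarrow> real"
  assumes C_pos: "\<forall>q. \<forall>v\<in>octant. C q v > 0"
    and C_cons: "YDelta_consistent C"
    and f_pos: "\<forall>v\<in>octant. f v > 0"
    and f_cube: "cube_recurrence f"
    and f_C: "\<forall>q. \<forall>v\<in>octant. cond_of f q v = C q v"
    and f_axes: "\<forall>i\<le>0. f (i, 0, 0) = 1 \<and> f (0, i, 0) = 1 \<and> f (0, 0, i) = 1"
  shows
    "(\<forall>L. lower_region L \<longrightarrow>
        (\<exists>g. gen_cube_solution C L g) \<and>
        (\<forall>g. gen_cube_solution C L g \<longrightarrow>
           g (0, 0, 0) =
             (\<Sum>G\<in>groves (init_conds L).
                const (prob_cond C (init_conds L) G) * grove_monomial (init_conds L) g G)))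
     \<and> (\<forall>L vs. lower_region L \<and> removal_order vs L \<longrightarrow>
          (\<forall>G. pmf (grove_shuffling C vs) G = prob_cond C (init_conds L) G))
     \<and> (\<forall>L. lower_region L \<longrightarrow>
          (\<forall>G. prob_cond C (init_conds L) G = prob_cube f (init_conds L) G))
     \<and> (\<forall>L. lower_region L \<longrightarrow>
          partition_fun C (init_conds L) = (\<Prod>v\<in>upper L. cube_Delta C v))"
proof (intro conjI allI impI; (elim conjE)?)
  fix L :: "pt set"
  assume L: "lower_region L"
  then obtain vs where vs: "removal_order vs L" using removal_order_exists by blast
  note part = partition_fun_product[OF C_pos C_cons vs]
  have Z: "partition_fun C (init_conds L) > 0"
    unfolding part using cube_Delta_pos[OF C_pos C_cons vs] by (intro prod_pos) blast
  show "partition_fun C (init_conds L) = (\<Prod>v\<in>upper L. cube_Delta C v)" by (rule part)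
  show "\<exists>g. gen_cube_solution C L g"
    using solution_exists[OF C_pos C_cons vs, of indet] pos_rat_indet unfolding gen_cube_solution_iff by blast
  show "g (0, 0, 0) =
      (\<Sum>G\<in>groves (init_conds L). const (prob_cond C (init_conds L) G) * grove_monomial (init_conds L) g G)"
    if "gen_cube_solution C L g" for g
  proof -
    let ?I = "init_conds L" and ?Z = "partition_fun C (init_conds L)"
    have g: "\<forall>v\<in>?I. pos_rat (g v)" "\<forall>v\<in>upper L. gen_cube_at C const g v"
      using that pos_rat_indet unfolding gen_cube_solution_iff by auto
    then have "\<forall>v\<in>upper L. pos_rat (g v)" by (intro solution_pos[OF C_pos C_cons vs])
    then have nz: "\<forall>v\<in>upper L \<union> ?I. g v \<noteq> 0" using g(1) pos_rat_nonzero by blast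
    have "const ?Z * g (0, 0, 0) = (\<Sum>G\<in>groves ?I. const (grove_weight C G) * grove_monomial ?I g G)"
      unfolding part
      by (rule weighted_sum_groves[OF C_pos C_cons const_hom vs g(2) nz, symmetric])
    also have "\<dots> = (\<Sum>G\<in>groves ?I. const ?Z * (const (prob_cond C ?I G) * grove_monomial ?I g G))"
      using Z by (intro sum.cong refl) (simp add: prob_cond_def const_hom(2)[symmetric] mult.assoc[symmetric])
    also have "\<dots> = const ?Z * (\<Sum>G\<in>groves ?I. const (prob_cond C ?I G) * grove_monomial ?I g G)"
      by (rule sum_distrib_left[symmetric])
    finally show ?thesis using pos_rat_nonzero[OF pos_rat_const[OF Z]] by simp
  qed
  show "prob_cond C (init_conds L) G = prob_cube f (init_conds L) G" for G
  proof (cases "G \<in> groves (init_conds L)")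
    case True
    have "f (0, 0, 0) > 0" using f_pos by (simp add: octant_iff)
    then show ?thesis
      using cube_monomial_eq_weight[OF C_pos C_cons f_pos f_cube f_C vs True] Z True
      unfolding prob_cond_def prob_cube_def part by (simp add: field_simps)
  qed (simp add: prob_cond_def prob_cube_def)
next
  fix L vs G
  assume "lower_region L" "removal_order vs L"
  then show "pmf (grove_shuffling C vs) G = prob_cond C (init_conds L) G"
    using shuffling_distribution[OF C_pos C_cons] by blast
qed

end
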